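(* Let $d=2$ and let $(q,r)$ be an admissible pair, i.e. $2\le q,r\le\infty$ and $\frac1q=\frac12\left(\frac12-\frac1r\right)$. Then there exists a constant $C=C_{q,r}>0$, independent of $h$, such that for every $h\in(0,1]$ and every $f\in L^2(h\mathbb Z^2)$, $$\left\|e^{it(-\Delta_h)^2}f\right\|_{L^q_t(\mathbb R;\,L^r(h\mathbb Z^2))}\le C\,\|f\|_{L^2(h\mathbb Z^2)} .$$
   Context: For $h\in(0,1]$, $h\mathbb Z^2=\{hn:n\in\mathbb Z^2\}$ and $\mathbb T_h^2=\frac1h[-\pi,\pi]^2$. For $1\le p<\infty$, $\|f\|_{L^p(h\mathbb Z^2)}=\left(h^2\sum_{x\in h\mathbb Z^2}|f(x)|^p\right)^{1/p}$, and $\|f\|_{L^\infty(h\mathbb Z^2)}=\sup_{x\in h\mathbb Z^2}|f(x)|$. The discrete Laplacian is $(\Delta_h u)(x)=\sum_{j=1}^2 h^{-2}\left(u(x+he_j)+u(x-he_j)-2u(x)\right)$, where $e_1,e_2$ is the standard basis of $\mathbb R^2$. The Fourier transform on $h\mathbb Z^2$ is $\mathcal F(f)(\xi)=h^2\sum_{x\in h\mathbb Z^2}f(x)e^{-ix\cdot\xi}$ for $\xi\in\mathbb T_h^2$ (extended to $L^2(h\mathbb Z^2)$ by Plancherel). The linear propagator is the Fourier multiplier $$\mathcal F\left(e^{it(-\Delta_h)^2}f\right)(\xi)=e^{it\omega(\xi)^4}\mathcal F(f)(\xi),\qquad \omega(\xi)=\frac1h\sqrt{\sum_{j=1}^2(2-2\cos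 h\xi_j)} .$$ *)

theory Defs
  imports "HOL-Probability.Essential_Supremum"
begin

definition lattice :: "real \<Rightarrow> (real^2) set" where
  "lattice h = {h *\<^sub>R (\<chi> j. of_int (n $ j)) | n :: int^2. True}"

definition torus :: "real \<Rightarrow> (real^2) set" where
  "torus h = cbox (\<chi> j. - (pi / h)) (\<chi> j. pi / h)"

(* Real power of an extended nonnegative real, used for exponents a > 0 only. *)
definition enn_powr :: "ennreal \<Rightarrow> real \<Rightarrow> ennreal" where
  "enn_powr x a = (if x = \<infinity> then \<infinity> else ennreal (enn2real x powr a))"

definition lattice_norm :: "real \<Rightarrow> ereal \<Rightarrow> (real^2 \<Rightarrow> complex) \<Rightarrow> ennreal" where
  "lattice_norm h p f =
     (if p = \<infinity> then (SUP x\<in>lattice h. ennreal (cmod (f x)))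
      else enn_powr
             (ennreal (h\<^sup>2) * (\<Sum>\<^sub>\<infinity>x\<in>lattice h. ennreal (cmod (f x) powr real_of_ereal p)))
             (1 / real_of_ereal p))"

(* A function on the lattice is represented by its extension by zero to the plane,
   so that equality of functions is equality on the lattice. *)
definition lattice_L2 :: "real \<Rightarrow> (real^2 \<Rightarrow> complex) set" where
  "lattice_L2 h = {f. (\<forall>x. x \<notin> lattice h \<longrightarrow> f x = 0) \<and> lattice_norm h 2 f < \<infinity>}"

definition fourier :: "real \<Rightarrow> (real^2 \<Rightarrow> complex) \<Rightarrow> real^2 \<Rightarrow> complex" where
  "fourier h f \<xi> = of_real (h\<^sup>2) * (\<Sum>\<^sub>\<infinity>x\<in>lattice h. f x * cis (- (x \<bullet> \<xi>)))"

(* g represents the Plancherel extension of the Fourier transform at f: the transforms of the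
   restrictions of f to finite sets of lattice points converge to g in L^2(torus h).
   Such a g is determined only up to null sets, hence a relation. *)
definition has_fourier_L2 ::
  "real \<Rightarrow> (real^2 \<Rightarrow> complex) \<Rightarrow> (real^2 \<Rightarrow> complex) \<Rightarrow> bool" where
  "has_fourier_L2 h f g \<longleftrightarrow>
     g \<in> borel_measurable (lebesgue_on (torus h)) \<and>
     ((\<lambda>A. \<integral>\<^sup>+ \<xi>. ennreal ((cmod (fourier h (\<lambda>x. if x \<in> A then f x else 0) \<xi> - g \<xi>))\<^sup>2)
              \<partial>lebesgue_on (torus h)) \<longlongrightarrow> 0) (finite_subsets_at_top (lattice h))"

definition omega :: "real \<Rightarrow> real^2 \<Rightarrow> real" where
  "omega h \<xi> = (1 / h) * sqrt (\<Sum>j\<in>UNIV. 2 - 2 * cos (h * \<xi> $ j))"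

(* propagator h t f is e^{it(-Delta_h)^2} f, for f in lattice_L2 h: the unique element of
   lattice_L2 h whose Fourier transform is e^{it omega^4} times that of f. *)
definition propagator :: "real \<Rightarrow> real \<Rightarrow> (real^2 \<Rightarrow> complex) \<Rightarrow> real^2 \<Rightarrow> complex" where
  "propagator h t f =
     (THE u. u \<in> lattice_L2 h \<and>
        (\<exists>g. has_fourier_L2 h f g \<and>
             has_fourier_L2 h u (\<lambda>\<xi>. cis (t * omega h \<xi> ^ 4) * g \<xi>)))"

definition spacetime_norm ::
  "real \<Rightarrow> ereal \<Rightarrow> ereal \<Rightarrow> (real \<Rightarrow> real^2 \<Rightarrow> complex) \<Rightarrow> ennreal" where
  "spacetime_norm h q r u =
     (if q = \<infinity> then esssup lborel (\<lambda>t. lattice_norm h r (u t))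
      else enn_powr
             (\<integral>\<^sup>+ t. enn_powr (lattice_norm h r (u t)) (real_of_ereal q) \<partial>lborel)
             (1 / real_of_ereal q))"

definition admissible :: "ereal \<Rightarrow> ereal \<Rightarrow> bool" where
  "admissible q r \<longleftrightarrow> 2 \<le> q \<and> 2 \<le> r \<and> 1 / q = 1 / 2 * (1 / 2 - 1 / r)"

end

(* Only the endpoint (q, r) = (4, oo) requires work: the bound by the conserved L^2 norm is Bessel's inequality, and
   the other pairs follow by Hoelder's inequality at each time. By duality (TT* ) and the Hardy-Littlewood-Sobolev
   inequality on the line, the endpoint follows from the dispersive bound
     | int over the torus of exp(i (v.xi + t omega(xi)^4)) | <= C |t|^(-1/2),
   which is invariant under the scaling in h, so one may take h = 1. For h = 1 the phase is
   a x + b y + t (4 - 2 cos x - 2 cos y)^2. Away from the origin its Hessian never vanishes, and one application of the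
   van der Corput lemma in a suitable direction (x, y or an antidiagonal) gives the decay t^(-1/2). At the origin, where
   the phase is quartic, the square is cut at the scale of the stationary point.
   The propagator is well defined because the L^2 closure of the trigonometric polynomials is stable under
   multiplication by exp(i t omega^4), an exponential series of trigonometric polynomials. *)
theory Submission
  imports Defs
begin

section \<open>One-dimensional oscillatory integrals\<close>

text \<open>Several requirements meet at the decay exponent 1/2. A homogeneous quartic phase in two
  variables decays like |t|^(-2/4) at its degenerate point, and one direction of nonzero curvature
  yields the same rate elsewhere, even where the Hessian has rank one. Under the substitution xi = p
  / h the time becomes t / h^4 and the Jacobian is h^(-2); at this rate the two powers of h cancel
  exactly. On the time line |t|^(-1/2) is the kernel that maps L^(4/3) to its dual L^4, whence q =
  4. The obstacle in the decay estimate is that the curvature in a fixed direction changes sign on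
  the torus. Cutting the cosines at -1/4 and -3/5 produces cells on each of which one of the three
  directions has curvature of one sign. The obstacle in the duality argument is the supremum over
  lattice points inside the time integral; it is overcome because the decay is uniform in the
  spatial point v, so that the point may vary with time.\<close>

lemma cis_comp_has_vector_derivative:
  assumes "(\<theta> has_real_derivative d) (at x within S)"
  shows "((\<lambda>x. cis (\<theta> x)) has_vector_derivative (\<i> * d * cis (\<theta> x))) (at x within S)"
proof -
  have "((\<lambda>x. cis (\<theta> x)) has_derivative (\<lambda>t. (d * t) *\<^sub>R (\<i> * cis (\<theta> x)))) (at x within S)"
    by (rule derivative_eq_intros refl assms[unfolded has_field_derivative_def])+
  thus ?thesis unfolding has_vector_derivative_def
    by (simp add: scaleR_conv_of_real mult_ac)
qed

text \<open>Integration by parts against \<open>1 / \<theta>'\<close>. Because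
  \<open>\<theta>''\<close> is nonnegative, the modulus of the remainder is the exact derivative of
  \<open>- 1 / \<theta>'\<close> and integrates to endpoint values again. Two endpoint terms from
  the boundary and two from the remainder make the constant 4.\<close>

lemma van_der_Corput_first_closed:
  fixes \<theta> \<theta>' \<theta>'' :: "real \<Rightarrow> real"
  assumes ab: "a \<le> b" and \<delta>: "\<delta> > 0"
    and d1: "\<And>x. (\<theta> has_real_derivative \<theta>' x) (at x)"
    and d2: "\<And>x. (\<theta>' has_real_derivative \<theta>'' x) (at x)"
    and c: "continuous_on UNIV \<theta>''"
    and lower: "\<And>x. x \<in> {a..b} \<Longrightarrow> \<delta> \<le> \<bar>\<theta>' x\<bar>"
    and convex: "\<And>x. x \<in> {a..b} \<Longrightarrow> 0 \<le> \<theta>'' x"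
  shows "cmod (integral {a..b} (\<lambda>x. cis (\<theta> x))) \<le> 4 / \<delta>"
proof -
  have nz: "\<theta>' x \<noteq> 0" if "x \<in> {a..b}" for x using lower[OF that] \<delta> by auto
  have c0: "continuous_on {a..b} \<theta>" "continuous_on {a..b} \<theta>'"
    using d1 d2 by (meson DERIV_isCont continuous_at_imp_continuous_on)+
  have c2: "continuous_on {a..b} \<theta>''" using c continuous_on_subset by blast
  define F where "F = (\<lambda>x. cis (\<theta> x) * complex_of_real (1 / \<theta>' x) / \<i>)"
  define R where "R = (\<lambda>x. cis (\<theta> x) * complex_of_real (\<theta>'' x / (\<theta>' x)\<^sup>2) / \<i>)"
  have g': "((\<lambda>x. 1 / \<theta>' x) has_real_derivative (- \<theta>'' x / (\<theta>' x)\<^sup>2)) (at x within {a..b})"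
    if "x \<in> {a..b}" for x
    using nz[OF that] by (auto intro!: derivative_eq_intros DERIV_subset[OF d2] simp: power2_eq_square)
  have F': "(F has_vector_derivative (cis (\<theta> x) - R x)) (at x within {a..b})" if x: "x \<in> {a..b}" for x
  proof -
    have "((\<lambda>x. complex_of_real (1 / \<theta>' x)) has_vector_derivative
       complex_of_real (- \<theta>'' x / (\<theta>' x)\<^sup>2)) (at x within {a..b})"
      using g'[OF x] has_vector_derivative_of_real has_real_derivative_iff_has_vector_derivative by blast
    from has_vector_derivative_mult[OF cis_comp_has_vector_derivative[OF DERIV_subset[OF d1 subset_UNIV]] this]
    have "((\<lambda>x. cis (\<theta> x) * complex_of_real (1 / \<theta>' x)) has_vector_derivative
      (cis (\<theta> x) * complex_of_real (- \<theta>'' x / (\<theta>' x)\<^sup>2) + \<i> * \<theta>' x * cis (\<theta> x) * complex_of_real (1 / \<theta>' x)))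
       (at x within {a..b})" .
    note F1 = has_vector_derivative_divide[OF this, of \<i>]
    show ?thesis
      unfolding F_def R_def
      by (rule has_vector_derivative_eq_rhs[OF F1]) (use nz[OF x] in \<open>simp add: field_simps\<close>)
  qed
  have "((\<lambda>x. cis (\<theta> x) - R x) has_integral (F b - F a)) {a..b}"
    by (rule fundamental_theorem_of_calculus[OF ab F'])
  moreover have cR: "continuous_on {a..b} R"
    unfolding R_def using nz by (auto intro!: continuous_intros c0 c2)
  have intR: "R integrable_on {a..b}" by (rule integrable_continuous_real[OF cR])
  ultimately have "((\<lambda>x. (cis (\<theta> x) - R x) + R x) has_integral (F b - F a + integral {a..b} R)) {a..b}"
    by (intro has_integral_add) (auto simp: integrable_integral)
  hence eq: "integral {a..b} (\<lambda>x. cis (\<theta> x)) = F b - F a + integral {a..b} R"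
    by (auto intro: integral_unique)
  have i2: "((\<lambda>x. \<theta>'' x / (\<theta>' x)\<^sup>2) has_integral (- (1 / \<theta>' b) - - (1 / \<theta>' a))) {a..b}"
    by (rule fundamental_theorem_of_calculus[OF ab])
      (auto intro!: derivative_eq_intros g'[THEN has_real_derivative_iff_has_vector_derivative[THEN iffD1]])
  have "norm (integral {a..b} R) \<le> integral {a..b} (\<lambda>x. \<theta>'' x / (\<theta>' x)\<^sup>2)"
    using i2 intR convex
    by (intro integral_norm_bound_integral) (auto simp: R_def norm_mult norm_divide norm_power)
  also have "\<dots> = 1 / \<theta>' a - 1 / \<theta>' b" using i2 by (simp add: integral_unique)
  also have "\<dots> \<le> \<bar>1 / \<theta>' a\<bar> + \<bar>1 / \<theta>' b\<bar>" by linarith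
  finally have nR: "norm (integral {a..b} R) \<le> \<bar>1 / \<theta>' a\<bar> + \<bar>1 / \<theta>' b\<bar>" .
  have inv: "\<bar>1 / \<theta>' x\<bar> \<le> 1 / \<delta>" if "x \<in> {a..b}" for x
    using lower[OF that] \<delta> by (simp add: frac_le)
  have nF: "norm (F x) = \<bar>1 / \<theta>' x\<bar>" for x by (simp add: F_def norm_mult norm_divide)
  have "norm (F b - F a + integral {a..b} R) \<le> norm (F b) + norm (F a) + norm (integral {a..b} R)"
    by (meson norm_triangle_ineq norm_triangle_ineq4 add_mono order_trans order_refl)
  also have "\<dots> \<le> 1/\<delta> + 1/\<delta> + (1/\<delta> + 1/\<delta>)"
    unfolding nF using nR inv[of a] inv[of b] ab by (intro add_mono) auto
  finally show ?thesis unfolding eq by simp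
qed

text \<open>The derivative \<open>\<theta>'\<close> grows at rate at least \<open>\<kappa>\<close>
  away from some point z. Beyond distance \<open>1 / sqrt \<kappa>\<close> from z it is at least
  \<open>sqrt \<kappa>\<close>, and the first derivative test gives \<open>4 / sqrt \<kappa>\<close>
  on either side; the window in between contributes at most its length,
  \<open>2 / sqrt \<kappa>\<close>.\<close>

lemma van_der_Corput_second_closed:
  fixes \<theta> \<theta>' \<theta>'' :: "real \<Rightarrow> real"
  assumes ab: "a \<le> b" and \<kappa>: "\<kappa> > 0"
    and d1: "\<And>x. (\<theta> has_real_derivative \<theta>' x) (at x)"
    and d2: "\<And>x. (\<theta>' has_real_derivative \<theta>'' x) (at x)"
    and c: "continuous_on UNIV \<theta>''"
    and lower: "\<And>x. x \<in> {a..b} \<Longrightarrow> \<kappa> \<le> \<theta>'' x"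
  shows "cmod (integral {a..b} (\<lambda>x. cis (\<theta> x))) \<le> 10 / sqrt \<kappa>"
proof -
  have incr: "\<theta>' y - \<theta>' x \<ge> \<kappa> * (y - x)" if "a \<le> x" "x \<le> y" "y \<le> b" for x y
  proof -
    have "\<theta>' x - \<kappa> * x \<le> \<theta>' y - \<kappa> * y"
    proof (rule DERIV_nonneg_imp_nondecreasing[OF that(2)])
      fix u assume "x \<le> u" "u \<le> y"
      hence "\<kappa> \<le> \<theta>'' u" using lower that by auto
      thus "\<exists>y. ((\<lambda>a. \<theta>' a - \<kappa> * a) has_real_derivative y) (at u) \<and> 0 \<le> y"
        by (intro exI[of _ "\<theta>'' u - \<kappa>"]) (auto intro!: derivative_eq_intros d2)
    qed
    thus ?thesis by (simp add: algebra_simps)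
  qed
  have c1: "continuous_on {a..b} \<theta>'" and c0: "continuous_on {a..b} \<theta>"
    using d1 d2 by (meson DERIV_isCont continuous_at_imp_continuous_on)+
  obtain z where z: "z \<in> {a..b}" and zl: "\<And>x. x \<in> {a..b} \<Longrightarrow> \<kappa> * \<bar>x - z\<bar> \<le> \<bar>\<theta>' x\<bar>"
  proof -
    \<comment> \<open>If the increasing function \<open>\<theta>'\<close> has no zero in the
      interval, the endpoint where its modulus is least takes the place of the zero.\<close>
    consider "\<theta>' a \<ge> 0" | "\<theta>' b \<le> 0" | "\<theta>' a \<le> 0" "\<theta>' b \<ge> 0" by linarith
    thus ?thesis
    proof cases
      case 1
      show ?thesis using ab 1 incr[of a] by (intro that[of a]) force+
    next
      case 2
      have "\<kappa> * \<bar>x - b\<bar> \<le> \<bar>\<theta>' x\<bar>" if "x \<in> {a..b}" for x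
      proof -
        have "0 \<le> \<kappa> * (b - x)" using \<kappa> that by simp
        thus ?thesis using incr[of x b] that 2 by (simp add: abs_if algebra_simps)
      qed
      thus ?thesis using ab by (intro that[of b]) auto
    next
      case 3
      then obtain z where z: "a \<le> z" "z \<le> b" "\<theta>' z = 0"
        using IVT'[of \<theta>' a 0 b] ab c1 by auto
      have "\<kappa> * \<bar>x - z\<bar> \<le> \<bar>\<theta>' x\<bar>" if "x \<in> {a..b}" for x
      proof (cases "x \<le> z")
        case True
        hence "0 \<le> \<kappa> * (z - x)" using \<kappa> by simp
        thus ?thesis using incr[of x z] z that True by (simp add: abs_if algebra_simps)
      next
        case False
        hence "0 \<le> \<kappa> * (x - z)" using \<kappa> by simp
        thus ?thesis using incr[of z x] z that False by (simp add: abs_if algebra_simps)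
      qed
      thus ?thesis using z by (intro that[of z]) auto
    qed
  qed
  define \<eta> where "\<eta> = 1 / sqrt \<kappa>"
  have \<eta>: "\<eta> > 0" "\<kappa> * \<eta> = sqrt \<kappa>" using \<kappa> by (auto simp: \<eta>_def real_div_sqrt)
  define p q where "p = max a (z - \<eta>)" and "q = min b (z + \<eta>)"
  have pq: "a \<le> p" "p \<le> q" "q \<le> b" using z \<eta> by (auto simp: p_def q_def)
  have cc: "continuous_on {a..b} (\<lambda>x. cis (\<theta> x))" by (intro continuous_intros c0)
  have I: "(\<lambda>x. cis (\<theta> x)) integrable_on {x..y}" if "a \<le> x" "y \<le> b" for x y
    using that by (intro integrable_continuous_real continuous_on_subset[OF cc]) auto
  let ?I = "\<lambda>S. integral S (\<lambda>x. cis (\<theta> x))"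
  have split: "?I {a..b} = ?I {a..p} + (?I {p..q} + ?I {q..b})"
    using Henstock_Kurzweil_Integration.integral_combine[OF pq(1) order_trans[OF pq(2,3)] I[of a b]]
      Henstock_Kurzweil_Integration.integral_combine[OF pq(2,3) I[of p b]] pq by simp
  have 1: "cmod (?I {a..p}) \<le> 4 / sqrt \<kappa>"
  proof (cases "z - \<eta> < a")
    case True thus ?thesis using \<kappa> by (simp add: p_def)
  next
    case False
    show ?thesis
    proof (rule van_der_Corput_first_closed[OF pq(1) _ d1 d2 c])
      fix x assume x: "x \<in> {a..p}"
      show "0 \<le> \<theta>'' x" using lower[of x] x pq \<kappa> by auto
      have "\<eta> \<le> \<bar>x - z\<bar>" using x False by (auto simp: p_def)
      hence "\<kappa> * \<eta> \<le> \<kappa> * \<bar>x - z\<bar>" using \<kappa> by simp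
      thus "sqrt \<kappa> \<le> \<bar>\<theta>' x\<bar>" using zl[of x] x pq \<eta> by auto
    qed (use \<kappa> in auto)
  qed
  have 3: "cmod (?I {q..b}) \<le> 4 / sqrt \<kappa>"
  proof (cases "z + \<eta> > b")
    case True thus ?thesis using \<kappa> by (simp add: q_def)
  next
    case False
    show ?thesis
    proof (rule van_der_Corput_first_closed[OF pq(3) _ d1 d2 c])
      fix x assume x: "x \<in> {q..b}"
      show "0 \<le> \<theta>'' x" using lower[of x] x pq \<kappa> by auto
      have "\<eta> \<le> \<bar>x - z\<bar>" using x False by (auto simp: q_def)
      hence "\<kappa> * \<eta> \<le> \<kappa> * \<bar>x - z\<bar>" using \<kappa> by simp
      thus "sqrt \<kappa> \<le> \<bar>\<theta>' x\<bar>" using zl[of x] x pq \<eta> by auto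
    qed (use \<kappa> in auto)
  qed
  have "cmod (?I {p..q}) \<le> integral {p..q} (\<lambda>_. 1)"
    by (rule integral_norm_bound_integral) (use I[of p q] pq in \<open>auto intro: integrable_on_const\<close>)
  also have "\<dots> \<le> 2 / sqrt \<kappa>" using pq by (simp add: p_def q_def \<eta>_def)
  finally have 2: "cmod (?I {p..q}) \<le> 2 / sqrt \<kappa>" .
  have "cmod (?I {a..b}) \<le> cmod (?I {a..p}) + (cmod (?I {p..q}) + cmod (?I {q..b}))"
    unfolding split by (meson norm_triangle_ineq norm_triangle_mono order_refl)
  also have "\<dots> \<le> 4 / sqrt \<kappa> + (2 / sqrt \<kappa> + 4 / sqrt \<kappa>)" using 1 2 3 by (intro add_mono)
  finally show ?thesis by simp
qed

text \<open>Slices of the planar cells are intervals that may or may not contain their endpoints.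
  Enclosing them between an open and a closed interval lets the closed versions of the tests apply
  up to two points.\<close>

lemma bounded_interval_cases:
  fixes S :: "real set"
  assumes "is_interval S" "bounded S"
  obtains a b where "a \<le> b" "{a<..<b} \<subseteq> S" "S \<subseteq> {a..b}"
proof (cases "S = {}")
  case True thus ?thesis using that[of 0 0] by auto
next
  case False
  have bdd: "bdd_above S" "bdd_below S" using assms(2) bounded_imp_bdd_above bounded_imp_bdd_below by auto
  have "{Inf S<..<Sup S} \<subseteq> S"
  proof
    fix x assume x: "x \<in> {Inf S<..<Sup S}"
    then obtain u v where "u \<in> S" "u < x" "v \<in> S" "x < v"
      using cInf_lessD[OF False] less_cSupD[OF False] by (metis greaterThanLessThan_iff)
    thus "x \<in> S" using assms(1) unfolding is_interval_1 by (meson less_imp_le)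
  qed
  thus ?thesis using bdd False
    by (intro that[of "Inf S" "Sup S"]) (auto intro: cInf_lower cSup_upper cInf_le_cSup)
qed

lemma set_integral_interval:
  fixes f :: "real \<Rightarrow> complex"
  assumes "a \<le> b" "{a<..<b} \<subseteq> S" "S \<subseteq> {a..b}" "continuous_on UNIV f"
  shows "(LINT x:S|lborel. f x) = integral {a..b} f"
proof -
  have "S = {a<..<b} \<union> (S \<inter> {a,b})"
    using assms(2,3) atLeastAtMost_iff less_le by (fastforce simp: subset_iff)
  moreover have "{a<..<b} \<union> (S \<inter> {a,b}) \<in> sets borel"
    by (intro sets.Un borel_open open_greaterThanLessThan borel_closed finite_imp_closed) auto
  ultimately have [measurable]: "S \<in> sets borel" by simp
  have [measurable]: "f \<in> borel_measurable borel" by (rule borel_measurable_continuous_onI[OF assms(4)])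
  have "(LINT x:S|lborel. f x) = (LINT x:{a..b}|lborel. f x)"
    unfolding set_lebesgue_integral_def
  proof (rule integral_cong_AE)
    have "AE x in lborel. x \<noteq> a \<and> x \<noteq> b"
      using AE_lborel_singleton[of a] AE_lborel_singleton[of b] by eventually_elim auto
    thus "AE x in lborel. indicator S x *\<^sub>R f x = indicator {a..b} x *\<^sub>R f x"
    proof eventually_elim
      fix x assume "x \<noteq> a \<and> x \<noteq> b"
      hence "x \<in> S \<longleftrightarrow> x \<in> {a..b}" using assms(2,3)
        by (metis atLeastAtMost_iff greaterThanLessThan_iff less_le subset_iff)
      thus "indicator S x *\<^sub>R f x = indicator {a..b} x *\<^sub>R f x" by (simp add: indicator_def)
    qed
  qed simp_all
  also have "\<dots> = integral {a..b} f"
    by (rule set_borel_integral_eq_integral)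
      (simp add: set_integrable_def borel_integrable_compact continuous_on_subset[OF assms(4)])
  finally show ?thesis .
qed

text \<open>Carries the derivative bounds, which are known on a slice only, over to its closed hull
  by continuity.\<close>

lemma ge_on_closed_interval_from_interior:
  fixes f :: "real \<Rightarrow> real"
  assumes "a < b" "continuous_on UNIV f" "\<And>x. x \<in> {a<..<b} \<Longrightarrow> k \<le> f x" "x \<in> {a..b}"
  shows "k \<le> f x"
proof -
  have "closed {x. k \<le> f x}" by (intro closed_Collect_le continuous_intros assms)
  hence "closure {a<..<b} \<subseteq> {x. k \<le> f x}" using assms(3) by (intro closure_minimal) auto
  thus ?thesis using assms by auto
qed

lemma van_der_Corput_first:
  fixes \<theta> \<theta>' \<theta>'' :: "real \<Rightarrow> real"
  assumes S: "is_interval S" "bounded S" and \<delta>: "\<delta> > 0"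
    and d1: "\<And>x. (\<theta> has_real_derivative \<theta>' x) (at x)"
    and d2: "\<And>x. (\<theta>' has_real_derivative \<theta>'' x) (at x)"
    and c: "continuous_on UNIV \<theta>''"
    and lower: "\<And>x. x \<in> S \<Longrightarrow> \<delta> \<le> \<bar>\<theta>' x\<bar>"
    and convex: "\<And>x. x \<in> S \<Longrightarrow> 0 \<le> \<theta>'' x"
  shows "cmod (LINT x:S|lborel. cis (\<theta> x)) \<le> 4 / \<delta>"
proof -
  obtain a b where ab: "a \<le> b" "{a<..<b} \<subseteq> S" "S \<subseteq> {a..b}" using bounded_interval_cases[OF S] .
  have c1: "continuous_on UNIV \<theta>'" and c0: "continuous_on UNIV \<theta>"
    using d1 d2 by (meson DERIV_isCont continuous_at_imp_continuous_on)+
  have eq: "(LINT x:S|lborel. cis (\<theta> x)) = integral {a..b} (\<lambda>x. cis (\<theta> x))"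
    by (rule set_integral_interval[OF ab]) (intro continuous_intros c0)
  show ?thesis
  proof (cases "a = b")
    case True thus ?thesis unfolding eq using \<delta> by simp
  next
    case False
    hence "a < b" using ab by simp
    note ext = ge_on_closed_interval_from_interior[OF this]
    show ?thesis unfolding eq
    proof (rule van_der_Corput_first_closed[OF ab(1) \<delta> d1 d2 c])
      fix x assume x: "x \<in> {a..b}"
      show "\<delta> \<le> \<bar>\<theta>' x\<bar>"
        by (rule ext[OF _ _ x]) (use ab lower in \<open>auto intro!: continuous_intros c1\<close>)
      show "0 \<le> \<theta>'' x" by (rule ext[OF c _ x]) (use ab convex in auto)
    qed
  qed
qed

lemma van_der_Corput_second:
  fixes \<theta> \<theta>' \<theta>'' :: "real \<Rightarrow> real"
  assumes S: "is_interval S" "bounded S" and \<kappa>: "\<kappa> > 0"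
    and d1: "\<And>x. (\<theta> has_real_derivative \<theta>' x) (at x)"
    and d2: "\<And>x. (\<theta>' has_real_derivative \<theta>'' x) (at x)"
    and c: "continuous_on UNIV \<theta>''"
    and lower: "\<And>x. x \<in> S \<Longrightarrow> \<kappa> \<le> \<theta>'' x"
  shows "cmod (LINT x:S|lborel. cis (\<theta> x)) \<le> 10 / sqrt \<kappa>"
proof -
  obtain a b where ab: "a \<le> b" "{a<..<b} \<subseteq> S" "S \<subseteq> {a..b}" using bounded_interval_cases[OF S] .
  have c0: "continuous_on UNIV \<theta>"
    using d1 by (meson DERIV_isCont continuous_at_imp_continuous_on)
  have eq: "(LINT x:S|lborel. cis (\<theta> x)) = integral {a..b} (\<lambda>x. cis (\<theta> x))"
    by (rule set_integral_interval[OF ab]) (intro continuous_intros c0)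
  show ?thesis
  proof (cases "a = b")
    case True thus ?thesis unfolding eq using \<kappa> by simp
  next
    case False
    hence "a < b" using ab by simp
    note ext = ge_on_closed_interval_from_interior[OF this]
    show ?thesis unfolding eq
    proof (rule van_der_Corput_second_closed[OF ab(1) \<kappa> d1 d2 c])
      fix x assume x: "x \<in> {a..b}"
      show "\<kappa> \<le> \<theta>'' x" by (rule ext[OF c _ x]) (use ab lower in auto)
    qed
  qed
qed

lemma set_integral_cis_uminus:
  "(LINT x:S|M. cis (- \<theta> x)) = cnj (LINT x:S|M. cis (\<theta> x))"
  unfolding set_lebesgue_integral_def
  by (subst Bochner_Integration.integral_cnj[symmetric]) (simp add: cis_cnj)

lemma van_der_Corput_second_neg:
  fixes \<theta> \<theta>' \<theta>'' :: "real \<Rightarrow> real"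
  assumes S: "is_interval S" "bounded S" and \<kappa>: "\<kappa> > 0"
    and d1: "\<And>x. (\<theta> has_real_derivative \<theta>' x) (at x)"
    and d2: "\<And>x. (\<theta>' has_real_derivative \<theta>'' x) (at x)"
    and c: "continuous_on UNIV \<theta>''"
    and upper: "\<And>x. x \<in> S \<Longrightarrow> \<theta>'' x \<le> - \<kappa>"
  shows "cmod (LINT x:S|lborel. cis (\<theta> x)) \<le> 10 / sqrt \<kappa>"
proof -
  have "cmod (LINT x:S|lborel. cis (- \<theta> x)) \<le> 10 / sqrt \<kappa>"
    using upper by (intro van_der_Corput_second[OF S \<kappa>, where \<theta>' = "\<lambda>x. - \<theta>' x" and \<theta>'' = "\<lambda>x. - \<theta>'' x"])
      (force intro!: derivative_eq_intros d1 d2 continuous_intros c)+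
  thus ?thesis by (simp add: set_integral_cis_uminus)
qed

section \<open>Oscillatory integrals over planar regions\<close>

lemma borel_measurable_fst_snd [measurable]:
  "fst \<in> borel_measurable (borel :: (real \<times> real) measure)"
  "snd \<in> borel_measurable (borel :: (real \<times> real) measure)"
  by (auto intro!: borel_measurable_continuous_onI continuous_intros)

lemma borel_measurable_cis [measurable]:
  "f \<in> borel_measurable M \<Longrightarrow> (\<lambda>x. cis (f x)) \<in> borel_measurable M"
  by (rule borel_measurable_continuous_on[of cis]) (intro continuous_intros)

lemma integrable_cis_region:
  fixes \<theta> :: "real \<times> real \<Rightarrow> real"
  assumes "continuous_on UNIV \<theta>" "E \<in> sets borel" "bounded E"
  shows "integrable lborel (\<lambda>p. indicator E p *\<^sub>R cis (\<theta> p))"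
proof -
  have [measurable]: "\<theta> \<in> borel_measurable borel" "E \<in> sets borel"
    using assms borel_measurable_continuous_onI by auto
  have "emeasure lborel E < \<infinity>" using assms(3) emeasure_bounded_finite by blast
  hence "integrable lborel (\<lambda>p. indicat_real E p)" by (simp add: integrable_indicator_iff)
  moreover have "(\<lambda>p. indicator E p *\<^sub>R cis (\<theta> p)) \<in> borel_measurable lborel"
    by measurable
  ultimately show ?thesis
    by (rule Bochner_Integration.integrable_bound) (auto simp: indicator_def)
qed

text \<open>The bound may vary with the slice: in \<open>phase_near_zero\<close> it is a Cauchy
  kernel, whose integral does not grow with the width of the region.\<close>

lemma slice_bound:
  fixes \<theta> :: "real \<times> real \<Rightarrow> real" and b :: "real \<Rightarrow> real"
  assumes \<theta>: "continuous_on UNIV \<theta>" and E: "E \<in> sets borel" "bounded E"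
    and le: "\<And>y. cmod (LINT x:{x. (x, y) \<in> E}|lborel. cis (\<theta> (x, y))) \<le> b y"
    and B: "(\<integral>\<^sup>+y. ennreal (b y) \<partial>lborel) \<le> ennreal B" "0 \<le> B"
  shows "cmod (LINT p:E|lborel. cis (\<theta> p)) \<le> B"
proof -
  define f where "f = (\<lambda>x y. indicator E (x, y) *\<^sub>R cis (\<theta> (x, y)))"
  have int: "integrable (lborel \<Otimes>\<^sub>M lborel) (case_prod f)"
    using integrable_cis_region[OF \<theta> E] by (simp add: lborel_prod f_def case_prod_beta')
  have "(LINT p:E|lborel. cis (\<theta> p)) = integral\<^sup>L (lborel \<Otimes>\<^sub>M lborel) (case_prod f)"
    by (simp add: set_lebesgue_integral_def lborel_prod f_def case_prod_beta')
  also have "\<dots> = (LINT y|lborel. LINT x|lborel. f x y)"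
    using lborel_pair.integral_snd[OF int] by simp
  finally have eq: "(LINT p:E|lborel. cis (\<theta> p)) = (LINT y|lborel. LINT x|lborel. f x y)" .
  have "ennreal (cmod (LINT y|lborel. LINT x|lborel. f x y)) \<le> (\<integral>\<^sup>+y. ennreal (cmod (LINT x|lborel. f x y)) \<partial>lborel)"
    by (rule integral_norm_bound_ennreal[OF lborel_pair.integrable_snd[OF int]])
  also have "\<dots> \<le> (\<integral>\<^sup>+y. ennreal (b y) \<partial>lborel)"
  proof (intro nn_integral_mono ennreal_leI)
    fix y
    show "cmod (LINT x|lborel. f x y) \<le> b y"
      using le[of y] unfolding set_lebesgue_integral_def f_def by (simp add: indicator_def)
  qed
  finally show ?thesis unfolding eq using B by (meson ennreal_le_iff order_trans)
qed

lemma set_integral_swap: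
  fixes \<theta> :: "real \<times> real \<Rightarrow> real"
  assumes \<theta>: "continuous_on UNIV \<theta>" and E: "E \<in> sets borel" "bounded E"
  shows "(LINT p:E|lborel. cis (\<theta> p)) = (LINT p:prod.swap ` E|lborel. cis (\<theta> (prod.swap p)))"
proof -
  have int: "integrable (lborel \<Otimes>\<^sub>M lborel) (\<lambda>p. indicator E p *\<^sub>R cis (\<theta> p))"
    using integrable_cis_region[OF \<theta> E] by (simp add: lborel_prod)
  have [simp]: "p \<in> prod.swap ` E \<longleftrightarrow> (snd p, fst p) \<in> E" for p by (cases p) force
  have ind: "indicat_real (prod.swap ` E) p *\<^sub>R cis (\<theta> (prod.swap p)) =
      indicat_real E (snd p, fst p) *\<^sub>R cis (\<theta> (snd p, fst p))" for p
    by (cases p) (simp add: indicator_def)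
  show ?thesis
    unfolding set_lebesgue_integral_def ind
    using lborel_pair.integral_product_swap[OF borel_measurable_integrable[OF int]]
    by (simp add: lborel_prod case_prod_beta')
qed

lemma swap_image_borel:
  fixes E :: "(real \<times> real) set"
  assumes "E \<in> sets borel" "bounded E"
  shows "prod.swap ` E \<in> sets borel" "bounded (prod.swap ` E)"
proof -
  have eq: "prod.swap ` E = prod.swap -` E" by (force simp: image_iff)
  have "prod.swap \<in> borel_measurable (borel :: (real \<times> real) measure)"
    unfolding prod.swap_def by (auto intro!: borel_measurable_continuous_onI continuous_intros)
  thus "prod.swap ` E \<in> sets borel" unfolding eq using assms(1) measurable_sets[of prod.swap borel borel E] by simp
  have "norm (prod.swap p) = norm p" for p :: "real \<times> real"
    by (simp add: norm_prod_def prod.swap_def add.commute)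
  thus "bounded (prod.swap ` E)" using assms(2) by (simp add: bounded_iff)
qed

lemma slice_bound':
  fixes \<theta> :: "real \<times> real \<Rightarrow> real" and b :: "real \<Rightarrow> real"
  assumes \<theta>: "continuous_on UNIV \<theta>" and E: "E \<in> sets borel" "bounded E"
    and le: "\<And>x. cmod (LINT y:{y. (x, y) \<in> E}|lborel. cis (\<theta> (x, y))) \<le> b x"
    and B: "(\<integral>\<^sup>+x. ennreal (b x) \<partial>lborel) \<le> ennreal B" "0 \<le> B"
  shows "cmod (LINT p:E|lborel. cis (\<theta> p)) \<le> B"
  unfolding set_integral_swap[OF \<theta> E]
proof (rule slice_bound[OF _ swap_image_borel[OF E] _ B])
  show "continuous_on UNIV (\<lambda>p. \<theta> (prod.swap p))"
    unfolding prod.swap_def by (intro continuous_on_compose2[OF \<theta>] continuous_intros) auto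
  have "{y. (y, x) \<in> prod.swap ` E} = {y. (x, y) \<in> E}" for x by (force simp: image_iff)
  thus "cmod (LINT x:{x. (x, y) \<in> prod.swap ` E}|lborel. cis (\<theta> (prod.swap (x, y)))) \<le> b y" for y
    using le[of y] by simp
qed

lemma strip_bound_nn_integral:
  assumes "0 \<le> K" "0 \<le> (w::real)"
  shows "(\<integral>\<^sup>+y. ennreal (K * indicator {0..w} y) \<partial>lborel) \<le> ennreal (K * w)"
proof -
  have "(\<integral>\<^sup>+y. ennreal (K * indicator {0..w} y) \<partial>lborel) = (\<integral>\<^sup>+y. ennreal K * indicator {0..w} y \<partial>lborel)"
    using assms by (intro nn_integral_cong) (auto simp: indicator_def)
  also have "\<dots> = ennreal (K * w)"
    using assms by (simp add: nn_integral_cmult_indicator ennreal_mult)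
  finally show ?thesis by simp
qed

lemma strip_slice_bound:
  fixes \<theta> :: "real \<times> real \<Rightarrow> real"
  assumes \<theta>: "continuous_on UNIV \<theta>" and E: "E \<in> sets borel" "bounded E" and K: "0 \<le> K" "0 \<le> w"
    and strip: "\<And>x y. (x, y) \<in> E \<Longrightarrow> y \<in> {0..w}"
    and le: "\<And>y. y \<in> {0..w} \<Longrightarrow> cmod (LINT x:{x. (x, y) \<in> E}|lborel. cis (\<theta> (x, y))) \<le> K"
  shows "cmod (LINT p:E|lborel. cis (\<theta> p)) \<le> K * w"
proof (rule slice_bound[OF \<theta> E _ strip_bound_nn_integral[OF K]])
  fix y show "cmod (LINT x:{x. (x, y) \<in> E}|lborel. cis (\<theta> (x, y))) \<le> K * indicator {0..w} y"
  proof (cases "y \<in> {0..w}")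
    case False
    hence "{x. (x, y) \<in> E} = {}" using strip by auto
    thus ?thesis using K by (simp add: set_lebesgue_integral_def)
  qed (use le in auto)
qed (use K in auto)

lemma strip_slice_bound':
  fixes \<theta> :: "real \<times> real \<Rightarrow> real"
  assumes \<theta>: "continuous_on UNIV \<theta>" and E: "E \<in> sets borel" "bounded E" and K: "0 \<le> K" "0 \<le> w"
    and strip: "\<And>x y. (x, y) \<in> E \<Longrightarrow> x \<in> {0..w}"
    and le: "\<And>x. x \<in> {0..w} \<Longrightarrow> cmod (LINT y:{y. (x, y) \<in> E}|lborel. cis (\<theta> (x, y))) \<le> K"
  shows "cmod (LINT p:E|lborel. cis (\<theta> p)) \<le> K * w"
proof (rule slice_bound'[OF \<theta> E _ strip_bound_nn_integral[OF K]])
  fix x show "cmod (LINT y:{y. (x, y) \<in> E}|lborel. cis (\<theta> (x, y))) \<le> K * indicator {0..w} x"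
  proof (cases "x \<in> {0..w}")
    case False
    hence "{y. (x, y) \<in> E} = {}" using strip by auto
    thus ?thesis using K by (simp add: set_lebesgue_integral_def)
  qed (use le in auto)
qed (use K in auto)

text \<open>The shear (x, y) to (x, x + y) preserves Lebesgue measure and turns the antidiagonals x
  + y = z into slices, so that a one-dimensional test can be applied along them.\<close>

lemma integral_shear:
  fixes F :: "real \<times> real \<Rightarrow> complex"
  assumes F: "integrable lborel F" and FT: "integrable lborel (\<lambda>p. F (fst p, snd p - fst p))"
  shows "(LINT p|lborel. F p) = (LINT z|lborel. LINT x|lborel. F (x, z - x))"
proof -
  have "(LINT p|lborel. F p) = (LINT x|lborel. LINT y|lborel. F (x, y))"
    using lborel_pair.integral_fst[of "\<lambda>x y. F (x, y)"] F by (simp add: lborel_prod)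
  also have "\<dots> = (LINT x|lborel. LINT z|lborel. F (x, z - x))"
  proof (rule Bochner_Integration.integral_cong[OF refl])
    fix x
    show "(LINT y|lborel. F (x, y)) = (LINT z|lborel. F (x, z - x))"
      using lborel_integral_real_affine[of 1 "\<lambda>y. F (x, y)" "-x"] by (simp add: add.commute)
  qed
  also have "\<dots> = (LINT z|lborel. LINT x|lborel. F (x, z - x))"
    by (rule lborel_pair.Fubini_integral[symmetric])
      (use FT in \<open>simp add: lborel_prod case_prod_beta'\<close>)
  finally show ?thesis .
qed

section \<open>The phase function\<close>

text \<open>The sign is that of minus the Laplacian, so the symbol is nonnegative; it is the square
  of \<open>omega\<close> at h = 1.\<close>

definition lap_symbol :: "real \<Rightarrow> real \<Rightarrow> real" where
  "lap_symbol x y = 4 - 2 * cos x - 2 * cos y"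

text \<open>The second derivative of the squared \<open>lap_symbol\<close> in its first variable,
  \<open>8 * (sin x)^2 + 4 * lap_symbol x y * cos x\<close>, with the sine eliminated. As a
  polynomial in the two cosines it can be estimated by adding products of nonnegative linear
  factors.\<close>

definition phase_hess :: "real \<Rightarrow> real \<Rightarrow> real" where
  "phase_hess x y = 8 + 16 * cos x - 16 * (cos x)\<^sup>2 - 8 * cos y * cos x"

text \<open>The coefficients \<open>a\<close> and \<open>b\<close> carry the spatial point; the
  final decay bound has to be uniform in them.\<close>

definition phase :: "real \<Rightarrow> real \<Rightarrow> real \<Rightarrow> real \<times> real \<Rightarrow> real" where
  "phase a b t p = a * fst p + b * snd p + t * (lap_symbol (fst p) (snd p))\<^sup>2"

lemma lap_symbol_commute: "lap_symbol x y = lap_symbol y x" by (simp add: lap_symbol_def)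

lemma continuous_phase: "continuous_on UNIV (phase a b t)"
  unfolding phase_def lap_symbol_def by (intro continuous_intros)

lemma phase_swap: "phase a b t (x, y) = phase b a t (y, x)"
  by (simp add: phase_def lap_symbol_commute[of x y])

lemma phase_deriv_fst:
  "((\<lambda>x. phase a b t (x, y)) has_real_derivative a + t * (4 * lap_symbol x y * sin x)) (at x)"
  unfolding phase_def lap_symbol_def by (auto intro!: derivative_eq_intros simp: algebra_simps)

lemma phase_deriv2_fst:
  "((\<lambda>x. a + t * (4 * lap_symbol x y * sin x)) has_real_derivative t * phase_hess x y) (at x)"
proof -
  have s: "(sin x)\<^sup>2 = 1 - (cos x)\<^sup>2" by (rule sin_squared_eq)
  have "8 * (sin x)\<^sup>2 + 4 * lap_symbol x y * cos x = phase_hess x y"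
    unfolding s lap_symbol_def phase_hess_def by (simp add: algebra_simps power2_eq_square)
  moreover have "((\<lambda>x. a + t * (4 * lap_symbol x y * sin x)) has_real_derivative
      t * (8 * (sin x)\<^sup>2 + 4 * lap_symbol x y * cos x)) (at x)"
    unfolding lap_symbol_def
    by (auto intro!: derivative_eq_intros simp: algebra_simps power2_eq_square)
  ultimately show ?thesis by simp
qed

lemma continuous_phase_hess: "continuous_on UNIV (\<lambda>x. t * phase_hess x y)"
  unfolding phase_hess_def by (intro continuous_intros)

lemma phase_second_fst:
  assumes "is_interval S" "bounded S" "k > 0" "t > 0"
    and "(\<forall>x\<in>S. k \<le> phase_hess x y) \<or> (\<forall>x\<in>S. phase_hess x y \<le> - k)"
  shows "cmod (LINT x:S|lborel. cis (phase a b t (x, y))) \<le> 10 / sqrt (t * k)"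
  using assms(5)
proof
  assume "\<forall>x\<in>S. k \<le> phase_hess x y"
  thus ?thesis using assms
    by (intro van_der_Corput_second[OF assms(1,2) _ phase_deriv_fst phase_deriv2_fst continuous_phase_hess]) auto
next
  assume "\<forall>x\<in>S. phase_hess x y \<le> - k"
  hence "\<forall>x\<in>S. t * phase_hess x y \<le> t * (- k)" using assms by (simp only: mult_le_cancel_left_pos simp_thms)
  thus ?thesis using assms
    by (intro van_der_Corput_second_neg[OF assms(1,2) _ phase_deriv_fst phase_deriv2_fst continuous_phase_hess]) auto
qed

lemma phase_first_fst:
  assumes "is_interval S" "bounded S" "k > 0" "t > 0"
    and "\<And>x. x \<in> S \<Longrightarrow> 0 \<le> phase_hess x y"
    and "\<And>x. x \<in> S \<Longrightarrow> k \<le> \<bar>a + t * (4 * lap_symbol x y * sin x)\<bar>"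
  shows "cmod (LINT x:S|lborel. cis (phase a b t (x, y))) \<le> 4 / k"
  using assms
  by (intro van_der_Corput_first[OF assms(1-3) phase_deriv_fst phase_deriv2_fst continuous_phase_hess]) auto

section \<open>Signs of the second derivatives of the phase\<close>

lemma hess_neg:
  assumes "cos x \<le> -3/5"
  shows "phase_hess x y \<le> - 2"
proof -
  define c where "c = cos x"
  define d where "d = cos y"
  have c: "c \<le> -3/5" "-1 \<le> c" and d: "-1 \<le> d" "d \<le> 1" using assms by (auto simp: c_def d_def)
  \<comment> \<open>Since \<open>c\<close> is negative, \<open>d = 1\<close> is the worst case, with
    value \<open>8 * (1 - c) * (1 + 2 * c)\<close>. This is negative for \<open>c\<close> below
    -1/2, and the threshold -3/5 leaves a margin.\<close>
  have "0 \<le> (1 - d) * (- c)" using c d by (intro mult_nonneg_nonneg) auto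
  moreover have "(1 - d) * (- c) = c * d - c" by (simp add: algebra_simps)
  moreover have "0 \<le> (-3/5 - c) * (1 - c)" using c by (intro mult_nonneg_nonneg) auto
  moreover have "(-3/5 - c) * (1 - c) = c * c - 2/5 * c - 3/5" by (simp add: field_simps)
  moreover have "phase_hess x y = 8 + 16 * c - 16 * (c * c) - 8 * (c * d)"
    by (simp add: phase_hess_def c_def d_def power2_eq_square)
  ultimately show ?thesis using c by linarith
qed

text \<open>The expression is concave in \<open>cos x\<close>, so only the extreme values -1/4 and 1
  matter. They give \<open>3 + 2 * cos y\<close> and \<open>8 - 8 * cos y\<close>, both at least 1;
  the first product below encodes the concavity.\<close>

lemma hess_pos_off_diagonal:
  assumes "-1/4 \<le> cos x" "cos y \<le> -1/4"
  shows "1 \<le> phase_hess x y"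
proof -
  define c where "c = cos x"
  define d where "d = cos y"
  have c: "-1/4 \<le> c" "c \<le> 1" and d: "-1 \<le> d" "d \<le> -1/4" using assms by (auto simp: c_def d_def)
  have "0 \<le> (1 - c) * (c + 1/4)" using c by (intro mult_nonneg_nonneg) auto
  moreover have "(1 - c) * (c + 1/4) = 3/4 * c + 1/4 - c * c" by (simp add: field_simps)
  moreover have "0 \<le> (c + 1/4) * (4 - 8 * d)" using c d by (intro mult_nonneg_nonneg) auto
  moreover have "(c + 1/4) * (4 - 8 * d) = 4 * c + 1 - 2 * d - 8 * (c * d)" by (simp add: algebra_simps)
  moreover have "phase_hess x y = 8 + 16 * c - 16 * (c * c) - 8 * (c * d)"
    by (simp add: phase_hess_def c_def d_def power2_eq_square)
  ultimately show ?thesis using d by linarith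
qed

text \<open>In this cell the curvature vanishes at the origin; comparison with
  \<open>lap_symbol\<close> measures how fast it does so.\<close>

lemma hess_ge_lap_symbol:
  assumes "-1/4 \<le> cos x" "-1/4 \<le> cos y"
  shows "lap_symbol x y / 2 \<le> phase_hess x y"
proof -
  define c where "c = cos x"
  define d where "d = cos y"
  have c: "-1/4 \<le> c" "c \<le> 1" and d: "-1/4 \<le> d" "d \<le> 1" using assms by (auto simp: c_def d_def)
  have "0 \<le> (1 - c) * (c + 1/4)" "0 \<le> (c + 1/4) * (1 - d)" "0 \<le> (1 - c) * (d + 1/4)"
    using c d by (auto intro!: mult_nonneg_nonneg)
  \<comment> \<open>The three weights are determined by the coefficients of \<open>c * c\<close>,
    \<open>c * d\<close> and \<open>d\<close> in the target; the coefficient of \<open>c\<close> and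
    the constant then match as well.\<close>
  hence "0 \<le> 16 * ((1 - c) * (c + 1/4)) + 28/5 * ((c + 1/4) * (1 - d)) + 12/5 * ((1 - c) * (d + 1/4))"
    by linarith
  also have "\<dots> = phase_hess x y - lap_symbol x y / 2"
    by (simp add: phase_hess_def lap_symbol_def c_def d_def power2_eq_square field_simps)
  finally show ?thesis by simp
qed

text \<open>This is the second derivative of the squared \<open>lap_symbol\<close> in the direction
  (1, -1), its mixed derivative being \<open>8 * sin x * sin y\<close>. The pure derivatives add up
  to at most 5, while both sines are at least 4/5, so that the mixed term removes 16 * 16/25, which
  exceeds 10.\<close>

lemma hess_antidiagonal_neg:
  assumes "x \<in> {0..pi}" "y \<in> {0..pi}"
    and "cos x \<in> {-3/5..-1/4}" "cos y \<in> {-3/5..-1/4}"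
  shows "phase_hess x y + phase_hess y x - 16 * sin x * sin y \<le> - 5"
proof -
  define c where "c = cos x"
  define d where "d = cos y"
  have cd: "-3/5 \<le> c" "c \<le> -1/4" "-3/5 \<le> d" "d \<le> -1/4" using assms by (auto simp: c_def d_def)
  have s: "4/5 \<le> sin u" if "u \<in> {0..pi}" "cos u \<in> {-3/5..-1/4}" for u
  proof -
    have "\<bar>cos u\<bar>\<^sup>2 \<le> (3/5)\<^sup>2" using that by (intro power_mono) auto
    hence "(4/5)\<^sup>2 \<le> (sin u)\<^sup>2" unfolding sin_squared_eq by (simp add: power2_eq_square)
    moreover have "0 \<le> sin u" using that sin_ge_zero[of u] by auto
    ultimately show ?thesis by (rule power2_le_imp_le)
  qed
  have "4/5 * (4/5) \<le> sin x * sin y" using s assms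
    by (intro mult_mono sin_ge_zero) auto
  moreover have "(1/4) * (1/4) \<le> u * v" if "1/4 \<le> u" "1/4 \<le> v" for u v :: real
    using that by (intro mult_mono) auto
  from this[of "-c" "-c"] this[of "-d" "-d"] this[of "-c" "-d"]
  have "1/16 \<le> c * c" "1/16 \<le> d * d" "1/16 \<le> c * d" using cd by auto
  moreover have "phase_hess x y + phase_hess y x = 16 + 16 * c + 16 * d - 16 * (c * c) - 16 * (d * d) - 16 * (c * d)"
    by (simp add: phase_hess_def c_def d_def power2_eq_square)
  ultimately show ?thesis using cd by linarith
qed

section \<open>Size of the phase near the origin and the scale of its stationary point\<close>

lemma sin_ge_cubic:
  assumes "0 \<le> (x::real)"
  shows "x - x^3 / 6 \<le> sin x"
proof -
  have c: "1 - u\<^sup>2 / 2 \<le> cos u" if "0 \<le> u" for u :: real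
  proof -
    have "cos 0 - (1 - 0\<^sup>2 / 2) \<le> cos u - (1 - u\<^sup>2 / 2)"
      using that
      by (intro DERIV_nonneg_imp_nondecreasing[of 0 u "\<lambda>u. cos u - (1 - u\<^sup>2 / 2)"])
        (auto intro!: exI derivative_eq_intros simp: sin_x_le_x)
    thus ?thesis by simp
  qed
  have "sin 0 - (0 - 0^3 / 6) \<le> sin x - (x - x^3 / 6)"
  proof (rule DERIV_nonneg_imp_nondecreasing[OF assms])
    fix u :: real assume "0 \<le> u"
    thus "\<exists>y. ((\<lambda>x. sin x - (x - x^3 / 6)) has_real_derivative y) (at u) \<and> 0 \<le> y"
      using c[of u] by (intro exI[of _ "cos u - (1 - u\<^sup>2 / 2)"]) (auto intro!: derivative_eq_intros)
  qed
  thus ?thesis by simp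
qed

lemma one_minus_cos_bounds:
  assumes "0 \<le> x" "x \<le> (2::real)"
  shows "x\<^sup>2 / 2 \<le> 2 - 2 * cos x" "2 - 2 * cos x \<le> x\<^sup>2"
proof -
  have eq: "2 - 2 * cos x = 4 * (sin (x/2))\<^sup>2" using cos_double_sin[of "x/2"] by simp
  have u: "sin (x/2) \<le> x/2" using assms sin_x_le_x[of "x/2"] by simp
  have p: "0 \<le> sin (x/2)" using assms pi_ge_two by (intro sin_ge_zero) auto
  have "(sin (x/2))\<^sup>2 \<le> (x/2)\<^sup>2" using u p by (intro power_mono) auto
  thus "2 - 2 * cos x \<le> x\<^sup>2" unfolding eq by (simp add: power2_eq_square)
  define s where "s = x/2"
  have s: "0 \<le> s" "s \<le> 1" using assms by (auto simp: s_def)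
  have "s^3 \<le> s" using s power_decreasing[of 1 3 s] by simp
  hence l: "s * (5/6) \<le> sin s" using sin_ge_cubic[OF s(1)] by simp
  have "(s * (5/6))\<^sup>2 \<le> (sin s)\<^sup>2" using l s by (intro power_mono) auto
  hence "4 * (25/36) * s\<^sup>2 \<le> 4 * (sin s)\<^sup>2" by (simp add: power2_eq_square)
  moreover have "2 * s\<^sup>2 \<le> 4 * (25/36) * s\<^sup>2" by simp
  ultimately have "2 * s\<^sup>2 \<le> 4 * (sin s)\<^sup>2" by linarith
  thus "x\<^sup>2 / 2 \<le> 2 - 2 * cos x" unfolding eq by (simp add: s_def power2_eq_square)
qed

lemma sin_ge_third:
  assumes "0 \<le> x" "x \<le> (2::real)"
  shows "x / 3 \<le> sin x"
proof -
  have "x * x\<^sup>2 \<le> x * 2\<^sup>2" using assms by (intro mult_left_mono power_mono) auto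
  thus ?thesis using sin_ge_cubic[OF assms(1)] by (simp add: power3_eq_cube power2_eq_square)
qed

lemma lap_symbol_bounds:
  assumes "0 \<le> x" "x \<le> 2" "0 \<le> y" "y \<le> 2"
  shows "(x\<^sup>2 + y\<^sup>2) / 2 \<le> lap_symbol x y" "lap_symbol x y \<le> x\<^sup>2 + y\<^sup>2"
  using one_minus_cos_bounds[OF assms(1,2)] one_minus_cos_bounds[OF assms(3,4)]
  by (auto simp: lap_symbol_def)

lemma hess_near_zero:
  assumes "x \<in> {0..2}" "y \<in> {0..2}" "-1/4 \<le> cos x" "-1/4 \<le> cos y"
  shows "(x\<^sup>2 + y\<^sup>2) / 4 \<le> phase_hess x y"
  using hess_ge_lap_symbol[OF assms(3,4)] lap_symbol_bounds(1)[of x y] assms by auto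

text \<open>Places the cell at the origin inside [0, 2], the range of the quadratic bounds on
  \<open>lap_symbol\<close>.\<close>

lemma arccos_quarter_le_2: "arccos (-1/4) \<le> 2"
proof -
  have "2 - 2 * cos 2 \<ge> (5/2 :: real)"
  proof -
    have "2 - 2 * cos (2::real) = 4 * (sin 1)\<^sup>2" using cos_double_sin[of "1::real"] by simp
    moreover have "(5/6)\<^sup>2 \<le> (sin (1::real))\<^sup>2" using sin_ge_cubic[of 1] by (intro power_mono) auto
    ultimately show ?thesis by (simp add: power2_eq_square)
  qed
  hence "cos 2 \<le> (-1/4::real)" by simp
  moreover have "-1 \<le> cos (2::real)" by simp
  ultimately have "arccos (-1/4) \<le> arccos (cos 2)" by (intro arccos_le_arccos) auto
  also have "\<dots> = 2" using pi_ge_two by (intro arccos_cos) auto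
  finally show ?thesis .
qed

text \<open>At distance \<open>\<rho>\<close> from the origin the gradient of the quartic term has
  size \<open>t * \<rho>^3\<close>. The witness is the larger of \<open>t\<close> to the power -1/4
  and the radius where this gradient balances the larger linear coefficient. The final disjunction
  records which of the two was taken; it decides how the innermost square is treated in
  \<open>phase_near_zero\<close>.\<close>

lemma critical_scale:
  fixes a b t :: real
  assumes t: "t > 0"
  obtains \<rho> where "\<rho> > 0" "1 \<le> t * \<rho>^4" "\<bar>a\<bar> \<le> t * \<rho>^3" "\<bar>b\<bar> \<le> t * \<rho>^3"
    "t * \<rho>^4 = 1 \<or> \<bar>a\<bar> = t * \<rho>^3 \<or> \<bar>b\<bar> = t * \<rho>^3"
proof -
  define m where "m = max \<bar>a\<bar> \<bar>b\<bar>"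
  define r0 r1 where "r0 = root 4 (1 / t)" and "r1 = root 3 (m / t)"
  have r0: "r0 > 0" "t * r0^4 = 1" using t by (auto simp: r0_def)
  have r1: "r1 \<ge> 0" "t * r1^3 = m" using t by (auto simp: r1_def m_def)
  have m: "\<bar>a\<bar> \<le> m" "\<bar>b\<bar> \<le> m" "m = \<bar>a\<bar> \<or> m = \<bar>b\<bar>" by (auto simp: m_def)
  show ?thesis
  proof (cases "r0 \<le> r1")
    case True
    have "t * r0^4 \<le> t * r1^4" using True r0 t by (intro mult_left_mono power_mono) auto
    thus ?thesis using True r0 r1 m by (intro that[of r1]) auto
  next
    case False
    have "t * r1^3 \<le> t * r0^3" using False r1 t by (intro mult_left_mono power_mono) auto
    thus ?thesis using r0 r1 m by (intro that[of r0]) auto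
  qed
qed

lemma nn_integral_cauchy_kernel:
  assumes "K \<ge> 0" "\<rho> > 0"
  shows "(\<integral>\<^sup>+x. ennreal (K / (x\<^sup>2 + \<rho>\<^sup>2)) * indicator {0..} x \<partial>lborel) \<le> ennreal (2 * K / \<rho>)"
proof -
  define F where "F = (\<lambda>x. K / \<rho> * arctan (x / \<rho>))"
  have "(\<integral>\<^sup>+x. ennreal (K / (x\<^sup>2 + \<rho>\<^sup>2)) * indicator {0..} x \<partial>lborel) = ennreal (K / \<rho> * (pi / 2) - F 0)"
  proof (rule nn_integral_FTC_atLeast)
    show "(\<lambda>x. K / (x\<^sup>2 + \<rho>\<^sup>2)) \<in> borel_measurable borel" by measurable
    show "0 \<le> K / (x\<^sup>2 + \<rho>\<^sup>2)" for x using assms by simp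
    show "(F has_real_derivative K / (x\<^sup>2 + \<rho>\<^sup>2)) (at x)" for x
    proof -
      have "x\<^sup>2 + \<rho>\<^sup>2 > 0" using assms by (intro add_nonneg_pos) auto
      hence eq: "K / \<rho> * (inverse (1 + (x / \<rho>)\<^sup>2) * (1 / \<rho>)) = K / (x\<^sup>2 + \<rho>\<^sup>2)"
        using assms by (simp add: divide_simps power_divide) (simp add: power2_eq_square algebra_simps)
      have "((\<lambda>x. arctan (x / \<rho>)) has_real_derivative inverse (1 + (x / \<rho>)\<^sup>2) * (1 / \<rho>)) (at x)"
        using DERIV_chain2[OF DERIV_arctan DERIV_cdivide[OF DERIV_ident]] .
      from DERIV_cmult[OF this, of "K / \<rho>"] show ?thesis unfolding F_def eq .
    qed
    have "filterlim (\<lambda>x. 1 / \<rho> * x) at_top at_top"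
      using assms by (intro filterlim_tendsto_pos_mult_at_top[OF tendsto_const _ filterlim_ident]) auto
    hence "filterlim (\<lambda>x. x / \<rho>) at_top at_top" by simp
    from filterlim_compose[OF tendsto_arctan_at_top this]
    show "(F \<longlongrightarrow> K / \<rho> * (pi / 2)) at_top" unfolding F_def by (intro tendsto_mult_left)
  qed
  also have "\<dots> \<le> ennreal (2 * K / \<rho>)"
  proof (rule ennreal_leI)
    have "K / \<rho> * (pi / 2) \<le> K / \<rho> * 2" using assms pi_less_4 by (intro mult_left_mono) auto
    thus "K / \<rho> * (pi / 2) - F 0 \<le> 2 * K / \<rho>" by (simp add: F_def mult.commute)
  qed
  finally show ?thesis .
qed

lemma sqrt_mult_le_iff_scale:
  assumes "t > 0" "\<rho> > 0" "1 \<le> t * \<rho>^4"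
  shows "1 \<le> sqrt t * \<rho>\<^sup>2"
proof -
  have "(sqrt t * \<rho>\<^sup>2)\<^sup>2 = t * \<rho>^4"
    using assms by (simp add: power_mult_distrib)
  thus ?thesis using assms by (metis abs_of_pos mult_pos_pos one_power2 power2_le_imp_le
        real_sqrt_gt_zero zero_less_power less_imp_le)
qed

text \<open>Let \<open>r\<close> be the scale at which the phase can be stationary, or \<open>t\<close> to the power \<open>-1/4\<close> if that is larger.
  On \<open>E1\<close> the linear term dominates, on \<open>E2\<close> the second derivative in the first variable is of size \<open>t * r\<^sup>2\<close>,
  and on \<open>E3\<close> the quartic term dominates, which makes the phase nonstationary in the second variable. Splitting at the
  single scale \<open>r\<close> avoids the logarithm that the second derivative test alone would produce near the origin.\<close>

lemma phase_near_zero: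
  fixes a b t w :: real
  assumes t: "t > 0" and w: "0 \<le> w" "w \<le> 2" "-1/4 \<le> cos w"
  shows "cmod (LINT p:{0..<w}\<times>{0..<w}|lborel. cis (phase a b t p)) \<le> 300 / sqrt t"
proof -
  obtain r where r: "r > 0" "1 \<le> t * r^4" "\<bar>a\<bar> \<le> t * r^3" "\<bar>b\<bar> \<le> t * r^3"
    "t * r^4 = 1 \<or> \<bar>a\<bar> = t * r^3 \<or> \<bar>b\<bar> = t * r^3"
    using critical_scale[OF t, of a b] .
  define s where "s = sqrt t"
  have s: "s > 0" "t = s * s" "1 \<le> s * r\<^sup>2"
    using t sqrt_mult_le_iff_scale[OF t r(1,2)] by (auto simp: s_def)
  define Q where "Q = {0..<w} \<times> {0..<w}"
  have cw: "-1/4 \<le> cos x" if "x \<in> {0..<w}" for x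
    using that w pi_gt3 cos_monotone_0_pi_le[of x w] by auto
  have hess: "(x\<^sup>2 + y\<^sup>2) / 4 \<le> phase_hess x y" if "x \<in> {0..<w}" "y \<in> {0..<w}" for x y
    using hess_near_zero[of x y] cw that w by auto
  have hess0: "0 \<le> phase_hess x y" if "x \<in> {0..<w}" "y \<in> {0..<w}" for x y
    using hess[OF that] by (meson divide_nonneg_pos order_trans sum_power2_ge_zero zero_less_numeral)
  define E1 where "E1 = ({0..<w} \<inter> {..<r/4}) \<times> ({0..<w} \<inter> {..<r/4})"
  define E2 where "E2 = {p \<in> Q. snd p < 2 * r \<and> (r/4 \<le> fst p \<or> r/4 \<le> snd p)}"
  define E3 where "E3 = {0..<w} \<times> ({0..<w} \<inter> {2 * r..})"
  have Qm: "Q \<in> sets borel" unfolding Q_def by (intro borel_Times) auto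
  have E1m: "E1 \<in> sets borel" unfolding E1_def by (intro borel_Times) auto
  have E3m: "E3 \<in> sets borel" unfolding E3_def by (intro borel_Times) auto
  have E2m: "E2 \<in> sets borel"
  proof -
    have "{p :: real \<times> real. snd p < 2 * r \<and> (r/4 \<le> fst p \<or> r/4 \<le> snd p)} \<in> sets borel" by measurable
    hence "Q \<inter> {p. snd p < 2 * r \<and> (r/4 \<le> fst p \<or> r/4 \<le> snd p)} \<in> sets borel"
      by (rule sets.Int[OF Qm])
    moreover have "E2 = Q \<inter> {p. snd p < 2 * r \<and> (r/4 \<le> fst p \<or> r/4 \<le> snd p)}"
      unfolding E2_def by blast
    ultimately show ?thesis by (simp only:)
  qed
  have Qb: "bounded Q" unfolding Q_def by (intro bounded_Times bounded_Ico)
  have sub: "E1 \<subseteq> Q" "E2 \<subseteq> Q" "E3 \<subseteq> Q" by (auto simp: E1_def E2_def E3_def Q_def)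
  have bd: "bounded E1" "bounded E2" "bounded E3" using sub Qb bounded_subset by blast+
  let ?J = "\<lambda>E. LINT p:E|lborel. cis (phase a b t p)"
  have si: "set_integrable lborel E (\<lambda>p. cis (phase a b t p))" if "E \<in> sets borel" "bounded E" for E
    unfolding set_integrable_def by (rule integrable_cis_region[OF continuous_phase that])
  have "Q = E1 \<union> (E2 \<union> E3)" using r by (auto simp: Q_def E1_def E2_def E3_def)
  moreover have "E1 \<inter> (E2 \<union> E3) = {}" using r by (auto simp: E1_def E2_def E3_def)
  moreover have "E2 \<inter> E3 = {}" by (auto simp: E2_def E3_def)
  ultimately have split: "?J Q = ?J E1 + (?J E2 + ?J E3)"
    using set_integral_Un[OF _ si si, of E1 "E2 \<union> E3"] set_integral_Un[OF _ si si, of E2 E3]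
      E1m E2m E3m bd by (simp add: bounded_Un)

  \<comment> \<open>For y at least \<open>2 * r\<close> the y-derivative of the quartic term exceeds
    \<open>t * r^3\<close>, hence \<open>\<bar>b\<bar>\<close>, by at least
    \<open>t * r * (x^2 + r^2)\<close>. The reciprocal is a Cauchy kernel in x with integral of
    order \<open>1 / (t * r^2)\<close>, and \<open>s * r^2\<close> being at least 1 turns this into
    \<open>1 / s\<close>.\<close>
  have J3: "cmod (?J E3) \<le> 8 / s"
  proof (rule slice_bound'[OF continuous_phase E3m bd(3)])
    fix x
    show "cmod (LINT y:{y. (x, y) \<in> E3}|lborel. cis (phase a b t (x, y)))
      \<le> 4 / (t * r) / (x\<^sup>2 + r\<^sup>2) * indicator {0..} x"
    proof (cases "x \<in> {0..<w}")
      case False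
      hence "{y. (x, y) \<in> E3} = {}" by (auto simp: E3_def)
      thus ?thesis using t r by (simp add: set_lebesgue_integral_def)
    next
      case x: True
      have eq: "{y. (x, y) \<in> E3} = {0..<w} \<inter> {2 * r..}" using x by (auto simp: E3_def)
      have pos: "0 < x\<^sup>2 + r\<^sup>2" using r by (intro add_nonneg_pos) auto
      have "cmod (LINT y:{0..<w} \<inter> {2 * r..}|lborel. cis (phase b a t (y, x))) \<le> 4 / (t * r * (x\<^sup>2 + r\<^sup>2))"
      proof (rule phase_first_fst)
        show "is_interval ({0..<w} \<inter> {2 * r..})" by (intro is_interval_Int) auto
        show "bounded ({0..<w} \<inter> {2 * r..})" by (intro bounded_Int) auto
        show "0 < t * r * (x\<^sup>2 + r\<^sup>2)" using t r pos by simp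
        fix y assume y: "y \<in> {0..<w} \<inter> {2 * r..}"
        show "0 \<le> phase_hess y x" using hess0 x y by auto
        have "(x\<^sup>2 + y\<^sup>2) / 2 \<le> lap_symbol y x"
          using lap_symbol_bounds(1)[of y x] x y w by (auto simp: add.commute)
        moreover have "y / 3 \<le> sin y" using sin_ge_third[of y] y w by auto
        ultimately have "(x\<^sup>2 + y\<^sup>2) / 2 * (y / 3) \<le> lap_symbol y x * sin y"
          using y by (intro mult_mono) (auto intro: order_trans[OF _ \<open>(x\<^sup>2 + y\<^sup>2) / 2 \<le> lap_symbol y x\<close>])
        moreover have "(x\<^sup>2 + (2 * r)\<^sup>2) / 2 * (2 * r / 3) \<le> (x\<^sup>2 + y\<^sup>2) / 2 * (y / 3)"
          using y r by (intro mult_mono divide_right_mono add_left_mono power_mono) auto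
        ultimately have "(x\<^sup>2 + (2 * r)\<^sup>2) / 2 * (2 * r / 3) \<le> lap_symbol y x * sin y" by (rule order_trans[rotated])
        hence "4 * ((x\<^sup>2 + (2 * r)\<^sup>2) / 2 * (2 * r / 3)) \<le> 4 * lap_symbol y x * sin y"
          unfolding mult.assoc[of 4] by (rule mult_left_mono) simp
        moreover have "4 * ((x\<^sup>2 + (2 * r)\<^sup>2) / 2 * (2 * r / 3)) = r * (x\<^sup>2 + r\<^sup>2) + r^3 + (x\<^sup>2 * r / 3 + 10/3 * r^3)"
          by (simp add: field_simps power2_eq_square power3_eq_cube)
        moreover have "0 \<le> x\<^sup>2 * r / 3 + 10/3 * r^3" using r by simp
        ultimately have "r * (x\<^sup>2 + r\<^sup>2) + r^3 \<le> 4 * lap_symbol y x * sin y" by linarith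
        hence "t * (r * (x\<^sup>2 + r\<^sup>2) + r^3) \<le> t * (4 * lap_symbol y x * sin y)" using t by simp
        hence "t * r * (x\<^sup>2 + r\<^sup>2) + t * r^3 \<le> t * (4 * lap_symbol y x * sin y)" by (simp add: algebra_simps)
        thus "t * r * (x\<^sup>2 + r\<^sup>2) \<le> \<bar>b + t * (4 * lap_symbol y x * sin y)\<bar>" using r(4) by linarith
      qed (rule t)
      thus ?thesis using x unfolding eq phase_swap[of a b] by simp
    qed
  next
    have "(\<integral>\<^sup>+x. ennreal (4 / (t * r) / (x\<^sup>2 + r\<^sup>2) * indicator {0..} x) \<partial>lborel)
      = (\<integral>\<^sup>+x. ennreal (4 / (t * r) / (x\<^sup>2 + r\<^sup>2)) * indicator {0..} x \<partial>lborel)"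
      by (intro nn_integral_cong) (auto simp: indicator_def)
    also have "\<dots> \<le> ennreal (2 * (4 / (t * r)) / r)"
      using t r by (intro nn_integral_cauchy_kernel) auto
    also have "\<dots> \<le> ennreal (8 / s)"
    proof (rule ennreal_leI)
      have "2 * (4 / (t * r)) / r = 8 / (s * (s * r\<^sup>2))" using s by (simp add: power2_eq_square mult_ac)
      also have "\<dots> \<le> 8 / (s * 1)" using s by (intro divide_left_mono mult_left_mono mult_pos_pos) auto
      finally show "2 * (4 / (t * r)) / r \<le> 8 / s" by simp
    qed
    finally show "(\<integral>\<^sup>+x. ennreal (4 / (t * r) / (x\<^sup>2 + r\<^sup>2) * indicator {0..} x) \<partial>lborel) \<le> ennreal (8 / s)" .
  qed (use s in auto)

  \<comment> \<open>One coordinate is at least \<open>r / 4\<close>, so the curvature in x is at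
    least \<open>(r / 8)^2\<close> and each slice contributes \<open>80 / (s * r)\<close>. The strip
    has height \<open>2 * r\<close>, which cancels \<open>r\<close>.\<close>
  have J2: "cmod (?J E2) \<le> 160 / s"
  proof -
    have "cmod (?J E2) \<le> 80 / (s * r) * (2 * r)"
    proof (rule strip_slice_bound[OF continuous_phase E2m bd(2)])
      show "y \<in> {0..2 * r}" if "(x, y) \<in> E2" for x y using that by (auto simp: E2_def Q_def)
      fix y assume "y \<in> {0..2 * r}"
      show "cmod (LINT x:{x. (x, y) \<in> E2}|lborel. cis (phase a b t (x, y))) \<le> 80 / (s * r)"
      proof (cases "y \<in> {0..<w} \<and> y < 2 * r")
        case False
        hence "{x. (x, y) \<in> E2} = {}" by (auto simp: E2_def Q_def)
        thus ?thesis using s r by (simp add: set_lebesgue_integral_def)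
      next
        case y: True
        have "cmod (LINT x:{x. (x, y) \<in> E2}|lborel. cis (phase a b t (x, y))) \<le> 10 / sqrt (t * (r / 8)\<^sup>2)"
        proof (rule phase_second_fst)
          have eq: "{x. (x, y) \<in> E2} = (if r/4 \<le> y then {0..<w} else {0..<w} \<inter> {r/4..})"
            using y by (auto simp: E2_def Q_def)
          show "is_interval {x. (x, y) \<in> E2}" unfolding eq by (auto intro!: is_interval_Int)
          show "bounded {x. (x, y) \<in> E2}" unfolding eq by (auto intro!: bounded_Int)
          have "(r/8)\<^sup>2 \<le> phase_hess x y" if "(x, y) \<in> E2" for x
          proof -
            have "(r/4)\<^sup>2 \<le> x\<^sup>2 \<or> (r/4)\<^sup>2 \<le> y\<^sup>2"
              using that r by (auto simp: E2_def intro: power_mono)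
            hence "(r/4)\<^sup>2 \<le> x\<^sup>2 + y\<^sup>2" by (smt (verit) zero_le_power2)
            moreover have "(x\<^sup>2 + y\<^sup>2) / 4 \<le> phase_hess x y" using hess that by (auto simp: E2_def Q_def)
            ultimately show ?thesis by (simp add: power2_eq_square)
          qed
          thus "(\<forall>x\<in>{x. (x, y) \<in> E2}. (r/8)\<^sup>2 \<le> phase_hess x y)
            \<or> (\<forall>x\<in>{x. (x, y) \<in> E2}. phase_hess x y \<le> - (r/8)\<^sup>2)" by auto
        qed (use r t in auto)
        also have "10 / sqrt (t * (r / 8)\<^sup>2) = 80 / (s * r)" using r by (simp add: real_sqrt_mult s_def)
        finally show ?thesis .
      qed
    qed (use r s in auto)
    also have "\<dots> = 160 / s" using r by simp
    finally show ?thesis .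
  qed

  \<comment> \<open>On this square the quartic term contributes at most \<open>t * r^3 / 8\<close>
    to a partial derivative. If a linear coefficient has modulus \<open>t * r^3\<close>, it
    therefore dominates in its own variable, and the first derivative test applies there. Otherwise
    \<open>t * r^4 = 1\<close>, and the area of the square is already of order
    \<open>1 / s\<close>.\<close>
  have J1: "cmod (?J E1) \<le> 2 / s"
  proof -
    have first: "cmod (LINT x:{0..<w} \<inter> {..<r/4}|lborel. cis (phase a' b' t (x, y))) \<le> 8 / (t * r^3)"
      if a': "\<bar>a'\<bar> = t * r^3" and y: "y \<in> {0..<w} \<inter> {..<r/4}" for a' b' y
    proof -
      have "cmod (LINT x:{0..<w} \<inter> {..<r/4}|lborel. cis (phase a' b' t (x, y))) \<le> 4 / (t * r^3 / 2)"
      proof (rule phase_first_fst)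
        show "is_interval ({0..<w} \<inter> {..<r/4})" by (intro is_interval_Int) auto
        show "bounded ({0..<w} \<inter> {..<r/4})" by (intro bounded_Int) auto
        show "0 < t * r^3 / 2" using t r by simp
        fix x assume x: "x \<in> {0..<w} \<inter> {..<r/4}"
        show "0 \<le> phase_hess x y" using hess0 x y by auto
        have l: "lap_symbol x y \<le> x\<^sup>2 + y\<^sup>2" "(x\<^sup>2 + y\<^sup>2) / 2 \<le> lap_symbol x y"
          using lap_symbol_bounds[of x y] x y w by auto
        have "x\<^sup>2 + y\<^sup>2 \<le> (r/4)\<^sup>2 + (r/4)\<^sup>2" using x y by (intro add_mono power_mono) auto
        hence lu: "lap_symbol x y \<le> (r/4)\<^sup>2 + (r/4)\<^sup>2" and l0: "0 \<le> lap_symbol x y"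
          using l by (auto intro: order_trans[OF _ l(2)])
        have sx: "0 \<le> sin x" "sin x \<le> r/4"
          using x w pi_gt3 sin_x_le_x[of x] by (auto intro!: sin_ge_zero)
        have "lap_symbol x y * sin x \<le> ((r/4)\<^sup>2 + (r/4)\<^sup>2) * (r/4)"
          using lu l0 sx by (intro mult_mono) auto
        hence "4 * lap_symbol x y * sin x \<le> r^3 / 8" by (simp add: power2_eq_square power3_eq_cube)
        hence "t * (4 * lap_symbol x y * sin x) \<le> t * (r^3 / 8)" using t by simp
        moreover have "0 \<le> t * (4 * lap_symbol x y * sin x)" using t l0 sx by simp
        moreover have "0 \<le> t * r^3" using t r by simp
        ultimately show "t * r^3 / 2 \<le> \<bar>a' + t * (4 * lap_symbol x y * sin x)\<bar>"
          using a' by linarith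
      qed (rule t)
      thus ?thesis by simp
    qed
    have K: "cmod (?J E1) \<le> 8 / (t * r^3) * (r / 4)" if ne: "t * r^4 \<noteq> 1"
    proof -
      consider "\<bar>a\<bar> = t * r^3" | "\<bar>b\<bar> = t * r^3" using r(5) ne by blast
      thus ?thesis
      proof cases
        case 1
        show ?thesis
        proof (rule strip_slice_bound[OF continuous_phase E1m bd(1)])
          fix y
          show "cmod (LINT x:{x. (x, y) \<in> E1}|lborel. cis (phase a b t (x, y))) \<le> 8 / (t * r^3)"
          proof (cases "y \<in> {0..<w} \<inter> {..<r/4}")
            case True
            hence "{x. (x, y) \<in> E1} = {0..<w} \<inter> {..<r/4}" by (auto simp: E1_def)
            thus ?thesis using first[OF 1 True] by simp
          next
            case False
            hence "{x. (x, y) \<in> E1} = {}" by (auto simp: E1_def)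
            thus ?thesis using t r by (simp add: set_lebesgue_integral_def)
          qed
        qed (use r t in \<open>auto simp: E1_def\<close>)
      next
        case 2
        show ?thesis
        proof (rule strip_slice_bound'[OF continuous_phase E1m bd(1)])
          fix x
          show "cmod (LINT y:{y. (x, y) \<in> E1}|lborel. cis (phase a b t (x, y))) \<le> 8 / (t * r^3)"
          proof (cases "x \<in> {0..<w} \<inter> {..<r/4}")
            case True
            hence "{y. (x, y) \<in> E1} = {0..<w} \<inter> {..<r/4}" by (auto simp: E1_def)
            thus ?thesis using first[OF 2 True] unfolding phase_swap[of a b] by simp
          next
            case False
            hence "{y. (x, y) \<in> E1} = {}" by (auto simp: E1_def)
            thus ?thesis using t r by (simp add: set_lebesgue_integral_def)
          qed
        qed (use r t in \<open>auto simp: E1_def\<close>)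
      qed
    qed
    show ?thesis
    proof (cases "t * r^4 = 1")
      case False
      have "8 / (t * r^3) * (r / 4) = 2 / (s * (s * r\<^sup>2))"
        using s r by (simp add: power2_eq_square power3_eq_cube)
      also have "\<dots> \<le> 2 / (s * 1)" using s by (intro divide_left_mono mult_left_mono mult_pos_pos) auto
      finally show ?thesis using K[OF False] by simp
    next
      case True
      have "(s * r\<^sup>2)\<^sup>2 = 1\<^sup>2" using True s(2) by (simp add: power2_eq_square power4_eq_xxxx mult_ac)
      hence sr: "s * r\<^sup>2 = 1" using s by (metis abs_of_pos less_imp_le power2_eq_imp_eq zero_le_one order_trans)
      have "cmod (?J E1) \<le> r / 4 * (r / 4)"
      proof (rule strip_slice_bound[OF continuous_phase E1m bd(1)])
        fix y
        have "cmod (LINT x:{x. (x, y) \<in> E1}|lborel. cis (phase a b t (x, y)))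
           \<le> (LINT x|lborel. indicator {0..r/4} x)"
          unfolding set_lebesgue_integral_def
        proof (rule order_trans[OF integral_norm_bound])
          show "(LINT x|lborel. norm (indicat_real {x. (x, y) \<in> E1} x *\<^sub>R cis (phase a b t (x, y))))
            \<le> (LINT x|lborel. indicat_real {0..r/4} x)"
          proof (rule integral_mono_AE')
            show "integrable lborel (indicat_real {0..r/4})" using r by (simp add: integrable_indicator_iff)
          qed (auto simp: E1_def indicator_def)
        qed
        thus "cmod (LINT x:{x. (x, y) \<in> E1}|lborel. cis (phase a b t (x, y))) \<le> r / 4"
          using r by simp
      qed (use r in \<open>auto simp: E1_def\<close>)
      also have "\<dots> \<le> r\<^sup>2" by (simp add: power2_eq_square)
      also have "\<dots> = 1 / s" using sr s by (simp add: field_simps)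
      also have "\<dots> \<le> 2 / s" using s by (simp add: divide_right_mono)
      finally show ?thesis .
    qed
  qed
  have "cmod (?J Q) \<le> cmod (?J E1) + (cmod (?J E2) + cmod (?J E3))"
    unfolding split by (meson norm_triangle_ineq norm_triangle_mono order_refl)
  also have "\<dots> \<le> 2 / s + (160 / s + 8 / s)" using J1 J2 J3 by (intro add_mono)
  also have "\<dots> \<le> 300 / s" using s by (simp add: add_divide_distrib[symmetric] divide_right_mono)
  finally show ?thesis unfolding Q_def s_def .
qed

section \<open>Cells away from the origin and the quadrant\<close>

lemma phase_rect_second:
  assumes X: "X \<in> sets borel" "is_interval X" "X \<subseteq> {0..4}" and Y: "Y \<in> sets borel" "Y \<subseteq> {0..4}"
    and "t > 0" "1 \<le> k"
    and hess: "(\<forall>x\<in>X. \<forall>y\<in>Y. k \<le> phase_hess x y) \<or> (\<forall>x\<in>X. \<forall>y\<in>Y. phase_hess x y \<le> - k)"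
  shows "cmod (LINT p:X\<times>Y|lborel. cis (phase a b t p)) \<le> 40 / sqrt t"
proof -
  have bX: "bounded X" and bY: "bounded Y"
    using X Y by (auto intro: bounded_subset[OF bounded_closed_interval])
  have XY: "X \<times> Y \<in> sets borel" "bounded (X \<times> Y)" using X Y bX bY by (auto intro: borel_Times bounded_Times)
  have "cmod (LINT p:X\<times>Y|lborel. cis (phase a b t p)) \<le> 10 / sqrt t * 4"
  proof (rule strip_slice_bound[OF continuous_phase XY])
    fix y assume "y \<in> {0..4::real}"
    show "cmod (LINT x:{x. (x, y) \<in> X \<times> Y}|lborel. cis (phase a b t (x, y))) \<le> 10 / sqrt t"
    proof (cases "y \<in> Y")
      case True
      hence "cmod (LINT x:X|lborel. cis (phase a b t (x, y))) \<le> 10 / sqrt (t * k)"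
        using hess assms by (intro phase_second_fst[OF X(2) bX]) auto
      also have "\<dots> \<le> 10 / sqrt t" using assms by (intro divide_left_mono) auto
      finally show ?thesis using True by simp
    qed (use assms in \<open>simp add: set_lebesgue_integral_def\<close>)
  qed (use Y assms in auto)
  thus ?thesis by simp
qed

lemma phase_rect_swap:
  assumes "X \<in> sets borel" "bounded X" "Y \<in> sets borel" "bounded Y"
  shows "(LINT p:X\<times>Y|lborel. cis (phase a b t p)) = (LINT p:Y\<times>X|lborel. cis (phase b a t p))"
proof -
  have XY: "X \<times> Y \<in> sets borel" "bounded (X \<times> Y)" using assms by (auto intro: borel_Times bounded_Times)
  have "prod.swap ` (X \<times> Y) = Y \<times> X" by force
  moreover have "phase a b t (prod.swap p) = phase b a t p" for p
    using phase_swap by (cases p) simp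
  ultimately show ?thesis using set_integral_swap[OF continuous_phase XY] by simp
qed

lemma phase_rect_second':
  assumes X: "X \<in> sets borel" "is_interval X" "X \<subseteq> {0..4}" and Y: "Y \<in> sets borel" "Y \<subseteq> {0..4}"
    and t: "t > 0" "1 \<le> k"
    and hess: "(\<forall>x\<in>X. \<forall>y\<in>Y. k \<le> phase_hess x y) \<or> (\<forall>x\<in>X. \<forall>y\<in>Y. phase_hess x y \<le> - k)"
  shows "cmod (LINT p:Y\<times>X|lborel. cis (phase a b t p)) \<le> 40 / sqrt t"
proof -
  have "bounded X" "bounded Y" using X Y by (auto intro: bounded_subset[OF bounded_closed_interval])
  thus ?thesis using phase_rect_second[OF assms] phase_rect_swap[OF Y(1) _ X(1)] by simp
qed

lemma phase_antidiagonal_deriv: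
  "((\<lambda>x. phase a b t (x, z - x)) has_real_derivative
     a - b + t * (4 * lap_symbol x (z - x) * (sin x - sin (z - x)))) (at x)"
  unfolding phase_def lap_symbol_def by (auto intro!: derivative_eq_intros simp: algebra_simps)

lemma phase_antidiagonal_deriv2:
  "((\<lambda>x. a - b + t * (4 * lap_symbol x (z - x) * (sin x - sin (z - x)))) has_real_derivative
     t * (phase_hess x (z - x) + phase_hess (z - x) x - 16 * sin x * sin (z - x))) (at x)"
proof -
  have "8 * (sin x - sin (z - x))\<^sup>2 + 4 * lap_symbol x (z - x) * (cos x + cos (z - x))
    = 8 * (sin x)\<^sup>2 + 8 * (sin (z - x))\<^sup>2 - 16 * sin x * sin (z - x)
      + 4 * lap_symbol x (z - x) * (cos x + cos (z - x))"
    by (simp add: power2_eq_square algebra_simps)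
  also have "\<dots> = phase_hess x (z - x) + phase_hess (z - x) x - 16 * sin x * sin (z - x)"
    unfolding sin_squared_eq phase_hess_def lap_symbol_def by (simp add: power2_eq_square algebra_simps)
  finally have eq: "8 * (sin x - sin (z - x))\<^sup>2 + 4 * lap_symbol x (z - x) * (cos x + cos (z - x)) = \<dots>" .
  have "((\<lambda>x. a - b + t * (4 * lap_symbol x (z - x) * (sin x - sin (z - x)))) has_real_derivative
      t * (8 * (sin x - sin (z - x))\<^sup>2 + 4 * lap_symbol x (z - x) * (cos x + cos (z - x)))) (at x)"
    unfolding lap_symbol_def
    by (auto intro!: derivative_eq_intros simp: algebra_simps power2_eq_square)
  thus ?thesis unfolding eq .
qed

text \<open>Here both pure second derivatives of the phase may vanish; the mixed one does not, which makes
  the phase curved along the antidiagonals.\<close>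

lemma phase_middle:
  assumes t: "t > 0" and \<alpha>: "0 \<le> \<alpha>" "\<beta> \<le> pi"
    and cos: "\<And>x. x \<in> {\<alpha>..<\<beta>} \<Longrightarrow> cos x \<in> {-3/5..-1/4}"
  shows "cmod (LINT p:{\<alpha>..<\<beta>}\<times>{\<alpha>..<\<beta>}|lborel. cis (phase a b t p)) \<le> 80 / sqrt t"
proof -
  define A where "A = {\<alpha>..<\<beta>}"
  have AA: "A \<times> A \<in> sets borel" "bounded (A \<times> A)" unfolding A_def by (auto intro: borel_Times bounded_Times)
  define F where "F = (\<lambda>p. indicat_real (A \<times> A) p *\<^sub>R cis (phase a b t p))"
  define E where "E = {p. fst p \<in> A \<and> snd p - fst p \<in> A}"
  have E: "E \<in> sets borel"
  proof -
    have "A \<in> sets borel" by (simp add: A_def)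
    thus ?thesis unfolding E_def by measurable
  qed
  \<comment> \<open>In sheared coordinates x is at most pi and x + y at most 2 pi, rounded up to 4
    and 8. The width 8 times the slice bound \<open>10 / sqrt t\<close> makes the constant
    80.\<close>
  have "E \<subseteq> {0..4} \<times> {0..8}"
    using \<alpha> pi_less_4 by (auto simp: E_def A_def)
  hence bE: "bounded E" by (rule bounded_subset[rotated]) (intro bounded_Times bounded_closed_interval)
  have FT: "integrable lborel (\<lambda>p. F (fst p, snd p - fst p))"
  proof -
    have "continuous_on UNIV (\<lambda>p. phase a b t (fst p, snd p - fst p))"
      by (intro continuous_on_compose2[OF continuous_phase] continuous_intros) auto
    from integrable_cis_region[OF this E bE] show ?thesis
      by (rule back_subst[of "integrable lborel"]) (auto simp: F_def E_def indicator_def)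
  qed
  have "(LINT p:A\<times>A|lborel. cis (phase a b t p)) = (LINT p|lborel. F p)"
    by (simp add: F_def set_lebesgue_integral_def)
  also have "\<dots> = (LINT z|lborel. LINT x|lborel. F (x, z - x))"
    by (rule integral_shear) (use FT integrable_cis_region[OF continuous_phase AA] in \<open>simp_all add: F_def\<close>)
  finally have eq: "(LINT p:A\<times>A|lborel. cis (phase a b t p)) = (LINT z|lborel. LINT x|lborel. F (x, z - x))" .
  have int: "integrable (lborel \<Otimes>\<^sub>M lborel) (\<lambda>(x, z). F (x, z - x))"
    using FT by (simp add: lborel_prod case_prod_beta')
  have inner: "cmod (LINT x|lborel. F (x, z - x)) \<le> 10 / sqrt t * indicator {0..8} z" for z
  proof -
    define S where "S = A \<inter> {z - \<beta><..z - \<alpha>}"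
    have Sx: "x \<in> S \<longleftrightarrow> x \<in> A \<and> z - x \<in> A" for x by (auto simp: S_def A_def)
    have F: "F (x, z - x) = indicat_real S x *\<^sub>R cis (phase a b t (x, z - x))" for x
      using Sx[of x] by (auto simp: F_def indicator_def)
    show ?thesis
    proof (cases "S = {}")
      case True
      thus ?thesis unfolding F using t by simp
    next
      case False
      then obtain x0 where "x0 \<in> A" "z - x0 \<in> A" using Sx by auto
      hence "z \<in> {0..8}" using \<alpha> pi_less_4 unfolding A_def atLeastLessThan_iff atLeastAtMost_iff by linarith
      have "cmod (LINT x:S|lborel. cis (phase a b t (x, z - x))) \<le> 10 / sqrt t"
      proof (rule van_der_Corput_second_neg[OF _ _ t phase_antidiagonal_deriv phase_antidiagonal_deriv2])
        show "is_interval S" unfolding S_def A_def by (auto intro!: is_interval_Int)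
        show "bounded S" unfolding S_def A_def by (intro bounded_Int) auto
        show "continuous_on UNIV (\<lambda>x. t * (phase_hess x (z - x) + phase_hess (z - x) x - 16 * sin x * sin (z - x)))"
          unfolding phase_hess_def by (intro continuous_intros)
        fix x assume "x \<in> S"
        hence x: "x \<in> A" "z - x \<in> A" using Sx by auto
        have "phase_hess x (z - x) + phase_hess (z - x) x - 16 * sin x * sin (z - x) \<le> - 5"
          using x \<alpha> cos unfolding A_def by (intro hess_antidiagonal_neg) auto
        hence "t * (phase_hess x (z - x) + phase_hess (z - x) x - 16 * sin x * sin (z - x)) \<le> t * (-1)"
          using t by (intro mult_left_mono) auto
        thus "t * (phase_hess x (z - x) + phase_hess (z - x) x - 16 * sin x * sin (z - x)) \<le> - t" by simp
      qed
      thus ?thesis unfolding F set_lebesgue_integral_def using \<open>z \<in> {0..8}\<close> by simp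
    qed
  qed
  have "ennreal (cmod (LINT z|lborel. LINT x|lborel. F (x, z - x)))
      \<le> (\<integral>\<^sup>+z. ennreal (cmod (LINT x|lborel. F (x, z - x))) \<partial>lborel)"
    by (rule integral_norm_bound_ennreal[OF lborel_pair.integrable_snd[OF int]])
  also have "\<dots> \<le> (\<integral>\<^sup>+z. ennreal (10 / sqrt t * indicator {0..8::real} z) \<partial>lborel)"
    by (intro nn_integral_mono ennreal_leI inner)
  also have "\<dots> \<le> ennreal (10 / sqrt t * 8)" using t by (intro strip_bound_nn_integral) auto
  finally show ?thesis unfolding eq A_def[symmetric] using t by (subst (asm) ennreal_le_iff) auto
qed

text \<open>With three ranges for each cosine, the cell at the origin needs its own analysis and the
  middle cell is curved along antidiagonals. Every other cell has curvature of one sign in x or in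
  y: negative in a variable whose cosine is at most -3/5, and positive in the variable of larger
  cosine when the ranges are the upper and the middle one. The six contributions add up to
  540.\<close>

lemma phase_quadrant:
  assumes t: "t > 0"
  shows "cmod (LINT p:{0..pi}\<times>{0..pi}|lborel. cis (phase a b t p)) \<le> 600 / sqrt t"
proof -
  define \<alpha> \<beta> :: real where "\<alpha> = arccos (-1/4)" and "\<beta> = arccos (-3/5)"
  have c\<alpha>: "cos \<alpha> = -1/4" and c\<beta>: "cos \<beta> = -3/5" by (auto simp: \<alpha>_def \<beta>_def cos_arccos)
  have b\<alpha>: "0 \<le> \<alpha>" "\<alpha> \<le> pi" and b\<beta>: "0 \<le> \<beta>" "\<beta> \<le> pi"
    by (auto simp: \<alpha>_def \<beta>_def intro!: arccos_lbound arccos_ubound)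
  have \<alpha>\<beta>: "\<alpha> \<le> \<beta>" unfolding \<alpha>_def \<beta>_def by (intro arccos_le_arccos) auto
  have mono: "cos y \<le> cos x" if "0 \<le> x" "x \<le> y" "y \<le> pi" for x y
    using that cos_monotone_0_pi_le by auto
  define A0 A1 A2 I where "A0 = {0..<\<alpha>}" and "A1 = {\<alpha>..<\<beta>}" and "A2 = {\<beta>..pi}" and "I = {0..pi}"
  note defs = A0_def A1_def A2_def I_def
  have cA0: "-1/4 \<le> cos x" if "x \<in> A0" for x using mono[of x \<alpha>] that b\<alpha> c\<alpha> by (auto simp: defs)
  have cA1: "cos x \<in> {-3/5..-1/4}" if "x \<in> A1" for x
    using mono[of x \<beta>] mono[of \<alpha> x] that b\<alpha> c\<alpha> b\<beta> c\<beta> by (auto simp: defs)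
  have cA2: "cos x \<le> -3/5" if "x \<in> A2" for x using mono[of \<beta> x] that b\<beta> c\<beta> by (auto simp: defs)
  have m: "A0 \<in> sets borel" "A1 \<in> sets borel" "A2 \<in> sets borel" "I \<in> sets borel" "A0 \<union> A1 \<in> sets borel"
    by (auto simp: defs)
  have iv: "is_interval A0" "is_interval A1" "is_interval A2" by (auto simp: defs)
  have sub: "A0 \<subseteq> {0..4}" "A1 \<subseteq> {0..4}" "A2 \<subseteq> {0..4}" "I \<subseteq> {0..4}" "A0 \<union> A1 \<subseteq> {0..4}"
    using b\<alpha> b\<beta> pi_less_4 by (auto simp: defs)
  let ?J = "\<lambda>E. LINT p:E|lborel. cis (phase a b t p)"
  have si: "set_integrable lborel (X \<times> Y) (\<lambda>p. cis (phase a b t p))"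
    if "X \<in> sets borel" "Y \<in> sets borel" "X \<subseteq> {0..4}" "Y \<subseteq> {0..4}" for X Y
    unfolding set_integrable_def using that
    by (intro integrable_cis_region continuous_phase borel_Times bounded_Times)
      (auto intro: bounded_subset[OF bounded_closed_interval])
  have U1: "?J ((X \<union> X') \<times> Y) = ?J (X \<times> Y) + ?J (X' \<times> Y)"
    if "X \<in> sets borel" "X' \<in> sets borel" "Y \<in> sets borel" "X \<subseteq> {0..4}" "X' \<subseteq> {0..4}" "Y \<subseteq> {0..4}"
      "X \<inter> X' = {}" for X X' Y
    unfolding Sigma_Un_distrib1 using that by (intro set_integral_Un si) auto
  have U2: "?J (Y \<times> (X \<union> X')) = ?J (Y \<times> X) + ?J (Y \<times> X')"
    if "X \<in> sets borel" "X' \<in> sets borel" "Y \<in> sets borel" "X \<subseteq> {0..4}" "X' \<subseteq> {0..4}" "Y \<subseteq> {0..4}"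
      "X \<inter> X' = {}" for X X' Y
    unfolding Sigma_Un_distrib2 using that by (intro set_integral_Un si) auto
  have I: "I = A0 \<union> A1 \<union> A2" using b\<alpha> b\<beta> \<alpha>\<beta> by (auto simp: defs)
  have dj: "A0 \<inter> A1 = {}" "(A0 \<union> A1) \<inter> A2 = {}" using \<alpha>\<beta> by (auto simp: defs)
  have "?J (I \<times> I) = ?J ((A0 \<union> A1) \<times> I) + ?J (A2 \<times> I)"
    using U1[of "A0 \<union> A1" A2 I] m sub dj I by simp
  also have "?J ((A0 \<union> A1) \<times> I) = ?J ((A0 \<union> A1) \<times> (A0 \<union> A1)) + ?J ((A0 \<union> A1) \<times> A2)"
    using U2[of "A0 \<union> A1" A2 "A0 \<union> A1"] m sub dj I by simp
  also have "?J ((A0 \<union> A1) \<times> (A0 \<union> A1)) = ?J (A0 \<times> (A0 \<union> A1)) + ?J (A1 \<times> (A0 \<union> A1))"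
    by (rule U1) (use m sub dj in auto)
  also have "?J (A0 \<times> (A0 \<union> A1)) = ?J (A0 \<times> A0) + ?J (A0 \<times> A1)"
    by (rule U2) (use m sub dj in auto)
  also have "?J (A1 \<times> (A0 \<union> A1)) = ?J (A1 \<times> A0) + ?J (A1 \<times> A1)"
    by (rule U2) (use m sub dj in auto)
  finally have split: "?J (I \<times> I) = ?J (A0 \<times> A0) + ?J (A0 \<times> A1) + (?J (A1 \<times> A0) + ?J (A1 \<times> A1))
      + ?J ((A0 \<union> A1) \<times> A2) + ?J (A2 \<times> I)" .
  have n: "cmod (u1 + u2 + (u3 + u4) + u5 + u6) \<le> k1 + k2 + (k3 + k4) + k5 + k6"
    if "cmod u1 \<le> k1" "cmod u2 \<le> k2" "cmod u3 \<le> k3" "cmod u4 \<le> k4" "cmod u5 \<le> k5" "cmod u6 \<le> k6"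
    for u1 u2 u3 u4 u5 u6 k1 k2 k3 k4 k5 k6
    using that by (meson add_mono norm_triangle_le order_refl order_trans norm_triangle_mono)
  have "cmod (?J (I \<times> I)) \<le> 300 / sqrt t + 40 / sqrt t + (40 / sqrt t + 80 / sqrt t) + 40 / sqrt t + 40 / sqrt t"
    unfolding split
  proof (rule n)
    show "cmod (?J (A0 \<times> A0)) \<le> 300 / sqrt t"
      unfolding A0_def using arccos_quarter_le_2 c\<alpha> b\<alpha> by (intro phase_near_zero[OF t]) (auto simp: \<alpha>_def)
    show "cmod (?J (A0 \<times> A1)) \<le> 40 / sqrt t"
      by (rule phase_rect_second[where k = 1]) (use m iv sub t hess_pos_off_diagonal cA0 cA1 in auto)
    show "cmod (?J (A1 \<times> A0)) \<le> 40 / sqrt t"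
      by (rule phase_rect_second'[where k = 1]) (use m iv sub t hess_pos_off_diagonal cA0 cA1 in auto)
    show "cmod (?J (A1 \<times> A1)) \<le> 80 / sqrt t"
      unfolding A1_def using b\<alpha> b\<beta> cA1 by (intro phase_middle[OF t]) (auto simp: A1_def)
    show "cmod (?J ((A0 \<union> A1) \<times> A2)) \<le> 40 / sqrt t"
      by (rule phase_rect_second'[where k = 2]) (use m iv sub t hess_neg cA2 in auto)
    show "cmod (?J (A2 \<times> I)) \<le> 40 / sqrt t"
      by (rule phase_rect_second[where k = 2]) (use m iv sub t hess_neg cA2 in auto)
  qed
  also have "\<dots> \<le> 600 / sqrt t" using t by (simp add: add_divide_distrib[symmetric] divide_right_mono)
  finally show ?thesis unfolding I_def .
qed

section \<open>From the quadrant to the torus\<close>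

lemma integral_dilate:
  fixes F :: "real \<times> real \<Rightarrow> complex"
  assumes c: "c \<noteq> 0" "d \<noteq> 0"
    and F: "integrable lborel F" and FT: "integrable lborel (\<lambda>p. F (c * fst p, d * snd p))"
  shows "(LINT p|lborel. F p) = of_real \<bar>c * d\<bar> * (LINT p|lborel. F (c * fst p, d * snd p))"
proof -
  have "(LINT p|lborel. F p) = (LINT x|lborel. LINT y|lborel. F (x, y))"
    using lborel_pair.integral_fst[of "\<lambda>x y. F (x, y)"] F by (simp add: lborel_prod)
  also have "\<dots> = \<bar>c\<bar> *\<^sub>R (LINT x|lborel. LINT y|lborel. F (c * x, y))"
    using lborel_integral_real_affine[OF c(1), of "\<lambda>x. LINT y|lborel. F (x, y)" 0] by simp
  also have "(\<lambda>x. LINT y|lborel. F (c * x, y)) = (\<lambda>x. \<bar>d\<bar> *\<^sub>R (LINT y|lborel. F (c * x, d * y)))"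
    using lborel_integral_real_affine[OF c(2), of "\<lambda>y. F (c * x, y)" 0 for x] by auto
  also have "(LINT x|lborel. \<bar>d\<bar> *\<^sub>R (LINT y|lborel. F (c * x, d * y)))
      = \<bar>d\<bar> *\<^sub>R (LINT x|lborel. LINT y|lborel. F (c * x, d * y))"
    by simp
  also have "(LINT x|lborel. LINT y|lborel. F (c * x, d * y)) = (LINT p|lborel. F (c * fst p, d * snd p))"
    using lborel_pair.integral_fst[of "\<lambda>x y. F (c * x, d * y)"] FT by (simp add: lborel_prod case_prod_beta')
  finally show ?thesis by (simp add: abs_mult scaleR_conv_of_real)
qed

lemma AE_lborel_prod_nonzero: "AE p in lborel. fst p \<noteq> (0::real) \<and> snd p \<noteq> (0::real)"
proof -
  have "{0} \<times> UNIV \<in> null_sets (lborel \<Otimes>\<^sub>M lborel :: (real \<times> real) measure)"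
    and "UNIV \<times> {0} \<in> null_sets (lborel \<Otimes>\<^sub>M lborel :: (real \<times> real) measure)"
    by (auto simp: null_sets_def lborel.emeasure_pair_measure_Times)
  hence "AE p in lborel \<Otimes>\<^sub>M lborel. p \<notin> {0::real} \<times> (UNIV :: real set)"
    and "AE p in lborel \<Otimes>\<^sub>M lborel. p \<notin> (UNIV :: real set) \<times> {0::real}"
    by (auto intro: AE_not_in)
  thus ?thesis unfolding lborel_prod by eventually_elim auto
qed

text \<open>\<open>lap_symbol\<close> is even in each variable, so reflecting a quadrant changes
  only the signs of \<open>a\<close> and \<open>b\<close>, in which the quadrant bound is uniform.
  The four reflected squares overlap on the axes, so the decomposition holds almost everywhere
  only.\<close>

lemma phase_square_pos:
  assumes t: "t > 0"
  shows "cmod (LINT p:{-pi..pi}\<times>{-pi..pi}|lborel. cis (phase a b t p)) \<le> 2400 / sqrt t"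
proof -
  define Q where "Q = {0..pi} \<times> {0..pi}"
  have Q: "Q \<in> sets borel" "bounded Q" unfolding Q_def by (auto intro: borel_Times bounded_Times)
  define G where "G = (\<lambda>c d p. indicat_real Q (c * fst p, d * snd p) *\<^sub>R cis (phase a b t p))"
  have sgn: "integrable lborel (G c d) \<and> (LINT p|lborel. G c d p) = (LINT p:Q|lborel. cis (phase (c * a) (d * b) t p))"
    if cd: "c \<in> {-1, 1}" "d \<in> {-1, 1}" for c d
  proof -
    have cc: "c * c = 1" "d * d = 1" using cd by auto
    define E where "E = (\<lambda>p. (c * fst p, d * snd p)) -` Q"
    have contm: "continuous_on UNIV (\<lambda>p :: real \<times> real. (c * fst p, d * snd p))"
      by (intro continuous_intros)
    have E: "E \<in> sets borel" unfolding E_def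
      using measurable_sets[OF borel_measurable_continuous_onI[OF contm] Q(1)] by simp
    have "E \<subseteq> {-pi..pi} \<times> {-pi..pi}" using cd by (auto simp: E_def Q_def)
    hence bE: "bounded E" by (rule bounded_subset[rotated]) (intro bounded_Times bounded_closed_interval)
    have ph: "phase a b t (c * x, d * y) = phase (c * a) (d * b) t (x, y)" for x y
      using cd by (auto simp: phase_def lap_symbol_def)
    have Geq: "G c d = (\<lambda>p. indicat_real E p *\<^sub>R cis (phase a b t p))"
      by (auto simp: G_def E_def indicator_def fun_eq_iff)
    have int: "integrable lborel (G c d)"
      unfolding Geq by (rule integrable_cis_region[OF continuous_phase E bE])
    have GT: "G c d (c * fst p, d * snd p) = indicat_real Q p *\<^sub>R cis (phase (c * a) (d * b) t p)" for p
      using cc by (simp add: G_def ph mult.assoc[symmetric])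
    have int': "integrable lborel (\<lambda>p. G c d (c * fst p, d * snd p))"
      unfolding GT by (rule integrable_cis_region[OF continuous_phase Q])
    have "\<bar>c * d\<bar> = 1" using cd by auto
    thus ?thesis using integral_dilate[OF _ _ int int'] cd int
      unfolding GT set_lebesgue_integral_def by auto
  qed
  have "(LINT p:{-pi..pi}\<times>{-pi..pi}|lborel. cis (phase a b t p))
      = (LINT p|lborel. (G 1 1 p + G 1 (-1) p) + (G (-1) 1 p + G (-1) (-1) p))"
    unfolding set_lebesgue_integral_def
  proof (rule integral_cong_AE)
    have "{-pi..pi} \<times> {-pi..pi} \<in> sets (borel :: (real \<times> real) measure)" by (intro borel_Times) auto
    thus "(\<lambda>p. indicat_real ({-pi..pi} \<times> {-pi..pi}) p *\<^sub>R cis (phase a b t p)) \<in> borel_measurable lborel"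
      using borel_measurable_continuous_onI[OF continuous_phase] by measurable
    show "(\<lambda>p. (G 1 1 p + G 1 (-1) p) + (G (-1) 1 p + G (-1) (-1) p)) \<in> borel_measurable lborel"
      using sgn by (intro borel_measurable_add borel_measurable_integrable) auto
    show "AE p in lborel. indicat_real ({-pi..pi} \<times> {-pi..pi}) p *\<^sub>R cis (phase a b t p)
       = (G 1 1 p + G 1 (-1) p) + (G (-1) 1 p + G (-1) (-1) p)"
      using AE_lborel_prod_nonzero
    proof eventually_elim
      fix p :: "real \<times> real" assume p: "fst p \<noteq> 0 \<and> snd p \<noteq> 0"
      obtain x y where xy: "p = (x, y)" by (cases p)
      have "indicat_real ({-pi..pi} \<times> {-pi..pi}) p = (indicat_real Q (x, y) + indicat_real Q (x, -y))
         + (indicat_real Q (-x, y) + indicat_real Q (-x, -y))"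
        using p unfolding xy Q_def
        by (cases "0 < x"; cases "0 < y") (auto simp: indicator_def)
      thus "indicat_real ({-pi..pi} \<times> {-pi..pi}) p *\<^sub>R cis (phase a b t p)
       = (G 1 1 p + G 1 (-1) p) + (G (-1) 1 p + G (-1) (-1) p)"
        by (simp add: G_def xy scaleR_add_left)
    qed
  qed
  also have "\<dots> = ((LINT p|lborel. G 1 1 p) + (LINT p|lborel. G 1 (-1) p))
     + ((LINT p|lborel. G (-1) 1 p) + (LINT p|lborel. G (-1) (-1) p))"
    using sgn by (simp add: Bochner_Integration.integral_add)
  also have "cmod \<dots> \<le> (600 / sqrt t + 600 / sqrt t) + (600 / sqrt t + 600 / sqrt t)"
    using sgn phase_quadrant[OF t] unfolding Q_def
    by (intro order_trans[OF norm_triangle_ineq] add_mono) auto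
  finally show ?thesis by simp
qed

lemma phase_square:
  assumes t: "t \<noteq> 0"
  shows "cmod (LINT p:{-pi..pi}\<times>{-pi..pi}|lborel. cis (phase a b t p)) \<le> 2400 / sqrt \<bar>t\<bar>"
proof (cases "t > 0")
  case False
  have "phase a b t p = - phase (-a) (-b) (-t) p" for p by (simp add: phase_def)
  thus ?thesis using phase_square_pos[of "-t" "-a" "-b"] False t
    by (simp add: set_integral_cis_uminus)
qed (use phase_square_pos in auto)

lemma continuous_on_vec2 [continuous_intros]:
  "continuous_on UNIV (\<lambda>p :: real \<times> real. if i = (1::2) then fst p else snd p)"
  by (cases "i = 1") (auto intro!: continuous_intros)

text \<open>Transfers integrals over the torus to pairs of reals, where slicing by Fubini was
  carried out.\<close>

lemma lborel_real2:
  "(lborel :: (real^2) measure) = distr lborel borel (\<lambda>p. \<chi> i. if i = 1 then fst p else snd p)"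
proof (rule lborel_eqI)
  define T :: "real \<times> real \<Rightarrow> real^2" where "T = (\<lambda>p. \<chi> i. if i = 1 then fst p else snd p)"
  have T: "T \<in> borel_measurable borel" unfolding T_def
    by (intro borel_measurable_continuous_onI continuous_on_vec_lambda) (auto intro!: continuous_intros)
  fix l u :: "real^2" assume le: "\<And>b. b \<in> Basis \<Longrightarrow> l \<bullet> b \<le> u \<bullet> b"
  have lu: "l $ i \<le> u $ i" for i using le[of "axis i 1"] by (simp add: inner_axis axis_in_Basis_iff)
  have vim: "T -` box l u = box (l $ 1) (u $ 1) \<times> box (l $ 2) (u $ 2)"
    by (auto simp: T_def mem_box_cart forall_2)
  have "emeasure (distr lborel borel T) (box l u) = emeasure lborel (box (l $ 1) (u $ 1) \<times> box (l $ 2) (u $ 2))"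
    using T by (simp add: emeasure_distr vim)
  also have "\<dots> = ennreal (u $ 1 - l $ 1) * ennreal (u $ 2 - l $ 2)"
    unfolding lborel_prod[symmetric] using lu
    by (subst lborel.emeasure_pair_measure_Times) auto
  also have "\<dots> = ennreal (\<Prod>i\<in>UNIV. u $ i - l $ i)"
    using lu by (simp add: UNIV_2 ennreal_mult)
  also have "(\<Prod>i\<in>UNIV. u $ i - l $ i) = (\<Prod>b\<in>Basis. (u - l) \<bullet> b)"
    by (simp add: Basis_vec_def axis_eq_axis cart_eq_inner_axis inner_diff_left
        prod.reindex[of "\<lambda>i. axis i (1::real)", unfolded inj_on_def image_def, simplified] UNION_singleton_eq_range
        prod.reindex inj_on_def)
  finally show "emeasure (distr lborel borel (\<lambda>p. \<chi> i. if i = 1 then fst p else snd p)) (box l u) = ennreal (\<Prod>b\<in>Basis. (u - l) \<bullet> b)"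
    unfolding T_def .
qed simp

lemma integral_lborel_real2:
  fixes f :: "real^2 \<Rightarrow> complex"
  assumes "f \<in> borel_measurable borel"
  shows "(LINT \<xi>|lborel. f \<xi>) = (LINT p|lborel. f (\<chi> i. if i = 1 then fst p else snd p))"
proof -
  have "(\<lambda>p :: real \<times> real. (\<chi> i. if i = 1 then fst p else snd p) :: real^2) \<in> borel_measurable borel"
    by (intro borel_measurable_continuous_onI continuous_on_vec_lambda) (auto intro!: continuous_intros)
  thus ?thesis using assms by (subst lborel_real2) (simp add: integral_distr)
qed

lemma omega_pow4:
  assumes "h > 0"
  shows "omega h \<xi> ^ 4 = (lap_symbol (h * \<xi> $ 1) (h * \<xi> $ 2))\<^sup>2 / h ^ 4"
proof -
  have nn: "0 \<le> lap_symbol x y" for x y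
    using cos_le_one[of x] cos_le_one[of y] by (simp add: lap_symbol_def del: cos_le_one)
  have "omega h \<xi> = sqrt (lap_symbol (h * \<xi> $ 1) (h * \<xi> $ 2)) / h"
    by (simp add: omega_def lap_symbol_def UNIV_2)
  moreover have "sqrt S ^ 4 = S\<^sup>2" if "0 \<le> S" for S
    using that by (metis num_double numeral_times_numeral power_mult real_sqrt_pow2)
  ultimately show ?thesis using nn by (simp add: power_divide)
qed

lemma torus_integral_eq:
  fixes f :: "real^2 \<Rightarrow> complex"
  assumes h: "h > 0" and f: "continuous_on UNIV f"
  shows "(LINT \<xi>|lebesgue_on (torus h). f \<xi>) =
    of_real (1 / h\<^sup>2) * (LINT p:{-pi..pi}\<times>{-pi..pi}|lborel. f (\<chi> i. (if i = 1 then fst p else snd p) / h))"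
proof -
  have fm [measurable]: "f \<in> borel_measurable borel" by (rule borel_measurable_continuous_onI[OF f])
  have tm [measurable]: "torus h \<in> sets borel" by (simp add: torus_def)
  define F where "F = (\<lambda>p. indicat_real (torus h) (\<chi> i. if i = 1 then fst p else snd p) *\<^sub>R
     f (\<chi> i. if i = 1 then fst p else snd p))"
  define Q where "Q = {-pi..pi} \<times> {-pi..pi}"
  define Qh where "Qh = {-pi/h..pi/h} \<times> {-pi/h..pi/h}"
  have int: "integrable lborel (\<lambda>p. indicat_real S p *\<^sub>R g p)"
    if "compact S" "continuous_on UNIV g" for S and g :: "real \<times> real \<Rightarrow> complex"
    by (rule borel_integrable_compact[OF that(1) continuous_on_subset[OF that(2)]]) simp
  have cv: "continuous_on UNIV (\<lambda>p::real\<times>real. f (\<chi> i. (if i = 1 then fst p else snd p) / c))" if "c > 0" for c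
    using that by (intro continuous_on_compose2[OF f] continuous_on_vec_lambda)
      (auto intro!: continuous_intros)
  have Feq: "F p = indicat_real Qh p *\<^sub>R f (\<chi> i. (if i = 1 then fst p else snd p) / 1)" for p
    by (cases p) (auto simp: F_def Qh_def torus_def mem_box_cart forall_2 indicator_def)
  have FTeq: "F ((1/h) * fst p, (1/h) * snd p) = indicat_real Q p *\<^sub>R f (\<chi> i. (if i = 1 then fst p else snd p) / h)" for p
  proof -
    have eq: "(\<chi> i::2. if i = 1 then fst ((1/h) * fst p, (1/h) * snd p) else snd ((1/h) * fst p, (1/h) * snd p))
        = (\<chi> i. (if i = 1 then fst p else snd p) / h)"
      by (auto simp: vec_eq_iff)
    have "(\<chi> i::2. (if i = 1 then fst p else snd p) / h) \<in> torus h \<longleftrightarrow> p \<in> Q"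
      using h by (cases p) (auto simp: Q_def torus_def mem_box_cart forall_2 field_simps)
    thus ?thesis unfolding F_def eq by (simp add: indicator_def)
  qed
  have "(LINT \<xi>|lebesgue_on (torus h). f \<xi>) = (LINT \<xi>|lebesgue. indicat_real (torus h) \<xi> *\<^sub>R f \<xi>)"
    by (subst integral_restrict_space) auto
  also have "\<dots> = (LINT \<xi>|lborel. indicat_real (torus h) \<xi> *\<^sub>R f \<xi>)"
    by (rule integral_completion) measurable
  also have "\<dots> = (LINT p|lborel. F p)"
    unfolding F_def by (rule integral_lborel_real2) measurable
  also have "\<dots> = of_real \<bar>(1/h) * (1/h)\<bar> * (LINT p|lborel. F ((1/h) * fst p, (1/h) * snd p))"
  proof (rule integral_dilate)
    show "integrable lborel F" unfolding Feq by (intro int cv) (auto simp: Qh_def intro: compact_Times)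
    show "integrable lborel (\<lambda>p. F ((1/h) * fst p, (1/h) * snd p))"
      unfolding FTeq using h by (intro int cv) (auto simp: Q_def intro: compact_Times)
  qed (use h in auto)
  also have "\<dots> = of_real (1 / h\<^sup>2) * (LINT p:Q|lborel. f (\<chi> i. (if i = 1 then fst p else snd p) / h))"
    unfolding FTeq set_lebesgue_integral_def by (simp add: power2_eq_square abs_mult)
  finally show ?thesis unfolding Q_def .
qed

lemma inner_real2: "v \<bullet> w = v $ 1 * w $ 1 + v $ 2 * w $ 2" for v w :: "real^2"
  by (simp add: inner_vec_def UNIV_2)

lemma continuous_omega_pow4: "h > 0 \<Longrightarrow> continuous_on UNIV (\<lambda>\<xi>. omega h \<xi> ^ 4)"
  unfolding omega_def by (intro continuous_intros)

text \<open>The bound is scale invariant, hence uniform in \<^term>\<open>h\<close>.\<close>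

lemma dispersive:
  assumes h: "h > 0" and t: "t \<noteq> 0"
  shows "cmod (LINT \<xi>|lebesgue_on (torus h). cis (v \<bullet> \<xi> + t * omega h \<xi> ^ 4)) \<le> 2400 / sqrt \<bar>t\<bar>"
proof -
  have c: "continuous_on UNIV (\<lambda>\<xi>. cis (v \<bullet> \<xi> + t * omega h \<xi> ^ 4))"
    by (intro continuous_intros continuous_omega_pow4 h)
  have "phase (v $ 1 / h) (v $ 2 / h) (t / h^4) p = v \<bullet> (\<chi> i. (if i = 1 then fst p else snd p) / h)
      + t * omega h (\<chi> i. (if i = 1 then fst p else snd p) / h) ^ 4" for p
    unfolding omega_pow4[OF h] inner_real2 using h by (simp add: phase_def)
  hence "(LINT \<xi>|lebesgue_on (torus h). cis (v \<bullet> \<xi> + t * omega h \<xi> ^ 4)) = of_real (1 / h\<^sup>2) *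
     (LINT p:{-pi..pi}\<times>{-pi..pi}|lborel. cis (phase (v $ 1 / h) (v $ 2 / h) (t / h^4) p))"
    by (simp add: torus_integral_eq[OF h c])
  also have "cmod \<dots> \<le> (1 / h\<^sup>2) * (2400 / sqrt \<bar>t / h^4\<bar>)"
    unfolding norm_mult using h t by (intro mult_mono phase_square) (auto simp: norm_divide norm_power)
  also have "sqrt \<bar>t / h^4\<bar> = sqrt \<bar>t\<bar> / h\<^sup>2"
  proof -
    have "sqrt (h^4) = h\<^sup>2" using h real_sqrt_unique[of "h\<^sup>2" "h^4"] by simp
    thus ?thesis using h by (simp add: real_sqrt_divide abs_divide)
  qed
  also have "(1 / h\<^sup>2) * (2400 / (sqrt \<bar>t\<bar> / h\<^sup>2)) = 2400 / sqrt \<bar>t\<bar>" using h by simp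
  finally show ?thesis .
qed

section \<open>Fractional integration\<close>

lemma nn_integral_abs_diff_le:
  fixes g :: "real \<Rightarrow> ennreal"
  assumes [measurable]: "g \<in> borel_measurable borel"
  shows "(\<integral>\<^sup>+s. g \<bar>t - s\<bar> \<partial>lborel) \<le> 2 * (\<integral>\<^sup>+u. g u * indicator {0..} u \<partial>lborel)"
proof -
  let ?I = "\<integral>\<^sup>+u. g u * indicator {0..} u \<partial>lborel"
  have 1: "(\<integral>\<^sup>+s. g (t - s) * indicator {0..} (t - s) \<partial>lborel) = ?I"
    using nn_integral_real_affine[of "\<lambda>u. g u * indicator {0..} u" "-1" t] by simp
  have 2: "(\<integral>\<^sup>+s. g (s - t) * indicator {0..} (s - t) \<partial>lborel) = ?I"
    using nn_integral_real_affine[of "\<lambda>u. g u * indicator {0..} u" 1 "-t"] by simp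
  have "(\<integral>\<^sup>+s. g \<bar>t - s\<bar> \<partial>lborel) \<le>
      (\<integral>\<^sup>+s. g (t - s) * indicator {0..} (t - s) + g (s - t) * indicator {0..} (s - t) \<partial>lborel)"
    by (intro nn_integral_mono) (auto simp: indicator_def abs_if)
  also have "\<dots> = ?I + ?I" by (subst nn_integral_add) (auto simp: 1 2)
  finally show ?thesis by (simp add: mult_2)
qed

lemma nn_integral_inverse_sqrt_near:
  assumes "0 < a"
  shows "(\<integral>\<^sup>+s. ennreal (indicator {0..a} \<bar>t - s\<bar> / sqrt \<bar>t - s\<bar>) \<partial>lborel) \<le> ennreal (4 * sqrt a)"
proof -
  have "(\<integral>\<^sup>+s. ennreal (indicator {0..a} \<bar>t - s\<bar> / sqrt \<bar>t - s\<bar>) \<partial>lborel)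
      \<le> 2 * (\<integral>\<^sup>+u. ennreal (indicator {0..a} u / sqrt u) * indicator {0..} u \<partial>lborel)"
    by (rule nn_integral_abs_diff_le) measurable
  also have "(\<integral>\<^sup>+u. ennreal (indicator {0..a} u / sqrt u) * indicator {0..} u \<partial>lborel)
      = (\<integral>\<^sup>+u. ennreal (u powr (-1/2)) * indicator {0..a} u \<partial>lborel)"
    by (intro nn_integral_cong) (auto simp: indicator_def powr_half_sqrt[symmetric] powr_minus_divide)
  also have "\<dots> = ennreal (a powr (-1/2 + 1) / (-1/2 + 1))"
    using assms by (intro nn_integral_has_integral_lebesgue' has_integral_powr_from_0) auto
  also have "a powr (-1/2 + 1) / (-1/2 + 1) = 2 * sqrt a" using assms by (simp add: powr_half_sqrt)
  also have "2 * ennreal (2 * sqrt a) = ennreal (4 * sqrt a)"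
    using assms by (simp add: ennreal_mult[symmetric] flip: ennreal_numeral)
  finally show ?thesis .
qed

lemma nn_integral_inverse_square_far:
  assumes "0 < a"
  shows "(\<integral>\<^sup>+s. ennreal (indicator {a..} \<bar>t - s\<bar> / \<bar>t - s\<bar>\<^sup>2) \<partial>lborel) \<le> ennreal (2 / a)"
proof -
  have "(\<integral>\<^sup>+s. ennreal (indicator {a..} \<bar>t - s\<bar> / \<bar>t - s\<bar>\<^sup>2) \<partial>lborel)
      \<le> 2 * (\<integral>\<^sup>+u. ennreal (indicator {a..} u / u\<^sup>2) * indicator {0..} u \<partial>lborel)"
    by (rule nn_integral_abs_diff_le) measurable
  also have "(\<integral>\<^sup>+u. ennreal (indicator {a..} u / u\<^sup>2) * indicator {0..} u \<partial>lborel)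
      = (\<integral>\<^sup>+u. ennreal (1 / u\<^sup>2) * indicator {a..} u \<partial>lborel)"
    using assms by (intro nn_integral_cong) (auto simp: indicator_def)
  also have "\<dots> = ennreal (0 - (- 1 / a))"
  proof (rule nn_integral_FTC_atLeast)
    show "((\<lambda>u. - 1 / u) has_real_derivative 1 / u\<^sup>2) (at u)" if "a \<le> u" for u
      using that assms by (auto intro!: derivative_eq_intros simp: power2_eq_square)
    show "((\<lambda>u::real. - 1 / u) \<longlongrightarrow> 0) at_top"
      by (rule real_tendsto_divide_at_top[OF tendsto_const filterlim_ident])
  qed auto
  also have "2 * ennreal (0 - (- 1 / a)) = ennreal (2 / a)"
    using assms by (simp add: ennreal_mult[symmetric] flip: ennreal_numeral)
  finally show ?thesis .
qed

text \<open>Young's inequality with exponents 4/3 and 4, up to the constants. Comparing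
  \<open>k\<close> with \<open>e * m\<close> shows directly that one of the two summands already
  suffices.\<close>

lemma young_cubic:
  fixes m k e :: real
  assumes "0 \<le> m" "0 \<le> k" "0 < e"
  shows "m^3 * k \<le> e * m^4 + k^4 / e^3"
proof (cases "k \<le> e * m")
  case True
  have "m^3 * k \<le> m^3 * (e * m)" using True assms by (intro mult_left_mono) auto
  also have "\<dots> = e * m^4" by (simp add: power4_eq_xxxx power3_eq_cube)
  finally show ?thesis using assms by (simp add: add_increasing2)
next
  case False
  hence "m \<le> k / e" using assms by (simp add: field_simps)
  hence "m^3 * k \<le> (k / e)^3 * k" using assms by (intro mult_right_mono power_mono) auto
  also have "\<dots> = k^4 / e^3" by (simp add: power_divide power4_eq_xxxx power3_eq_cube)
  finally show ?thesis using assms by (simp add: add_increasing)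
qed

text \<open>Diagonal Hardy--Littlewood--Sobolev inequality in dimension one. Since the form is symmetric it
  suffices to integrate over the region where \<^term>\<open>m s \<le> m t\<close>, and there \<^term>\<open>m t\<close> controls the
  singularity of the kernel.\<close>

lemma HLS_half_inner:
  fixes m :: "real \<Rightarrow> real"
  assumes [measurable]: "m \<in> borel_measurable borel" and nn: "\<And>t. 0 \<le> m t"
    and P: "0 < P" "(\<integral>\<^sup>+s. ennreal (m s ^ 4) \<partial>lborel) \<le> ennreal P"
  shows "(\<integral>\<^sup>+s. ennreal (indicator {..m t} (m s) * m s ^ 3 / sqrt \<bar>t - s\<bar>) \<partial>lborel) \<le> ennreal (7 * m t * sqrt P)"
proof (cases "m t = 0")
  case True
  hence "(\<integral>\<^sup>+s. ennreal (indicator {..m t} (m s) * m s ^ 3 / sqrt \<bar>t - s\<bar>) \<partial>lborel) = (\<integral>\<^sup>+s. 0 \<partial>(lborel :: real measure))"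
    using nn by (intro nn_integral_cong) (auto simp: indicator_def intro: antisym)
  thus ?thesis by simp
next
  case False
  define A where "A = m t"
  have A: "0 < A" using False nn[of t] by (simp add: A_def)
  \<comment> \<open>These choices give all three terms below the size \<open>A * sqrt P\<close>.
    Near the singularity \<open>m s\<close> is at most \<open>A\<close>, giving
    \<open>A^3 * 4 * sqrt a\<close>, that is 4 units; farther away \<open>young_cubic\<close>
    replaces the kernel by its integrable fourth power, and \<open>e * P\<close> and
    \<open>2 / (e^3 * a)\<close> give 1 and 2 units. Hence the factor 7.\<close>
  define a e where "a = P / A^4" and "e = A / sqrt P"
  have a: "0 < a" and e: "0 < e" using A P by (auto simp: a_def e_def)
  have pw: "indicator {..m t} (m s) * m s ^ 3 / sqrt \<bar>t - s\<bar>
      \<le> A^3 * (indicator {0..a} \<bar>t - s\<bar> / sqrt \<bar>t - s\<bar>) + e * m s ^ 4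
        + 1 / e^3 * (indicator {a..} \<bar>t - s\<bar> / \<bar>t - s\<bar>\<^sup>2)" for s
  proof (cases "\<bar>t - s\<bar> \<le> a")
    case True
    have "indicator {..m t} (m s) * m s ^ 3 \<le> A^3"
      using nn A by (auto simp: indicator_def A_def intro: power_mono)
    hence "indicator {..m t} (m s) * m s ^ 3 / sqrt \<bar>t - s\<bar> \<le> A^3 * (indicator {0..a} \<bar>t - s\<bar> / sqrt \<bar>t - s\<bar>)"
      using True by (simp add: divide_right_mono)
    moreover have "0 \<le> e * m s ^ 4" "0 \<le> 1 / e^3 * (indicator {a..} \<bar>t - s\<bar> / \<bar>t - s\<bar>\<^sup>2)"
      using e nn[of s] by simp_all
    ultimately show ?thesis by linarith
  next
    case far: False
    have "indicator {..m t} (m s) * m s ^ 3 / sqrt \<bar>t - s\<bar> \<le> m s ^ 3 * (1 / sqrt \<bar>t - s\<bar>)"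
      using nn[of s] by (simp add: indicator_def)
    also have "\<dots> \<le> e * m s ^ 4 + (1 / sqrt \<bar>t - s\<bar>)^4 / e^3"
      using nn[of s] e by (intro young_cubic) auto
    also have "sqrt \<bar>t - s\<bar> ^ 4 = \<bar>t - s\<bar>\<^sup>2"
      using power_mult[of "sqrt \<bar>t - s\<bar>" 2 2] by simp
    hence "(1 / sqrt \<bar>t - s\<bar>)^4 / e^3 = 1 / e^3 * (indicator {a..} \<bar>t - s\<bar> / \<bar>t - s\<bar>\<^sup>2)"
      using far by (simp add: power_divide)
    finally show ?thesis using far by simp
  qed
  have lin: "ennreal (x * u + y * v + z * w) = ennreal x * ennreal u + ennreal y * ennreal v + ennreal z * ennreal w"
    if "0 \<le> x" "0 \<le> u" "0 \<le> y" "0 \<le> v" "0 \<le> z" "0 \<le> w" for x u y v z w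
    using that by (simp add: ennreal_plus ennreal_mult)
  have "(\<integral>\<^sup>+s. ennreal (indicator {..m t} (m s) * m s ^ 3 / sqrt \<bar>t - s\<bar>) \<partial>lborel) \<le>
     (\<integral>\<^sup>+s. ennreal (A^3) * ennreal (indicator {0..a} \<bar>t - s\<bar> / sqrt \<bar>t - s\<bar>) + ennreal e * ennreal (m s ^ 4)
        + ennreal (1 / e^3) * ennreal (indicator {a..} \<bar>t - s\<bar> / \<bar>t - s\<bar>\<^sup>2) \<partial>lborel)"
  proof (rule nn_integral_mono)
    fix s
    show "ennreal (indicator {..m t} (m s) * m s ^ 3 / sqrt \<bar>t - s\<bar>) \<le> ennreal (A^3) * ennreal (indicator {0..a} \<bar>t - s\<bar> / sqrt \<bar>t - s\<bar>) + ennreal e * ennreal (m s ^ 4)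
        + ennreal (1 / e^3) * ennreal (indicator {a..} \<bar>t - s\<bar> / \<bar>t - s\<bar>\<^sup>2)"
      using ennreal_leI[OF pw[of s]] A e nn[of s] by (subst (asm) lin) auto
  qed
  also have "\<dots> = ennreal (A^3) * (\<integral>\<^sup>+s. ennreal (indicator {0..a} \<bar>t - s\<bar> / sqrt \<bar>t - s\<bar>) \<partial>lborel)
      + ennreal e * (\<integral>\<^sup>+s. ennreal (m s ^ 4) \<partial>lborel)
      + ennreal (1 / e^3) * (\<integral>\<^sup>+s. ennreal (indicator {a..} \<bar>t - s\<bar> / \<bar>t - s\<bar>\<^sup>2) \<partial>lborel)"
    by (simp add: nn_integral_add nn_integral_cmult)
  also have "\<dots> \<le> ennreal (A^3) * ennreal (4 * sqrt a) + ennreal e * ennreal P + ennreal (1 / e^3) * ennreal (2 / a)"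
    by (intro add_mono mult_left_mono nn_integral_inverse_sqrt_near nn_integral_inverse_square_far a P) auto
  also have "\<dots> = ennreal (A^3 * (4 * sqrt a) + e * P + 1 / e^3 * (2 / a))"
    using A a e P by (subst lin) auto
  also have "A^3 * (4 * sqrt a) + e * P + 1 / e^3 * (2 / a) = 7 * m t * sqrt P"
  proof -
    define q where "q = sqrt P"
    have q: "q > 0" "P = q * q" using P by (auto simp: q_def)
    have sa: "sqrt a = q / A\<^sup>2"
      unfolding a_def using A q(1) by (intro real_sqrt_unique) (auto simp: q(2) power_divide power2_eq_square power4_eq_xxxx)
    have ee: "e = A / q" by (simp add: e_def q_def)
    have aa: "a = q * q / A^4" by (simp add: a_def q)
    have "A^3 * (4 * sqrt a) + e * P + 1 / e^3 * (2 / a) = 7 * A * q"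
      unfolding sa ee q(2) unfolding aa
      using q(1) A by (simp add: field_simps power2_eq_square power3_eq_cube power4_eq_xxxx)
    thus ?thesis by (simp add: A_def q_def)
  qed
  finally show ?thesis .
qed

text \<open>The inequality is applied to \<open>m^3\<close>: its L^(4/3) norm is the power 3/4 of
  the integral of \<open>m^4\<close>, so \<open>P * sqrt P\<close> is the square of that norm. The
  two halves of the plane, exchanged by swapping \<open>t\<close> and \<open>s\<close>, account for
  14 = 2 * 7.\<close>

lemma HLS_diagonal:
  fixes m :: "real \<Rightarrow> real"
  assumes [measurable]: "m \<in> borel_measurable borel" and nn: "\<And>t. 0 \<le> m t"
    and P: "0 < P" "(\<integral>\<^sup>+s. ennreal (m s ^ 4) \<partial>lborel) \<le> ennreal P"
  shows "(\<integral>\<^sup>+t. \<integral>\<^sup>+s. ennreal (m t ^ 3 * m s ^ 3 / sqrt \<bar>t - s\<bar>) \<partial>lborel \<partial>lborel) \<le> ennreal (14 * P * sqrt P)"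
proof -
  define K where "K = (\<lambda>t s. m t ^ 3 * (indicator {..m t} (m s) * m s ^ 3 / sqrt \<bar>t - s\<bar>))"
  have Keq: "K = (\<lambda>t s. if m s \<le> m t then m t ^ 3 * (m s ^ 3 / sqrt \<bar>t - s\<bar>) else 0)"
    by (auto simp: K_def indicator_def fun_eq_iff)
  have Km [measurable]: "(\<lambda>p. K (fst p) (snd p)) \<in> borel_measurable (lborel \<Otimes>\<^sub>M lborel)"
    unfolding Keq by measurable
  have Km' [measurable]: "K t \<in> borel_measurable borel" "(\<lambda>t. K t s) \<in> borel_measurable borel" for t s
    unfolding Keq by measurable
  have K0: "0 \<le> K t s" for t s unfolding K_def using nn by simp
  have half: "(\<integral>\<^sup>+t. \<integral>\<^sup>+s. ennreal (K t s) \<partial>lborel \<partial>lborel) \<le> ennreal (7 * sqrt P * P)"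
  proof -
    have "(\<integral>\<^sup>+t. \<integral>\<^sup>+s. ennreal (K t s) \<partial>lborel \<partial>lborel) \<le> (\<integral>\<^sup>+t. ennreal (7 * sqrt P) * ennreal (m t ^ 4) \<partial>lborel)"
    proof (rule nn_integral_mono)
      fix t
      have "(\<integral>\<^sup>+s. ennreal (K t s) \<partial>lborel) = ennreal (m t ^ 3) *
          (\<integral>\<^sup>+s. ennreal (indicator {..m t} (m s) * m s ^ 3 / sqrt \<bar>t - s\<bar>) \<partial>lborel)"
        unfolding K_def ennreal_mult'[OF zero_le_power[OF nn]] by (rule nn_integral_cmult) measurable
      also have "\<dots> \<le> ennreal (m t ^ 3) * ennreal (7 * m t * sqrt P)"
        by (intro mult_left_mono HLS_half_inner assms) auto
      also have "\<dots> = ennreal (7 * sqrt P) * ennreal (m t ^ 4)"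
        using nn[of t] P by (simp add: ennreal_mult[symmetric] power3_eq_cube power4_eq_xxxx mult_ac)
      finally show "(\<integral>\<^sup>+s. ennreal (K t s) \<partial>lborel) \<le> ennreal (7 * sqrt P) * ennreal (m t ^ 4)" .
    qed
    also have "\<dots> = ennreal (7 * sqrt P) * (\<integral>\<^sup>+t. ennreal (m t ^ 4) \<partial>lborel)" by (simp add: nn_integral_cmult)
    also have "\<dots> \<le> ennreal (7 * sqrt P) * ennreal P" by (intro mult_left_mono P) auto
    finally show ?thesis using P by (simp add: ennreal_mult)
  qed
  have pw: "m t ^ 3 * m s ^ 3 / sqrt \<bar>t - s\<bar> \<le> K t s + K s t" for t s
  proof (cases "m s \<le> m t")
    case True thus ?thesis using K0[of s t] by (simp add: K_def)
  next
    case False thus ?thesis using K0[of t s] by (simp add: K_def abs_minus_commute mult.commute)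
  qed
  have "(\<integral>\<^sup>+t. \<integral>\<^sup>+s. ennreal (m t ^ 3 * m s ^ 3 / sqrt \<bar>t - s\<bar>) \<partial>lborel \<partial>lborel)
     \<le> (\<integral>\<^sup>+t. \<integral>\<^sup>+s. ennreal (K t s) + ennreal (K s t) \<partial>lborel \<partial>lborel)"
    using pw K0 by (intro nn_integral_mono) (simp add: ennreal_plus[symmetric] ennreal_leI del: ennreal_plus)
  also have "\<dots> = (\<integral>\<^sup>+t. \<integral>\<^sup>+s. ennreal (K t s) \<partial>lborel \<partial>lborel) + (\<integral>\<^sup>+t. \<integral>\<^sup>+s. ennreal (K s t) \<partial>lborel \<partial>lborel)"
  proof -
    have [measurable]: "(\<lambda>p. ennreal (K (fst p) (snd p))) \<in> borel_measurable (lborel \<Otimes>\<^sub>M lborel)"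
      "(\<lambda>p. ennreal (K (snd p) (fst p))) \<in> borel_measurable (lborel \<Otimes>\<^sub>M lborel)"
      using measurable_compose[OF measurable_pair_swap'[of lborel lborel] Km]
      by (simp_all add: case_prod_beta')
    show ?thesis
      using Km
      by (subst nn_integral_add[symmetric])
        (auto intro!: nn_integral_cong nn_integral_add lborel.borel_measurable_nn_integral)
  qed
  also have "(\<integral>\<^sup>+t. \<integral>\<^sup>+s. ennreal (K s t) \<partial>lborel \<partial>lborel) = (\<integral>\<^sup>+t. \<integral>\<^sup>+s. ennreal (K t s) \<partial>lborel \<partial>lborel)"
    by (rule lborel_pair.Fubini') (simp add: case_prod_beta')
  also have "\<dots> + \<dots> \<le> ennreal (7 * sqrt P * P) + ennreal (7 * sqrt P * P)" using half by (intro add_mono)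
  also have "\<dots> = ennreal (14 * P * sqrt P)" using P by (simp add: ennreal_plus[symmetric] del: ennreal_plus)
  finally show ?thesis .
qed


section \<open>The endpoint estimate by duality\<close>

lemma borel_measurable_cnj_of_real [measurable]:
  "f \<in> borel_measurable M \<Longrightarrow> (\<lambda>x. cnj (f x)) \<in> borel_measurable M"
  "g \<in> borel_measurable M \<Longrightarrow> (\<lambda>x. complex_of_real (g x)) \<in> borel_measurable M"
  by (auto intro: borel_measurable_continuous_on[of cnj] borel_measurable_continuous_on[of complex_of_real]
      continuous_intros)

text \<open>The two sides are the pairings of an operator and of its transpose. As \<open>E\<close>
  is bounded by 1, the product of the moduli of \<open>w\<close> and \<open>g\<close> is an
  integrable majorant for Fubini.\<close>

lemma pair_integral_adjoint:
  fixes w :: "real \<Rightarrow> complex" and g :: "'a \<Rightarrow> complex" and E :: "real \<Rightarrow> 'a \<Rightarrow> complex"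
  assumes M: "sigma_finite_measure M"
    and w: "integrable lborel w" and g: "integrable M g"
    and E: "(\<lambda>p. E (fst p) (snd p)) \<in> borel_measurable (lborel \<Otimes>\<^sub>M M)" "\<And>t x. cmod (E t x) \<le> 1"
  shows "(LINT x|M. g x * (LINT t|lborel. w t * E t x)) = (LINT t|lborel. w t * (LINT x|M. E t x * g x))"
proof -
  interpret M: sigma_finite_measure M by fact
  interpret pair_sigma_finite lborel M ..
  note [measurable] = borel_measurable_integrable[OF w] borel_measurable_integrable[OF g]
  have Em [measurable]: "(\<lambda>(t, x). E t x) \<in> borel_measurable (lborel \<Otimes>\<^sub>M M)"
    using E(1) by (simp add: case_prod_beta')
  have Et: "E t \<in> borel_measurable M" for t using measurable_Pair2[OF Em, of t] by simp
  have "integrable (lborel \<Otimes>\<^sub>M M) (\<lambda>(t, x). w t * E t x * g x)"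
  proof (rule Fubini_integrable)
    show "(\<lambda>(t, x). w t * E t x * g x) \<in> borel_measurable (lborel \<Otimes>\<^sub>M M)" by measurable
    have b: "norm (w t * E t x * g x) \<le> norm (w t) * norm (g x)" for t x
      unfolding norm_mult using E(2)[of t x] by (intro mult_right_mono mult_left_le) auto
    have i: "integrable M (\<lambda>x. w t * E t x * g x)" for t
      using Et[of t] by (intro Bochner_Integration.integrable_bound[OF integrable_mult_right[OF integrable_norm[OF g], of "norm (w t)"]])
        (auto simp: b)
    show "AE t in lborel. integrable M (\<lambda>x. case (t, x) of (t, x) \<Rightarrow> w t * E t x * g x)" using i by simp
    show "integrable lborel (\<lambda>t. LINT x|M. norm (case (t, x) of (t, x) \<Rightarrow> w t * E t x * g x))"
    proof (rule Bochner_Integration.integrable_bound[OF integrable_mult_left[OF integrable_norm[OF w], of "LINT x|M. norm (g x)"]])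
      show "(\<lambda>t. LINT x|M. norm (case (t, x) of (t, x) \<Rightarrow> w t * E t x * g x)) \<in> borel_measurable lborel"
        by measurable
      have "(LINT x|M. norm (w t * E t x * g x)) \<le> norm (w t) * (LINT x|M. norm (g x))" for t
      proof -
        have "(LINT x|M. norm (w t * E t x * g x)) \<le> (LINT x|M. norm (w t) * norm (g x))"
          using b i g by (intro integral_mono) auto
        thus ?thesis by simp
      qed
      thus "AE t in lborel. norm (LINT x|M. norm (case (t, x) of (t, x) \<Rightarrow> w t * E t x * g x))
          \<le> norm (norm (w t) * (LINT x|M. norm (g x)))"
        by (simp add: integral_nonneg_AE)
    qed
  qed
  from Fubini_integral[OF this]
  have "(LINT x|M. LINT t|lborel. w t * E t x * g x) = (LINT t|lborel. LINT x|M. w t * E t x * g x)" .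
  moreover have "(LINT x|M. g x * (LINT t|lborel. w t * E t x)) = (LINT x|M. LINT t|lborel. w t * E t x * g x)"
    by (intro Bochner_Integration.integral_cong refl) (simp add: mult.commute)
  moreover have "(LINT x|M. w t * E t x * g x) = w t * (LINT x|M. E t x * g x)" for t
    by (simp add: mult.assoc)
  ultimately show ?thesis by simp
qed

lemma square_integrable_imp_integrable:
  fixes G :: "'a \<Rightarrow> complex"
  assumes "finite_measure M" "G \<in> borel_measurable M" "(\<integral>\<^sup>+x. ennreal ((cmod (G x))\<^sup>2) \<partial>M) < \<infinity>"
  shows "integrable M G" "integrable M (\<lambda>x. (cmod (G x))\<^sup>2)"
proof -
  interpret finite_measure M by fact
  show i: "integrable M (\<lambda>x. (cmod (G x))\<^sup>2)" using assms by (intro integrableI_bounded) auto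
  have "cmod z \<le> 1 + (cmod z)\<^sup>2" for z
    using power2_diff[of "cmod z" 1] zero_le_power2[of "cmod z - 1"] norm_ge_zero[of z]
    by (smt (verit) one_power2 mult_cancel_left2)
  thus "integrable M G" using assms
    by (intro Bochner_Integration.integrable_bound[OF Bochner_Integration.integrable_add[OF integrable_const[of 1] i]]) auto
qed

text \<open>The supremum over lattice points is linearized by a measurable choice \<open>\<psi>\<close> of the point. The linearized operator
  is the adjoint of \<open>w \<mapsto> V\<close> below, whose \<open>L\<^sup>2\<close> bound is the dispersive estimate combined with \<open>HLS_diagonal\<close>. The truncation
  to a bounded time interval makes the quantity to be estimated finite, so that it can be absorbed.\<close>

lemma strichartz_linearized:
  fixes M :: "'a measure" and Y :: "'a \<Rightarrow> real^2" and \<Phi> :: "'a \<Rightarrow> real" and \<psi> :: "real \<Rightarrow> real^2"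
  assumes M: "finite_measure M"
    and Y [measurable]: "Y \<in> borel_measurable M" and \<Phi> [measurable]: "\<Phi> \<in> borel_measurable M"
    and \<psi> [measurable]: "\<psi> \<in> borel_measurable borel"
    and disp: "\<And>v t. t \<noteq> 0 \<Longrightarrow> cmod (LINT \<xi>|M. cis (v \<bullet> Y \<xi> + t * \<Phi> \<xi>)) \<le> D / sqrt \<bar>t\<bar>" and D: "0 < D"
    and G [measurable]: "G \<in> borel_measurable M" and N: "0 < N" "(\<integral>\<^sup>+\<xi>. ennreal ((cmod (G \<xi>))\<^sup>2) \<partial>M) \<le> ennreal N"
  shows "(\<integral>\<^sup>+t. ennreal (indicator {-T..T} t * cmod (LINT \<xi>|M. cis (\<psi> t \<bullet> Y \<xi> + t * \<Phi> \<xi>) * G \<xi>) ^ 4) \<partial>lborel)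
    \<le> ennreal ((14 * D * N)\<^sup>2)"
proof -
  interpret M: finite_measure M by fact
  interpret pair_sigma_finite lborel M ..
  define E where "E = (\<lambda>t \<xi>. cis (\<psi> t \<bullet> Y \<xi> + t * \<Phi> \<xi>))"
  have Em [measurable]: "(\<lambda>p. E (fst p) (snd p)) \<in> borel_measurable (lborel \<Otimes>\<^sub>M M)"
    unfolding E_def by measurable
  have Et [measurable]: "E t \<in> borel_measurable M" for t unfolding E_def by measurable
  have E1: "cmod (E t x) = 1" for t x by (simp add: E_def)
  define u where "u = (\<lambda>t. LINT \<xi>|M. E t \<xi> * G \<xi>)"
  have um [measurable]: "u \<in> borel_measurable borel"
  proof -
    have "(\<lambda>p. E (fst p) (snd p) * G (snd p)) \<in> borel_measurable (lborel \<Otimes>\<^sub>M M)" by measurable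
    hence "(\<lambda>t. LINT \<xi>|M. E t \<xi> * G \<xi>) \<in> borel_measurable lborel"
      by (intro M.borel_measurable_lebesgue_integral) (simp add: case_prod_beta')
    thus ?thesis by (simp add: u_def)
  qed
  have G2: "(\<integral>\<^sup>+\<xi>. ennreal ((cmod (G \<xi>))\<^sup>2) \<partial>M) < \<infinity>" using N(2) by (auto simp: less_top[symmetric] top_unique)
  note Gi = square_integrable_imp_integrable[OF M G G2]
  define B where "B = (LINT \<xi>|M. cmod (G \<xi>))"
  have uB: "cmod (u t) \<le> B" for t
    unfolding u_def B_def by (rule order_trans[OF integral_norm_bound]) (simp add: norm_mult E1)
  define m where "m = (\<lambda>t. indicator {-T..T} t * cmod (u t))"
  have mm [measurable]: "m \<in> borel_measurable borel" unfolding m_def by measurable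
  have m0: "0 \<le> m t" for t by (simp add: m_def)
  \<comment> \<open>The function dual to \<open>u\<close> in L^4: its modulus is \<open>m^3\<close>,
    which suits \<open>HLS_diagonal\<close>, and its product with \<open>u\<close> is
    \<open>m^4\<close>, so that pairing it with \<open>u\<close> returns the quantity
    \<open>W\<close> to be bounded.\<close>
  define w where "w = (\<lambda>t. indicator {-T..T} t *\<^sub>R (cnj (u t) * of_real ((cmod (u t))\<^sup>2)))"
  have wm [measurable]: "w \<in> borel_measurable borel" unfolding w_def by measurable
  have cw: "cmod (w t) = m t ^ 3" for t
    by (simp add: w_def m_def indicator_def norm_mult norm_power power2_eq_square power3_eq_cube)
  have wu: "w t * u t = of_real (m t ^ 4)" for t
  proof -
    have "cnj (u t) * of_real ((cmod (u t))\<^sup>2) * u t = (u t * cnj (u t)) * of_real ((cmod (u t))\<^sup>2)" by simp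
    also have "\<dots> = of_real (cmod (u t) ^ 4)"
      unfolding complex_norm_square[symmetric] by (simp flip: of_real_power of_real_mult add: power_mult[symmetric])
    finally show ?thesis by (simp add: w_def m_def indicator_def)
  qed
  have bdd: "integrable lborel f" if "f \<in> borel_measurable borel" "\<And>t. norm (f t) \<le> indicator {-T..T} t * K"
    for f :: "real \<Rightarrow> 'z::{banach,second_countable_topology}" and K :: real
  proof (rule Bochner_Integration.integrable_bound)
    show "integrable lborel (\<lambda>t. indicator {-T..T} t * K)" by (intro integrable_mult_left) (simp add: integrable_indicator_iff emeasure_lborel_Icc_eq)
    show "AE x in lborel. norm (f x) \<le> norm (indicat_real {-T..T} x * K)"
      unfolding real_norm_def by (intro AE_I2 order_trans[OF that(2) abs_ge_self])
    show "f \<in> borel_measurable lborel" using that(1) by simp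
  qed
  have m4: "integrable lborel (\<lambda>t. m t ^ 4)"
    by (rule bdd[of _ "B^4"]) (auto simp: m_def indicator_def uB intro!: power_mono)
  have wi: "integrable lborel w"
    by (rule bdd[of _ "B^3"]) (use uB in \<open>auto simp: cw simp: m_def indicator_def intro!: power_mono\<close>)
  define W where "W = (LINT t|lborel. m t ^ 4)"
  have W: "(\<integral>\<^sup>+t. ennreal (m t ^ 4) \<partial>lborel) = ennreal W"
    unfolding W_def using m0 by (intro nn_integral_eq_integral m4) auto
  have W0: "0 \<le> W" unfolding W_def using m0 by (intro integral_nonneg_AE) auto
  have "W \<le> (14 * D * N)\<^sup>2"
  proof (cases "W = 0")
    case False
    hence Wp: "0 < W" using W0 by simp
    define V where "V = (\<lambda>\<xi>. LINT t|lborel. w t * E t \<xi>)"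
    have Vm [measurable]: "V \<in> borel_measurable M"
    proof -
      have "(\<lambda>p. w (snd p) * E (snd p) (fst p)) \<in> borel_measurable (M \<Otimes>\<^sub>M lborel)"
        using measurable_compose[OF measurable_pair_swap' Em] by (simp add: case_prod_beta') measurable
      thus ?thesis unfolding V_def
        by (intro lborel.borel_measurable_lebesgue_integral) (simp add: case_prod_beta')
    qed
    define K where "K = (LINT t|lborel. cmod (w t))"
    have VK: "cmod (V \<xi>) \<le> K" for \<xi>
      unfolding V_def K_def by (rule order_trans[OF integral_norm_bound]) (simp add: norm_mult E1)
    have Vi: "integrable M (\<lambda>\<xi>. cnj (V \<xi>))" using VK
      by (intro M.integrable_const_bound[where B = K]) auto
    have V2: "integrable M (\<lambda>\<xi>. (cmod (V \<xi>))\<^sup>2)" using VK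
      by (intro M.integrable_const_bound[where B = "K\<^sup>2"]) (auto intro!: power_mono)
    define R where "R = (LINT \<xi>|M. (cmod (V \<xi>))\<^sup>2)"
    have R0: "0 \<le> R" unfolding R_def by (intro integral_nonneg_AE) auto
    define y where "y = (\<lambda>t. LINT \<xi>|M. E t \<xi> * cnj (V \<xi>))"
    have adj: "(LINT \<xi>|M. g \<xi> * V \<xi>) = (LINT t|lborel. w t * (LINT \<xi>|M. E t \<xi> * g \<xi>))" if "integrable M g" for g
      unfolding V_def by (rule pair_integral_adjoint[OF M.sigma_finite_measure_axioms wi that Em]) (simp add: E1)
    \<comment> \<open>The product merges into one exponential with the vector
      \<open>\<psi> s - \<psi> t\<close> and the time \<open>s - t\<close>. Since the dispersive
      hypothesis is uniform in the vector, the choice of the lattice points leaves no trace in the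
      kernel.\<close>
    have ker: "cmod (LINT \<xi>|M. E s \<xi> * cnj (E t \<xi>)) \<le> D / sqrt \<bar>t - s\<bar>" if "s \<noteq> t" for s t
    proof -
      have "E s \<xi> * cnj (E t \<xi>) = cis ((\<psi> s - \<psi> t) \<bullet> Y \<xi> + (s - t) * \<Phi> \<xi>)" for \<xi>
        by (simp add: E_def cis_cnj cis_mult inner_diff_left algebra_simps)
      thus ?thesis using disp[of "s - t" "\<psi> s - \<psi> t"] that by (simp add: abs_minus_commute)
    qed
    have y: "ennreal (cmod (y t)) \<le> (\<integral>\<^sup>+s. ennreal (m s ^ 3 * (D / sqrt \<bar>t - s\<bar>)) \<partial>lborel)" for t
    proof -
      have Ei: "integrable M (\<lambda>\<xi>. cnj (E t \<xi>))"
        by (intro M.integrable_const_bound[where B = 1]) (auto simp: E1)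
      have "cnj (y t) = (LINT \<xi>|M. cnj (E t \<xi>) * V \<xi>)"
        unfolding y_def by (subst Bochner_Integration.integral_cnj[symmetric]) simp
      also have "\<dots> = (LINT s|lborel. w s * (LINT \<xi>|M. E s \<xi> * cnj (E t \<xi>)))" by (rule adj[OF Ei])
      finally have eq: "cmod (y t) = cmod (LINT s|lborel. w s * (LINT \<xi>|M. E s \<xi> * cnj (E t \<xi>)))"
        by (metis complex_mod_cnj)
      have "ennreal (cmod (y t)) \<le> (\<integral>\<^sup>+s. ennreal (cmod (w s * (LINT \<xi>|M. E s \<xi> * cnj (E t \<xi>)))) \<partial>lborel)"
      \<comment> \<open>In the nonintegrable case the Bochner integral is 0 by convention and the
        bound is trivial, so integrability need not be decided.\<close>
      proof (cases "integrable lborel (\<lambda>s. w s * (LINT \<xi>|M. E s \<xi> * cnj (E t \<xi>)))")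
        case True thus ?thesis unfolding eq by (rule integral_norm_bound_ennreal)
      qed (simp add: eq not_integrable_integral_eq)
      also have "\<dots> \<le> (\<integral>\<^sup>+s. ennreal (m s ^ 3 * (D / sqrt \<bar>t - s\<bar>)) \<partial>lborel)"
      proof (rule nn_integral_mono_AE)
        show "AE s in lborel. ennreal (cmod (w s * (LINT \<xi>|M. E s \<xi> * cnj (E t \<xi>)))) \<le> ennreal (m s ^ 3 * (D / sqrt \<bar>t - s\<bar>))"
          using AE_lborel_singleton[of t]
        proof eventually_elim
          fix s assume "s \<noteq> t"
          thus "ennreal (cmod (w s * (LINT \<xi>|M. E s \<xi> * cnj (E t \<xi>)))) \<le> ennreal (m s ^ 3 * (D / sqrt \<bar>t - s\<bar>))"
            unfolding norm_mult cw using m0[of s] by (intro ennreal_leI mult_left_mono ker) auto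
        qed
      qed
      finally show ?thesis .
    qed
    have "complex_of_real R = (LINT \<xi>|M. cnj (V \<xi>) * V \<xi>)"
    proof -
      have "cnj (V \<xi>) * V \<xi> = of_real ((cmod (V \<xi>))\<^sup>2)" for \<xi>
        unfolding complex_norm_square by (rule mult.commute)
      thus ?thesis unfolding R_def by (simp only: integral_complex_of_real)
    qed
    also have "\<dots> = (LINT t|lborel. w t * y t)" unfolding y_def by (rule adj[OF Vi])
    finally have Req: "R = cmod (LINT t|lborel. w t * y t)" using R0 by (metis abs_of_nonneg norm_of_real)
    have "ennreal R \<le> (\<integral>\<^sup>+t. ennreal (cmod (w t * y t)) \<partial>lborel)"
    proof (cases "integrable lborel (\<lambda>t. w t * y t)")
      case True thus ?thesis unfolding Req by (rule integral_norm_bound_ennreal)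
    qed (simp add: Req not_integrable_integral_eq)
    also have "\<dots> \<le> (\<integral>\<^sup>+t. ennreal D * (\<integral>\<^sup>+s. ennreal (m t ^ 3 * m s ^ 3 / sqrt \<bar>t - s\<bar>) \<partial>lborel) \<partial>lborel)"
    proof (rule nn_integral_mono)
      fix t
      have "ennreal (cmod (w t * y t)) \<le> ennreal (m t ^ 3) * (\<integral>\<^sup>+s. ennreal (m s ^ 3 * (D / sqrt \<bar>t - s\<bar>)) \<partial>lborel)"
        unfolding norm_mult cw using y[of t] m0[of t] by (simp add: ennreal_mult mult_left_mono)
      also have "\<dots> = (\<integral>\<^sup>+s. ennreal (m t ^ 3) * ennreal (m s ^ 3 * (D / sqrt \<bar>t - s\<bar>)) \<partial>lborel)"
        by (rule nn_integral_cmult[symmetric]) measurable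
      also have "\<dots> = (\<integral>\<^sup>+s. ennreal D * ennreal (m t ^ 3 * m s ^ 3 / sqrt \<bar>t - s\<bar>) \<partial>lborel)"
        using m0 D by (intro nn_integral_cong) (simp add: ennreal_mult[symmetric] mult_ac)
      also have "\<dots> = ennreal D * (\<integral>\<^sup>+s. ennreal (m t ^ 3 * m s ^ 3 / sqrt \<bar>t - s\<bar>) \<partial>lborel)"
        by (rule nn_integral_cmult) measurable
      finally show "ennreal (cmod (w t * y t)) \<le> ennreal D * (\<integral>\<^sup>+s. ennreal (m t ^ 3 * m s ^ 3 / sqrt \<bar>t - s\<bar>) \<partial>lborel)" .
    qed
    also have "\<dots> = ennreal D * (\<integral>\<^sup>+t. \<integral>\<^sup>+s. ennreal (m t ^ 3 * m s ^ 3 / sqrt \<bar>t - s\<bar>) \<partial>lborel \<partial>lborel)"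
      by (rule nn_integral_cmult) measurable
    also have "\<dots> \<le> ennreal D * ennreal (14 * W * sqrt W)"
      by (intro mult_left_mono HLS_diagonal mm m0 Wp) (simp_all add: W)
    also have "\<dots> = ennreal (D * (14 * W * sqrt W))" using D Wp by (simp add: ennreal_mult)
    finally have R: "R \<le> D * (14 * W * sqrt W)" using D Wp by (subst (asm) ennreal_le_iff) auto
    have Nint: "(LINT \<xi>|M. (cmod (G \<xi>))\<^sup>2) \<le> N"
    proof -
      have "ennreal (LINT \<xi>|M. (cmod (G \<xi>))\<^sup>2) = (\<integral>\<^sup>+\<xi>. ennreal ((cmod (G \<xi>))\<^sup>2) \<partial>M)"
        by (intro nn_integral_eq_integral[symmetric] Gi) auto
      thus ?thesis using N by (metis ennreal_le_iff less_imp_le)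
    qed
    have "complex_of_real W = (LINT t|lborel. w t * u t)"
      unfolding W_def wu by (rule integral_complex_of_real[symmetric])
    also have "\<dots> = (LINT \<xi>|M. G \<xi> * V \<xi>)" unfolding u_def by (rule adj[OF Gi(1), symmetric])
    finally have "W = cmod (LINT \<xi>|M. G \<xi> * V \<xi>)" using W0 by (metis abs_of_nonneg norm_of_real)
    also have "\<dots> \<le> (LINT \<xi>|M. cmod (G \<xi> * V \<xi>))" by (rule integral_norm_bound)
    \<comment> \<open>Cauchy-Schwarz in the form of a weighted arithmetic-geometric mean. The
      weights let the first term contribute at most \<open>W / 2\<close>, which is absorbed on the
      left; the second term then is a multiple of \<open>sqrt W\<close>, and dividing by
      \<open>sqrt W\<close> finishes.\<close>
    also have "\<dots> \<le> (LINT \<xi>|M. W / (2 * N) * (cmod (G \<xi>))\<^sup>2 + N / (2 * W) * (cmod (V \<xi>))\<^sup>2)"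
    proof (rule integral_mono_AE')
      show "integrable M (\<lambda>\<xi>. W / (2 * N) * (cmod (G \<xi>))\<^sup>2 + N / (2 * W) * (cmod (V \<xi>))\<^sup>2)"
        using Gi V2 by auto
      have "g * v \<le> W / (2 * N) * g\<^sup>2 + N / (2 * W) * v\<^sup>2" for g v :: real
      proof -
        have "0 \<le> (W * g - N * v)\<^sup>2 / (2 * N * W)" using Wp N by simp
        also have "\<dots> = W / (2 * N) * g\<^sup>2 + N / (2 * W) * v\<^sup>2 - g * v"
          using Wp N by (simp add: field_simps power2_eq_square)
        finally show ?thesis by simp
      qed
      thus "AE \<xi> in M. cmod (G \<xi> * V \<xi>) \<le> W / (2 * N) * (cmod (G \<xi>))\<^sup>2 + N / (2 * W) * (cmod (V \<xi>))\<^sup>2"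
        by (simp add: norm_mult)
    qed (use Wp N in \<open>auto intro!: add_nonneg_nonneg divide_nonneg_nonneg mult_nonneg_nonneg\<close>)
    also have "\<dots> = W / (2 * N) * (LINT \<xi>|M. (cmod (G \<xi>))\<^sup>2) + N / (2 * W) * R"
      unfolding R_def using Gi V2 by simp
    also have "\<dots> \<le> W / (2 * N) * N + N / (2 * W) * (D * (14 * W * sqrt W))"
      using Wp N Nint R by (intro add_mono mult_left_mono) auto
    also have "\<dots> = W / 2 + 7 * D * N * sqrt W" using Wp N by simp
    finally have "W / 2 \<le> 7 * D * N * sqrt W" by simp
    hence "sqrt W * sqrt W \<le> 14 * D * N * sqrt W" using Wp by simp
    hence "sqrt W \<le> 14 * D * N" by (rule mult_right_le_imp_le) (use Wp in simp)
    hence "(sqrt W)\<^sup>2 \<le> (14 * D * N)\<^sup>2" using Wp by (intro power_mono) auto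
    thus ?thesis using Wp by simp
  qed simp
  moreover have "indicator {-T..T} t * cmod (u t) ^ 4 = m t ^ 4" for t
    by (simp add: m_def indicator_def)
  ultimately show ?thesis using W by (simp add: u_def E_def ennreal_leI)
qed

section \<open>Square integrable functions on the torus and their Fourier coefficients\<close>

lemma finite_measure_torus: "finite_measure (lebesgue_on (torus h))"
  unfolding torus_def by (rule finite_measure_lebesgue_on) simp

lemma continuous_torus_measurable:
  fixes f :: "real^2 \<Rightarrow> 'z::{second_countable_topology, real_normed_vector}"
  assumes "continuous_on UNIV f"
  shows "f \<in> borel_measurable (lebesgue_on (torus h))"
proof -
  have "f \<in> borel_measurable lebesgue"
    by (rule measurable_completion) (use borel_measurable_continuous_onI[OF assms] in simp)
  thus ?thesis by (rule measurable_restrict_space1)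
qed

lemma cis_inner_measurable [measurable]: "(\<lambda>\<xi>. cis (x \<bullet> \<xi>)) \<in> borel_measurable (lebesgue_on (torus h))"
  by (intro continuous_torus_measurable continuous_intros)

lemma lattice_diff: "x \<in> lattice h \<Longrightarrow> y \<in> lattice h \<Longrightarrow> x - y \<in> lattice h"
  unfolding lattice_def by clarsimp
    (metis (no_types, lifting) of_int_diff scaleR_diff_right vec_eq_iff vec_lambda_beta vector_minus_component)

lemma countable_lattice: "countable (lattice h)"
proof -
  have "countable (UNIV :: (int^2) set)"
    by (rule countable_subset[OF _ countable_image[of "UNIV :: (int \<times> int) set" "\<lambda>p. \<chi> i. if i = 1 then fst p else snd p"]])
      (auto simp: image_iff vec_eq_iff forall_2 intro!: exI[of _ "_ $ 1"] exI[of _ "_ $ 2"])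
  hence "countable (range (\<lambda>n :: int^2. h *\<^sub>R (\<chi> j. real_of_int (n $ j))))" by simp
  thus ?thesis by (rule back_subst[of countable]) (auto simp: lattice_def)
qed

lemma integral_cis_int:
  "(LINT s:{-pi..pi}|lborel. cis (of_int n * s)) = (if n = 0 then of_real (2 * pi) else 0)"
proof (cases "n = 0")
  case True
  thus ?thesis by (simp add: set_lebesgue_integral_def scaleR_conv_of_real)
next
  case False
  have c: "continuous_on UNIV (\<lambda>s. cis (of_int n * s))" by (intro continuous_intros)
  have "(LINT s:{-pi..pi}|lborel. cis (of_int n * s)) = integral {-pi..pi} (\<lambda>s. cis (of_int n * s))"
    by (rule set_borel_integral_eq_integral)
      (simp add: set_integrable_def borel_integrable_compact continuous_on_subset[OF c])
  also have "\<dots> = cis (of_int n * pi) / (\<i> * of_int n) - cis (of_int n * (-pi)) / (\<i> * of_int n)"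
  proof (intro integral_unique fundamental_theorem_of_calculus)
    fix s :: real
    have "((\<lambda>s. of_int n * s) has_real_derivative of_int n) (at s within {-pi..pi})"
      by (auto intro!: derivative_eq_intros)
    from has_vector_derivative_divide[OF cis_comp_has_vector_derivative[OF this], of "\<i> * of_int n"]
    show "((\<lambda>s. cis (of_int n * s) / (\<i> * of_int n)) has_vector_derivative cis (of_int n * s)) (at s within {-pi..pi})"
      by (rule has_vector_derivative_eq_rhs) (use False in simp)
  qed simp
  also have "cis (of_int n * (-pi)) = cis (of_int n * pi)"
    by (auto simp: complex_eq_iff mult.commute sin_int_times_real)
  finally show ?thesis using False by simp
qed

lemma fourier_orthogonality:
  assumes h: "h > 0" and xy: "x \<in> lattice h" "y \<in> lattice h"
  shows "(LINT \<xi>|lebesgue_on (torus h). cis (x \<bullet> \<xi>) * cis (- (y \<bullet> \<xi>))) = (if x = y then of_real ((2 * pi / h)\<^sup>2) else 0)"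
proof -
  obtain n :: "int^2" where n: "x - y = h *\<^sub>R (\<chi> j. of_int (n $ j))"
    using lattice_diff[OF xy] by (auto simp: lattice_def)
  have n0: "x = y \<longleftrightarrow> n $ 1 = 0 \<and> n $ 2 = 0"
  proof -
    have "x = y \<longleftrightarrow> h *\<^sub>R (\<chi> j. real_of_int (n $ j)) = 0" using n by (metis eq_iff_diff_eq_0)
    thus ?thesis using h by (simp add: vec_eq_iff forall_2)
  qed
  have c: "continuous_on UNIV (\<lambda>\<xi>. cis ((x - y) \<bullet> \<xi>))" by (intro continuous_intros)
  define c1 where "c1 = (\<lambda>s. indicat_real {-pi..pi} s *\<^sub>R cis (of_int (n $ 1) * s))"
  define c2 where "c2 = (\<lambda>s. indicat_real {-pi..pi} s *\<^sub>R cis (of_int (n $ 2) * s))"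
  have "cis (x \<bullet> \<xi>) * cis (- (y \<bullet> \<xi>)) = cis ((x - y) \<bullet> \<xi>)" for \<xi>
    by (simp add: cis_mult inner_diff_left)
  hence "(LINT \<xi>|lebesgue_on (torus h). cis (x \<bullet> \<xi>) * cis (- (y \<bullet> \<xi>))) = of_real (1 / h\<^sup>2) *
    (LINT p:{-pi..pi}\<times>{-pi..pi}|lborel. cis ((x - y) \<bullet> (\<chi> i. (if i = 1 then fst p else snd p) / h)))"
    using torus_integral_eq[OF h c] by simp
  also have "(LINT p:{-pi..pi}\<times>{-pi..pi}|lborel. cis ((x - y) \<bullet> (\<chi> i. (if i = 1 then fst p else snd p) / h)))
      = (LINT p|lborel. c1 (fst p) * c2 (snd p))"
    unfolding set_lebesgue_integral_def n inner_real2 c1_def c2_def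
    by (intro Bochner_Integration.integral_cong refl) (use h in \<open>auto simp: indicator_def cis_mult\<close>)
  also have "\<dots> = (LINT a|lborel. LINT b|lborel. c1 a * c2 b)"
  proof -
    have th: "continuous_on UNIV (\<lambda>p. of_int (n $ 1) * fst p + of_int (n $ 2) * snd p :: real)" by (intro continuous_intros)
    have Q: "{-pi..pi} \<times> {-pi..pi} \<in> sets borel" "bounded ({-pi..pi} \<times> {-pi..pi})"
      by (auto intro: borel_Times bounded_Times)
    have "(\<lambda>p. c1 (fst p) * c2 (snd p)) = (\<lambda>p. indicat_real ({-pi..pi} \<times> {-pi..pi}) p *\<^sub>R
        cis (of_int (n $ 1) * fst p + of_int (n $ 2) * snd p))"
      by (auto simp: fun_eq_iff c1_def c2_def indicator_def cis_mult)
    hence "integrable lborel (\<lambda>p. c1 (fst p) * c2 (snd p))" using integrable_cis_region[OF th Q] by simp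
    thus ?thesis using lborel_pair.integral_fst[of "\<lambda>a b. c1 a * c2 b"] by (simp add: lborel_prod case_prod_beta')
  qed
  also have "\<dots> = (LINT s:{-pi..pi}|lborel. cis (of_int (n $ 1) * s)) * (LINT s:{-pi..pi}|lborel. cis (of_int (n $ 2) * s))"
  proof -
    have "(LINT a|lborel. LINT b|lborel. c1 a * c2 b) = (LINT a|lborel. c1 a) * (LINT b|lborel. c2 b)" by simp
    thus ?thesis unfolding set_lebesgue_integral_def c1_def c2_def .
  qed
  finally show ?thesis unfolding integral_cis_int n0 using h by (auto simp: power2_eq_square)
qed

section \<open>Squared norms on the torus, trigonometric polynomials and Bessel's inequality\<close>

definition tnorm2 :: "real \<Rightarrow> (real^2 \<Rightarrow> complex) \<Rightarrow> ennreal" where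
  "tnorm2 h g = (\<integral>\<^sup>+\<xi>. ennreal ((cmod (g \<xi>))\<^sup>2) \<partial>lebesgue_on (torus h))"

definition trig_poly :: "real \<Rightarrow> (real^2) set \<Rightarrow> (real^2 \<Rightarrow> complex) \<Rightarrow> real^2 \<Rightarrow> complex" where
  "trig_poly h A f \<xi> = of_real (h\<^sup>2) * (\<Sum>x\<in>A. f x * cis (- (x \<bullet> \<xi>)))"

text \<open>The inverse Fourier integral. The factor is free of \<open>h\<close> because the
  \<open>h^2\<close> in \<open>trig_poly\<close> cancels the \<open>h\<close> in the torus area
  \<open>(2 * pi / h)^2\<close>.\<close>

definition fcoef :: "real \<Rightarrow> (real^2 \<Rightarrow> complex) \<Rightarrow> real^2 \<Rightarrow> complex" where
  "fcoef h G x = of_real (1 / (2 * pi)\<^sup>2) * (LINT \<xi>|lebesgue_on (torus h). cis (x \<bullet> \<xi>) * G \<xi>)"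

lemma fourier_finite:
  assumes "finite A" "A \<subseteq> lattice h"
  shows "fourier h (\<lambda>x. if x \<in> A then f x else 0) = trig_poly h A f"
proof
  fix \<xi>
  have "(\<Sum>\<^sub>\<infinity>x\<in>lattice h. (if x \<in> A then f x else 0) * cis (- (x \<bullet> \<xi>))) = (\<Sum>\<^sub>\<infinity>x\<in>A. f x * cis (- (x \<bullet> \<xi>)))"
    using assms by (intro infsum_cong_neutral) auto
  thus "fourier h (\<lambda>x. if x \<in> A then f x else 0) \<xi> = trig_poly h A f \<xi>"
    using assms by (simp add: fourier_def trig_poly_def)
qed

lemma continuous_trig_poly: "continuous_on UNIV (trig_poly h A f)"
  unfolding trig_poly_def[abs_def] by (intro continuous_intros)

lemma trig_poly_measurable [measurable]: "trig_poly h A f \<in> borel_measurable (lebesgue_on (torus h))"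
  by (rule continuous_torus_measurable[OF continuous_trig_poly])

lemma trig_poly_bound: "cmod (trig_poly h A f \<xi>) \<le> h\<^sup>2 * (\<Sum>x\<in>A. cmod (f x))"
  unfolding trig_poly_def norm_mult by (intro mult_mono sum_norm_le) (auto simp: norm_mult norm_power)

lemma tnorm2_bounded_finite:
  assumes "\<And>\<xi>. cmod (g \<xi>) \<le> B"
  shows "tnorm2 h g < \<infinity>"
proof -
  interpret finite_measure "lebesgue_on (torus h)" by (rule finite_measure_torus)
  have "tnorm2 h g \<le> (\<integral>\<^sup>+\<xi>. ennreal (B\<^sup>2) \<partial>lebesgue_on (torus h))"
    unfolding tnorm2_def using assms by (intro nn_integral_mono ennreal_leI power_mono) auto
  also have "\<dots> < \<infinity>"
    unfolding nn_integral_const emeasure_eq_measure by (simp add: ennreal_mult_less_top)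
  finally show ?thesis .
qed

lemma tnorm2_add_le:
  assumes [measurable]: "f \<in> borel_measurable (lebesgue_on (torus h))" "g \<in> borel_measurable (lebesgue_on (torus h))"
  shows "tnorm2 h (\<lambda>\<xi>. f \<xi> + g \<xi>) \<le> 2 * (tnorm2 h f + tnorm2 h g)"
proof -
  have "(cmod (a + b))\<^sup>2 \<le> 2 * ((cmod a)\<^sup>2 + (cmod b)\<^sup>2)" for a b :: complex
  proof -
    have "(cmod (a + b))\<^sup>2 \<le> (cmod a + cmod b)\<^sup>2" by (intro power_mono norm_triangle_ineq) auto
    thus ?thesis using sum_squares_bound[of "cmod a" "cmod b"] by (simp add: power2_sum)
  qed
  hence "tnorm2 h (\<lambda>\<xi>. f \<xi> + g \<xi>) \<le> (\<integral>\<^sup>+\<xi>. 2 * (ennreal ((cmod (f \<xi>))\<^sup>2) + ennreal ((cmod (g \<xi>))\<^sup>2)) \<partial>lebesgue_on (torus h))"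
    unfolding tnorm2_def
    by (intro nn_integral_mono) (simp add: ennreal_plus[symmetric] ennreal_mult'[symmetric] ennreal_leI
        del: ennreal_plus flip: ennreal_numeral)
  also have "\<dots> = 2 * (tnorm2 h f + tnorm2 h g)"
    unfolding tnorm2_def by (subst nn_integral_cmult) (auto simp: nn_integral_add)
  finally show ?thesis .
qed

lemma tnorm2_diff_le:
  assumes [measurable]: "f \<in> borel_measurable (lebesgue_on (torus h))" "g \<in> borel_measurable (lebesgue_on (torus h))"
    "k \<in> borel_measurable (lebesgue_on (torus h))"
  shows "tnorm2 h (\<lambda>\<xi>. f \<xi> - g \<xi>) \<le> 2 * (tnorm2 h (\<lambda>\<xi>. f \<xi> - k \<xi>) + tnorm2 h (\<lambda>\<xi>. k \<xi> - g \<xi>))"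
  using tnorm2_add_le[of "\<lambda>\<xi>. f \<xi> - k \<xi>" h "\<lambda>\<xi>. k \<xi> - g \<xi>"] by simp

lemma tnorm2_minus_commute: "tnorm2 h (\<lambda>\<xi>. f \<xi> - g \<xi>) = tnorm2 h (\<lambda>\<xi>. g \<xi> - f \<xi>)"
  by (simp add: tnorm2_def norm_minus_commute)

lemma tnorm2_mult_le:
  assumes "\<And>\<xi>. cmod (k \<xi>) \<le> B" and [measurable]: "g \<in> borel_measurable (lebesgue_on (torus h))"
  shows "tnorm2 h (\<lambda>\<xi>. k \<xi> * g \<xi>) \<le> ennreal (B\<^sup>2) * tnorm2 h g"
proof -
  have "tnorm2 h (\<lambda>\<xi>. k \<xi> * g \<xi>) \<le> (\<integral>\<^sup>+\<xi>. ennreal (B\<^sup>2) * ennreal ((cmod (g \<xi>))\<^sup>2) \<partial>lebesgue_on (torus h))"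
    unfolding tnorm2_def norm_mult power_mult_distrib using assms
    by (intro nn_integral_mono) (simp add: ennreal_mult'[symmetric] ennreal_leI mult_right_mono power_mono)
  also have "\<dots> = ennreal (B\<^sup>2) * tnorm2 h g" unfolding tnorm2_def by (rule nn_integral_cmult) measurable
  finally show ?thesis .
qed

lemma tnorm2_integrable:
  assumes "G \<in> borel_measurable (lebesgue_on (torus h))" "tnorm2 h G < \<infinity>"
  shows "integrable (lebesgue_on (torus h)) G" "integrable (lebesgue_on (torus h)) (\<lambda>\<xi>. (cmod (G \<xi>))\<^sup>2)"
    "tnorm2 h G = ennreal (LINT \<xi>|lebesgue_on (torus h). (cmod (G \<xi>))\<^sup>2)"
proof -
  note i = square_integrable_imp_integrable[OF finite_measure_torus assms(1) assms(2)[unfolded tnorm2_def]]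
  show "integrable (lebesgue_on (torus h)) G" "integrable (lebesgue_on (torus h)) (\<lambda>\<xi>. (cmod (G \<xi>))\<^sup>2)" by (fact i)+
  show "tnorm2 h G = ennreal (LINT \<xi>|lebesgue_on (torus h). (cmod (G \<xi>))\<^sup>2)"
    unfolding tnorm2_def by (intro nn_integral_eq_integral i) auto
qed

lemma integrable_cis_mult:
  assumes "integrable (lebesgue_on (torus h)) G"
  shows "integrable (lebesgue_on (torus h)) (\<lambda>\<xi>. cis (x \<bullet> \<xi>) * G \<xi>)"
  by (rule Bochner_Integration.integrable_bound[OF assms])
    (use borel_measurable_integrable[OF assms] in \<open>auto simp: norm_mult\<close>)

lemma fcoef_trig_poly:
  assumes h: "h > 0" and A: "finite A" "A \<subseteq> lattice h" and x: "x \<in> lattice h"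
  shows "fcoef h (trig_poly h A f) x = (if x \<in> A then f x else 0)"
proof -
  let ?M = "lebesgue_on (torus h)"
  interpret finite_measure ?M by (rule finite_measure_torus)
  have i: "integrable ?M (\<lambda>\<xi>. f y * (cis (x \<bullet> \<xi>) * cis (- (y \<bullet> \<xi>))))" for y
  proof (intro integrable_mult_right integrable_const_bound[where B = 1])
    show "(\<lambda>\<xi>. cis (x \<bullet> \<xi>) * cis (- (y \<bullet> \<xi>))) \<in> borel_measurable ?M"
      by (intro continuous_torus_measurable continuous_intros)
  qed (auto simp: norm_mult)
  have "(LINT \<xi>|?M. cis (x \<bullet> \<xi>) * trig_poly h A f \<xi>) = (LINT \<xi>|?M. of_real (h\<^sup>2) * (\<Sum>y\<in>A. f y * (cis (x \<bullet> \<xi>) * cis (- (y \<bullet> \<xi>)))))"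
    by (simp add: trig_poly_def sum_distrib_left mult_ac)
  also have "\<dots> = of_real (h\<^sup>2) * (\<Sum>y\<in>A. f y * (LINT \<xi>|?M. cis (x \<bullet> \<xi>) * cis (- (y \<bullet> \<xi>))))"
    using i by (simp add: Bochner_Integration.integral_sum)
  also have "(\<Sum>y\<in>A. f y * (LINT \<xi>|?M. cis (x \<bullet> \<xi>) * cis (- (y \<bullet> \<xi>)))) = (\<Sum>y\<in>A. if y = x then f x * of_real ((2 * pi / h)\<^sup>2) else 0)"
    using A x by (intro sum.cong refl) (auto simp: fourier_orthogonality[OF h x] subset_iff)
  also have "\<dots> = (if x \<in> A then f x * of_real ((2 * pi / h)\<^sup>2) else 0)" using A by (simp add: sum.delta)
  finally show ?thesis unfolding fcoef_def using h by (auto simp: power2_eq_square field_simps)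
qed

text \<open>Completing the square in the coefficients. The factor \<open>(2 * pi * h)^2\<close> is
  the torus area \<open>(2 * pi / h)^2\<close> times the \<open>h^4\<close> from the normalization
  of \<open>trig_poly\<close>. The choice f = \<open>fcoef\<close> yields Bessel's inequality;
  comparing general f with it yields that truncated Fourier series are best approximations.\<close>

lemma fourier_approx_identity:
  assumes h: "h > 0" and G: "G \<in> borel_measurable (lebesgue_on (torus h))" "tnorm2 h G < \<infinity>"
    and A: "finite A" "A \<subseteq> lattice h"
  shows "(LINT \<xi>|lebesgue_on (torus h). (cmod (G \<xi> - trig_poly h A f \<xi>))\<^sup>2) =
     (LINT \<xi>|lebesgue_on (torus h). (cmod (G \<xi>))\<^sup>2) - (2 * pi * h)\<^sup>2 * (\<Sum>x\<in>A. (cmod (fcoef h G x))\<^sup>2)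
      + (2 * pi * h)\<^sup>2 * (\<Sum>x\<in>A. (cmod (fcoef h G x - f x))\<^sup>2)"
proof -
  let ?M = "lebesgue_on (torus h)"
  define T where "T = trig_poly h A f"
  have T: "T \<in> borel_measurable ?M" "tnorm2 h T < \<infinity>"
    unfolding T_def using tnorm2_bounded_finite[OF trig_poly_bound] by auto
  note Gi = tnorm2_integrable[OF G] and Ti = tnorm2_integrable[OF T]
  have inner: "integrable ?M (\<lambda>\<xi>. H \<xi> * cnj (T \<xi>)) \<and>
      (LINT \<xi>|?M. H \<xi> * cnj (T \<xi>)) = of_real ((2 * pi * h)\<^sup>2) * (\<Sum>x\<in>A. cnj (f x) * fcoef h H x)"
    if H: "integrable ?M H" for H
  proof -
    have eq: "H \<xi> * cnj (T \<xi>) = of_real (h\<^sup>2) * (\<Sum>x\<in>A. cnj (f x) * (cis (x \<bullet> \<xi>) * H \<xi>))" for \<xi>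
      by (simp add: T_def trig_poly_def sum_distrib_left cis_cnj mult_ac)
    note i = integrable_cis_mult[OF H]
    have "(LINT \<xi>|?M. H \<xi> * cnj (T \<xi>)) = of_real (h\<^sup>2) * (\<Sum>x\<in>A. cnj (f x) * (LINT \<xi>|?M. cis (x \<bullet> \<xi>) * H \<xi>))"
      unfolding eq using i by (simp add: Bochner_Integration.integral_sum)
    also have "\<dots> = of_real ((2 * pi * h)\<^sup>2) * (\<Sum>x\<in>A. cnj (f x) * fcoef h H x)"
      unfolding fcoef_def sum_distrib_left by (intro sum.cong refl) (simp add: power_mult_distrib)
    finally show ?thesis unfolding eq using i by (simp add: Bochner_Integration.integrable_sum)
  qed
  have sq: "(cmod (a - b))\<^sup>2 = (cmod a)\<^sup>2 + Re (b * cnj b) - 2 * Re (a * cnj b)" for a b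
    unfolding cmod_power2 by (simp add: power2_eq_square algebra_simps)
  have TT: "(\<Sum>x\<in>A. cnj (f x) * fcoef h T x) = (\<Sum>x\<in>A. of_real ((cmod (f x))\<^sup>2))"
    using A by (intro sum.cong refl) (auto simp: T_def fcoef_trig_poly[OF h A] subset_iff complex_norm_square mult.commute simp del: of_real_power)
  have "(LINT \<xi>|?M. (cmod (G \<xi> - T \<xi>))\<^sup>2) = (LINT \<xi>|?M. (cmod (G \<xi>))\<^sup>2 + Re (T \<xi> * cnj (T \<xi>)) - 2 * Re (G \<xi> * cnj (T \<xi>)))"
    unfolding sq ..
  also have "\<dots> = (LINT \<xi>|?M. (cmod (G \<xi>))\<^sup>2) + Re (LINT \<xi>|?M. T \<xi> * cnj (T \<xi>)) - 2 * Re (LINT \<xi>|?M. G \<xi> * cnj (T \<xi>))"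
  proof -
    have "(LINT \<xi>|?M. p \<xi> + Re (a \<xi>) - 2 * Re (b \<xi>)) = (LINT \<xi>|?M. p \<xi>) + Re (LINT \<xi>|?M. a \<xi>) - 2 * Re (LINT \<xi>|?M. b \<xi>)"
      if "integrable ?M p" "integrable ?M a" "integrable ?M b" for p a b
      using that by simp
    from this[OF Gi(2) inner[OF Ti(1), THEN conjunct1] inner[OF Gi(1), THEN conjunct1]] show ?thesis .
  qed
  also have "\<dots> = (LINT \<xi>|?M. (cmod (G \<xi>))\<^sup>2) + (2 * pi * h)\<^sup>2 * (\<Sum>x\<in>A. (cmod (f x))\<^sup>2)
      - 2 * ((2 * pi * h)\<^sup>2 * (\<Sum>x\<in>A. Re (cnj (f x) * fcoef h G x)))"
  proof -
    have re: "Re (of_real c * z) = c * Re z" for c z by simp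
    show ?thesis
      unfolding inner[OF Ti(1), THEN conjunct2] inner[OF Gi(1), THEN conjunct2] TT re Re_sum Re_complex_of_real ..
  qed
  also have "\<dots> = (LINT \<xi>|?M. (cmod (G \<xi>))\<^sup>2) - (2 * pi * h)\<^sup>2 * (\<Sum>x\<in>A. (cmod (fcoef h G x))\<^sup>2)
      + (2 * pi * h)\<^sup>2 * (\<Sum>x\<in>A. (cmod (fcoef h G x))\<^sup>2 + (cmod (f x))\<^sup>2 - 2 * Re (cnj (f x) * fcoef h G x))"
  proof -
    have s: "(\<Sum>x\<in>A. a x + b x - 2 * c x) = sum a A + sum b A - 2 * sum c A" for a b c :: "real^2 \<Rightarrow> real"
      by (simp add: sum.distrib sum_subtractf sum_distrib_left)
    have "p + k * b - 2 * (k * c) = p - k * a + k * (a + b - 2 * c)" for p k a b c :: real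
      by (simp add: algebra_simps)
    thus ?thesis unfolding s .
  qed
  also have "(\<Sum>x\<in>A. (cmod (fcoef h G x))\<^sup>2 + (cmod (f x))\<^sup>2 - 2 * Re (cnj (f x) * fcoef h G x))
     = (\<Sum>x\<in>A. (cmod (fcoef h G x - f x))\<^sup>2)"
    unfolding cmod_power2 by (intro sum.cong refl) (simp add: power2_eq_square algebra_simps)
  finally show ?thesis unfolding T_def .
qed

lemma bessel:
  assumes h: "h > 0" and G: "G \<in> borel_measurable (lebesgue_on (torus h))" "tnorm2 h G < \<infinity>"
    and A: "finite A" "A \<subseteq> lattice h"
  shows "ennreal ((2 * pi * h)\<^sup>2 * (\<Sum>x\<in>A. (cmod (fcoef h G x))\<^sup>2)) \<le> tnorm2 h G"
proof -
  have "0 \<le> (LINT \<xi>|lebesgue_on (torus h). (cmod (G \<xi> - trig_poly h A (fcoef h G) \<xi>))\<^sup>2)"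
    by (intro integral_nonneg_AE) auto
  thus ?thesis unfolding fourier_approx_identity[OF h G A] tnorm2_integrable(3)[OF G]
    by (intro ennreal_leI) simp
qed

lemma tnorm2_approx:
  assumes h: "h > 0" and G: "G \<in> borel_measurable (lebesgue_on (torus h))" "tnorm2 h G < \<infinity>"
    and A: "finite A" "A \<subseteq> lattice h"
  shows "tnorm2 h (\<lambda>\<xi>. G \<xi> - trig_poly h A f \<xi>) = ennreal (
     (LINT \<xi>|lebesgue_on (torus h). (cmod (G \<xi>))\<^sup>2) - (2 * pi * h)\<^sup>2 * (\<Sum>x\<in>A. (cmod (fcoef h G x))\<^sup>2)
      + (2 * pi * h)\<^sup>2 * (\<Sum>x\<in>A. (cmod (fcoef h G x - f x))\<^sup>2))"
proof -
  have "tnorm2 h (\<lambda>\<xi>. G \<xi> + (-1) * trig_poly h A f \<xi>) \<le> 2 * (tnorm2 h G + tnorm2 h (\<lambda>\<xi>. (-1) * trig_poly h A f \<xi>))"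
    using G by (intro tnorm2_add_le) auto
  also have "tnorm2 h (\<lambda>\<xi>. (-1) * trig_poly h A f \<xi>) = tnorm2 h (trig_poly h A f)" by (simp add: tnorm2_def)
  also have "2 * (tnorm2 h G + tnorm2 h (trig_poly h A f)) < \<infinity>"
    using G(2) tnorm2_bounded_finite[OF trig_poly_bound, of h h A f]
    by (simp add: ennreal_mult_less_top)
  finally have fin: "tnorm2 h (\<lambda>\<xi>. G \<xi> - trig_poly h A f \<xi>) < \<infinity>" by simp
  have m: "(\<lambda>\<xi>. G \<xi> - trig_poly h A f \<xi>) \<in> borel_measurable (lebesgue_on (torus h))" using G(1) by measurable
  show ?thesis unfolding tnorm2_integrable(3)[OF m fin] fourier_approx_identity[OF h G A] ..
qed

lemma tnorm2_trig_poly: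
  assumes h: "h > 0" and A: "finite A" "A \<subseteq> lattice h"
  shows "tnorm2 h (trig_poly h A f) = ennreal ((2 * pi * h)\<^sup>2 * (\<Sum>x\<in>A. (cmod (f x))\<^sup>2))"
  using tnorm2_approx[OF h _ _ A, of "\<lambda>_. 0" f]
  by (simp add: tnorm2_def fcoef_def)

lemma trig_poly_diff_subset:
  assumes "finite A" "B \<subseteq> A"
  shows "trig_poly h A f \<xi> - trig_poly h B f \<xi> = trig_poly h (A - B) f \<xi>"
  using assms by (simp add: trig_poly_def right_diff_distrib[symmetric] sum_diff[symmetric])

lemma has_fourier_L2_iff:
  "has_fourier_L2 h f g \<longleftrightarrow> g \<in> borel_measurable (lebesgue_on (torus h)) \<and>
    (\<forall>\<epsilon>>0. \<exists>A0. finite A0 \<and> A0 \<subseteq> lattice h \<and>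
      (\<forall>A. finite A \<and> A0 \<subseteq> A \<and> A \<subseteq> lattice h \<longrightarrow> tnorm2 h (\<lambda>\<xi>. g \<xi> - trig_poly h A f \<xi>) < \<epsilon>))"
proof -
  define N where "N = (\<lambda>A. \<integral>\<^sup>+ \<xi>. ennreal ((cmod (fourier h (\<lambda>x. if x \<in> A then f x else 0) \<xi> - g \<xi>))\<^sup>2) \<partial>lebesgue_on (torus h))"
  have N: "N A = tnorm2 h (\<lambda>\<xi>. g \<xi> - trig_poly h A f \<xi>)" if "finite A" "A \<subseteq> lattice h" for A
    unfolding N_def fourier_finite[OF that] tnorm2_def by (simp add: norm_minus_commute)
  have "(N \<longlongrightarrow> 0) (finite_subsets_at_top (lattice h)) \<longleftrightarrow>
      (\<forall>\<epsilon>>0. eventually (\<lambda>A. N A < \<epsilon>) (finite_subsets_at_top (lattice h)))"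
    by (auto intro: order_tendstoI dest: order_tendstoD(2))
  also have "\<dots> \<longleftrightarrow> (\<forall>\<epsilon>>0. \<exists>A0. finite A0 \<and> A0 \<subseteq> lattice h \<and>
      (\<forall>A. finite A \<and> A0 \<subseteq> A \<and> A \<subseteq> lattice h \<longrightarrow> tnorm2 h (\<lambda>\<xi>. g \<xi> - trig_poly h A f \<xi>) < \<epsilon>))"
    unfolding eventually_finite_subsets_at_top using N by (intro all_cong imp_cong ex_cong conj_cong refl) metis
  finally show ?thesis unfolding has_fourier_L2_def N_def by simp
qed

lemma has_fourier_L2_finite_norm:
  assumes "has_fourier_L2 h f g"
  shows "g \<in> borel_measurable (lebesgue_on (torus h))" "tnorm2 h g < \<infinity>"
proof -
  show m [measurable]: "g \<in> borel_measurable (lebesgue_on (torus h))" using assms has_fourier_L2_iff by blast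
  obtain A where A: "tnorm2 h (\<lambda>\<xi>. g \<xi> - trig_poly h A f \<xi>) < 1"
    using assms[unfolded has_fourier_L2_iff, THEN conjunct2, rule_format, of 1] by auto
  have "tnorm2 h (\<lambda>\<xi>. (g \<xi> - trig_poly h A f \<xi>) + trig_poly h A f \<xi>)
    \<le> 2 * (tnorm2 h (\<lambda>\<xi>. g \<xi> - trig_poly h A f \<xi>) + tnorm2 h (trig_poly h A f))"
    by (intro tnorm2_add_le) measurable
  also have "\<dots> < \<infinity>"
    using order.strict_trans[OF A ennreal_one_less_top] tnorm2_bounded_finite[OF trig_poly_bound, of h h A f]
    by (simp add: ennreal_mult_less_top)
  finally show "tnorm2 h g < \<infinity>" by simp
qed

text \<open>A wrong coefficient at x keeps every truncation containing x at a fixed positive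
  distance from g, by \<open>fourier_approx_identity\<close>.\<close>

lemma has_fourier_L2_fcoef:
  assumes h: "h > 0" and f: "has_fourier_L2 h f g" and x: "x \<in> lattice h"
  shows "f x = fcoef h g x"
proof (rule ccontr)
  assume "f x \<noteq> fcoef h g x"
  hence pos: "0 < (2 * pi * h)\<^sup>2 * (cmod (fcoef h g x - f x))\<^sup>2" using h by simp
  note g = has_fourier_L2_finite_norm[OF f]
  obtain A0 where A0: "finite A0" "A0 \<subseteq> lattice h"
    and lt: "\<And>A. finite A \<Longrightarrow> A0 \<subseteq> A \<Longrightarrow> A \<subseteq> lattice h \<Longrightarrow>
      tnorm2 h (\<lambda>\<xi>. g \<xi> - trig_poly h A f \<xi>) < ennreal ((2 * pi * h)\<^sup>2 * (cmod (fcoef h g x - f x))\<^sup>2)"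
    using f[unfolded has_fourier_L2_iff, THEN conjunct2, rule_format, of "ennreal ((2 * pi * h)\<^sup>2 * (cmod (fcoef h g x - f x))\<^sup>2)"]
      pos by (auto simp: ennreal_less_zero_iff)
  define A where "A = insert x A0"
  have A: "finite A" "A0 \<subseteq> A" "A \<subseteq> lattice h" "x \<in> A" using A0 x by (auto simp: A_def)
  have "(cmod (fcoef h g x - f x))\<^sup>2 \<le> (\<Sum>x\<in>A. (cmod (fcoef h g x - f x))\<^sup>2)"
    using A by (intro member_le_sum) auto
  hence "(2 * pi * h)\<^sup>2 * (cmod (fcoef h g x - f x))\<^sup>2 \<le> (2 * pi * h)\<^sup>2 * (\<Sum>x\<in>A. (cmod (fcoef h g x - f x))\<^sup>2)"
    by (intro mult_left_mono) auto
  moreover have "(2 * pi * h)\<^sup>2 * (\<Sum>x\<in>A. (cmod (fcoef h g x))\<^sup>2) \<le> (LINT \<xi>|lebesgue_on (torus h). (cmod (g \<xi>))\<^sup>2)"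
  proof -
    have "0 \<le> (LINT \<xi>|lebesgue_on (torus h). (cmod (g \<xi> - trig_poly h A (fcoef h g) \<xi>))\<^sup>2)"
      by (intro integral_nonneg_AE) auto
    thus ?thesis unfolding fourier_approx_identity[OF h g A(1,3)] by simp
  qed
  ultimately have "ennreal ((2 * pi * h)\<^sup>2 * (cmod (fcoef h g x - f x))\<^sup>2) \<le> tnorm2 h (\<lambda>\<xi>. g \<xi> - trig_poly h A f \<xi>)"
    unfolding tnorm2_approx[OF h g A(1,3)] by (intro ennreal_leI) linarith
  thus False using lt[OF A(1-3)] by simp
qed

section \<open>Functions in the closure of the trigonometric polynomials\<close>

text \<open>A closed subspace that contains every Plancherel transform and whose elements all arise
  as such transforms. Showing it stable under the multiplier yields the lattice function that the
  propagator must return.\<close>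

definition trig_closure :: "real \<Rightarrow> (real^2 \<Rightarrow> complex) set" where
  "trig_closure h = {G. G \<in> borel_measurable (lebesgue_on (torus h)) \<and>
     (\<forall>\<epsilon>>0. \<exists>A f. finite A \<and> A \<subseteq> lattice h \<and> tnorm2 h (\<lambda>\<xi>. G \<xi> - trig_poly h A f \<xi>) < \<epsilon>)}"

lemma trig_closure_measurable: "G \<in> trig_closure h \<Longrightarrow> G \<in> borel_measurable (lebesgue_on (torus h))"
  by (simp add: trig_closure_def)

text \<open>A quarter rather than a half, because \<open>tnorm2\<close> is a squared norm and its
  triangle inequality costs a factor 2.\<close>

lemma ennreal_quarter:
  fixes \<epsilon> :: ennreal
  assumes "0 < \<epsilon>"
  obtains \<delta> :: ennreal where "0 < \<delta>" "\<And>a b. a < \<delta> \<Longrightarrow> b < \<delta> \<Longrightarrow> 2 * (a + b) < \<epsilon>"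
proof -
  obtain e where e: "0 < e" "e < \<epsilon>" using dense[OF assms] by blast
  hence "e < \<infinity>" by (metis ennreal_less_top infinity_ennreal_def less_top_ennreal order_less_le_trans top_greatest)
  then obtain r where r: "e = ennreal r" "0 \<le> r" by (metis ennreal_cases less_irrefl infinity_ennreal_def)
  have rp: "0 < r" using e r by auto
  show ?thesis
  proof (rule that[of "ennreal (r / 4)"])
    show "0 < ennreal (r / 4)" using rp by simp
    fix a b :: ennreal assume "a < ennreal (r / 4)" "b < ennreal (r / 4)"
    hence "2 * (a + b) \<le> 2 * (ennreal (r / 4) + ennreal (r / 4))" by (intro mult_left_mono add_mono) auto
    also have "\<dots> = ennreal r" using rp
      by (simp add: ennreal_plus[symmetric] ennreal_mult'[symmetric] del: ennreal_plus flip: ennreal_numeral)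
    finally show "2 * (a + b) < \<epsilon>" using e r by simp
  qed
qed

lemma trig_closure_limit:
  assumes G: "G \<in> borel_measurable (lebesgue_on (torus h))"
    and lim: "\<And>\<epsilon>. 0 < \<epsilon> \<Longrightarrow> \<exists>H\<in>trig_closure h. tnorm2 h (\<lambda>\<xi>. G \<xi> - H \<xi>) < \<epsilon>"
  shows "G \<in> trig_closure h"
  unfolding trig_closure_def
proof (intro CollectI conjI G allI impI)
  fix \<epsilon> :: ennreal assume "0 < \<epsilon>"
  then obtain \<delta> where \<delta>: "0 < \<delta>" "\<And>a b. a < \<delta> \<Longrightarrow> b < \<delta> \<Longrightarrow> 2 * (a + b) < \<epsilon>" using ennreal_quarter by blast
  obtain H where H: "H \<in> trig_closure h" "tnorm2 h (\<lambda>\<xi>. G \<xi> - H \<xi>) < \<delta>" using lim[OF \<delta>(1)] by blast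
  obtain A f where Af: "finite A" "A \<subseteq> lattice h" "tnorm2 h (\<lambda>\<xi>. H \<xi> - trig_poly h A f \<xi>) < \<delta>"
    using H(1) \<delta>(1) unfolding trig_closure_def by blast
  have "tnorm2 h (\<lambda>\<xi>. G \<xi> - trig_poly h A f \<xi>) < \<epsilon>"
    using tnorm2_diff_le[OF G trig_poly_measurable trig_closure_measurable[OF H(1)]] \<delta>(2)[OF H(2) Af(3)]
    by (rule le_less_trans)
  thus "\<exists>A f. finite A \<and> A \<subseteq> lattice h \<and> tnorm2 h (\<lambda>\<xi>. G \<xi> - trig_poly h A f \<xi>) < \<epsilon>" using Af by blast
qed

lemma trig_closure_add:
  assumes "G \<in> trig_closure h" "H \<in> trig_closure h"
  shows "(\<lambda>\<xi>. G \<xi> + H \<xi>) \<in> trig_closure h"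
  unfolding trig_closure_def
proof (intro CollectI conjI allI impI)
  note [measurable] = assms[THEN trig_closure_measurable]
  show "(\<lambda>\<xi>. G \<xi> + H \<xi>) \<in> borel_measurable (lebesgue_on (torus h))" by measurable
  fix \<epsilon> :: ennreal assume "0 < \<epsilon>"
  then obtain \<delta> where \<delta>: "0 < \<delta>" "\<And>a b. a < \<delta> \<Longrightarrow> b < \<delta> \<Longrightarrow> 2 * (a + b) < \<epsilon>" using ennreal_quarter by blast
  obtain A f where A: "finite A" "A \<subseteq> lattice h" "tnorm2 h (\<lambda>\<xi>. G \<xi> - trig_poly h A f \<xi>) < \<delta>"
    using assms(1) \<delta>(1) unfolding trig_closure_def by blast
  obtain B g where B: "finite B" "B \<subseteq> lattice h" "tnorm2 h (\<lambda>\<xi>. H \<xi> - trig_poly h B g \<xi>) < \<delta>"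
    using assms(2) \<delta>(1) unfolding trig_closure_def by blast
  define k where "k = (\<lambda>x. (if x \<in> A then f x else 0) + (if x \<in> B then g x else 0))"
  have ext: "(\<Sum>x\<in>S. f x * cis (- (x \<bullet> \<xi>))) = (\<Sum>x\<in>A \<union> B. (if x \<in> S then f x else 0) * cis (- (x \<bullet> \<xi>)))"
    if "S \<subseteq> A \<union> B" for S f \<xi>
    using that A B by (intro sum.mono_neutral_cong_left) auto
  have k: "trig_poly h (A \<union> B) k \<xi> = trig_poly h A f \<xi> + trig_poly h B g \<xi>" for \<xi>
    unfolding trig_poly_def ext[of A f, OF Un_upper1] ext[of B g, OF Un_upper2] k_def
    by (simp add: distrib_left distrib_right sum.distrib)
  have "tnorm2 h (\<lambda>\<xi>. (G \<xi> - trig_poly h A f \<xi>) + (H \<xi> - trig_poly h B g \<xi>)) \<le>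
      2 * (tnorm2 h (\<lambda>\<xi>. G \<xi> - trig_poly h A f \<xi>) + tnorm2 h (\<lambda>\<xi>. H \<xi> - trig_poly h B g \<xi>))"
    by (intro tnorm2_add_le) measurable
  also have "\<dots> < \<epsilon>" by (rule \<delta>(2)[OF A(3) B(3)])
  finally have "tnorm2 h (\<lambda>\<xi>. (G \<xi> + H \<xi>) - trig_poly h (A \<union> B) k \<xi>) < \<epsilon>" by (simp add: k algebra_simps)
  thus "\<exists>A f. finite A \<and> A \<subseteq> lattice h \<and> tnorm2 h (\<lambda>\<xi>. (G \<xi> + H \<xi>) - trig_poly h A f \<xi>) < \<epsilon>"
    using A B by (intro exI[of _ "A \<union> B"] exI[of _ k]) auto
qed

lemma trig_closure_scale:
  assumes "G \<in> trig_closure h"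
  shows "(\<lambda>\<xi>. c * G \<xi>) \<in> trig_closure h"
  unfolding trig_closure_def
proof (intro CollectI conjI allI impI)
  note [measurable] = assms[THEN trig_closure_measurable]
  show "(\<lambda>\<xi>. c * G \<xi>) \<in> borel_measurable (lebesgue_on (torus h))" by measurable
  fix \<epsilon> :: ennreal assume \<epsilon>: "0 < \<epsilon>"
  \<comment> \<open>The added 1 keeps the divisor positive when \<open>c = 0\<close>.\<close>
  define B where "B = 1 + cmod c"
  have B: "0 < B" "cmod c \<le> B" by (auto simp: B_def add_pos_nonneg)
  obtain e where e: "0 < e" "ennreal e \<le> \<epsilon>"
  proof -
    obtain e' where "0 < e'" "e' < \<epsilon>" using dense[OF \<epsilon>] by blast
    moreover from this obtain r where "e' = ennreal r" "0 \<le> r" by (cases e') auto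
    ultimately show ?thesis by (intro that[of r]) auto
  qed
  have "0 < ennreal (e / B\<^sup>2)" using e B by simp
  then obtain A f where A: "finite A" "A \<subseteq> lattice h" "tnorm2 h (\<lambda>\<xi>. G \<xi> - trig_poly h A f \<xi>) < ennreal (e / B\<^sup>2)"
    using assms unfolding trig_closure_def by blast
  have "tnorm2 h (\<lambda>\<xi>. c * (G \<xi> - trig_poly h A f \<xi>)) \<le> ennreal (B\<^sup>2) * tnorm2 h (\<lambda>\<xi>. G \<xi> - trig_poly h A f \<xi>)"
    using B by (intro tnorm2_mult_le) auto
  also have "\<dots> < ennreal (B\<^sup>2) * ennreal (e / B\<^sup>2)"
    using B A(3) by (intro ennreal_mult_strict_left_mono) auto
  also have "\<dots> = ennreal e" using B e by (simp add: ennreal_mult[symmetric])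
  finally have "tnorm2 h (\<lambda>\<xi>. c * (G \<xi> - trig_poly h A f \<xi>)) < \<epsilon>" using e by simp
  moreover have "c * (G \<xi> - trig_poly h A f \<xi>) = c * G \<xi> - trig_poly h A (\<lambda>x. c * f x) \<xi>" for \<xi>
    by (simp add: trig_poly_def right_diff_distrib sum_distrib_left mult_ac)
  ultimately show "\<exists>A f. finite A \<and> A \<subseteq> lattice h \<and> tnorm2 h (\<lambda>\<xi>. c * G \<xi> - trig_poly h A f \<xi>) < \<epsilon>"
    using A by (intro exI[of _ A] exI[of _ "\<lambda>x. c * f x"]) auto
qed

text \<open>Multiplication by a lattice character translates the coefficients of a trigonometric
  polynomial by -y, which stays on the lattice.\<close>

lemma trig_closure_modulate:
  assumes "G \<in> trig_closure h" and y: "y \<in> lattice h"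
  shows "(\<lambda>\<xi>. cis (y \<bullet> \<xi>) * G \<xi>) \<in> trig_closure h"
  unfolding trig_closure_def
proof (intro CollectI conjI allI impI)
  note [measurable] = assms(1)[THEN trig_closure_measurable]
  show "(\<lambda>\<xi>. cis (y \<bullet> \<xi>) * G \<xi>) \<in> borel_measurable (lebesgue_on (torus h))" by measurable
  fix \<epsilon> :: ennreal assume "0 < \<epsilon>"
  then obtain A f where A: "finite A" "A \<subseteq> lattice h" "tnorm2 h (\<lambda>\<xi>. G \<xi> - trig_poly h A f \<xi>) < \<epsilon>"
    using assms unfolding trig_closure_def by blast
  have "trig_poly h ((\<lambda>x. x - y) ` A) (\<lambda>x. f (x + y)) \<xi> = cis (y \<bullet> \<xi>) * trig_poly h A f \<xi>" for \<xi>
  proof -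
    have inj: "inj_on (\<lambda>x. x - y) A" by (auto simp: inj_on_def)
    have "cis (y \<bullet> \<xi> - x \<bullet> \<xi>) = cis (y \<bullet> \<xi>) * cis (- (x \<bullet> \<xi>))" for x by (simp add: cis_mult)
    thus ?thesis
      unfolding trig_poly_def by (simp add: sum.reindex[OF inj] inner_diff_left sum_distrib_left mult_ac)
  qed
  hence "cis (y \<bullet> \<xi>) * G \<xi> - trig_poly h ((\<lambda>x. x - y) ` A) (\<lambda>x. f (x + y)) \<xi> = cis (y \<bullet> \<xi>) * (G \<xi> - trig_poly h A f \<xi>)" for \<xi>
    by (simp add: right_diff_distrib)
  hence "tnorm2 h (\<lambda>\<xi>. cis (y \<bullet> \<xi>) * G \<xi> - trig_poly h ((\<lambda>x. x - y) ` A) (\<lambda>x. f (x + y)) \<xi>) < \<epsilon>"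
    using A(3) by (simp add: tnorm2_def norm_mult)
  moreover have "(\<lambda>x. x - y) ` A \<subseteq> lattice h" using A(2) y by (auto intro: lattice_diff)
  ultimately show "\<exists>A f. finite A \<and> A \<subseteq> lattice h \<and> tnorm2 h (\<lambda>\<xi>. cis (y \<bullet> \<xi>) * G \<xi> - trig_poly h A f \<xi>) < \<epsilon>"
    using A(1) by blast
qed

lemma has_fourier_L2_trig_closure:
  assumes "has_fourier_L2 h f g"
  shows "g \<in> trig_closure h"
  using assms unfolding has_fourier_L2_iff trig_closure_def by blast

text \<open>Truncated Fourier series are best approximations, so density of the trigonometric polynomials
  turns into convergence of the Fourier series.\<close>

lemma trig_closure_has_fourier:
  assumes h: "h > 0" and G: "G \<in> trig_closure h"
  shows "has_fourier_L2 h (\<lambda>x. if x \<in> lattice h then fcoef h G x else 0) G" and "tnorm2 h G < \<infinity>"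
proof -
  note m [measurable] = trig_closure_measurable[OF G]
  obtain A f where A: "tnorm2 h (\<lambda>\<xi>. G \<xi> - trig_poly h A f \<xi>) < 1"
    using G unfolding trig_closure_def by (auto dest: spec[of _ 1])
  have "tnorm2 h (\<lambda>\<xi>. (G \<xi> - trig_poly h A f \<xi>) + trig_poly h A f \<xi>)
    \<le> 2 * (tnorm2 h (\<lambda>\<xi>. G \<xi> - trig_poly h A f \<xi>) + tnorm2 h (trig_poly h A f))"
    by (intro tnorm2_add_le) measurable
  also have "\<dots> < \<infinity>"
    using order.strict_trans[OF A ennreal_one_less_top] tnorm2_bounded_finite[OF trig_poly_bound, of h h A f]
    by (simp add: ennreal_mult_less_top)
  finally show fin: "tnorm2 h G < \<infinity>" by simp
  show "has_fourier_L2 h (\<lambda>x. if x \<in> lattice h then fcoef h G x else 0) G"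
    unfolding has_fourier_L2_iff
  proof (intro conjI m allI impI)
    fix \<epsilon> :: ennreal assume "0 < \<epsilon>"
    then obtain A0 f where A0: "finite A0" "A0 \<subseteq> lattice h" "tnorm2 h (\<lambda>\<xi>. G \<xi> - trig_poly h A0 f \<xi>) < \<epsilon>"
      using G unfolding trig_closure_def by blast
    show "\<exists>A0. finite A0 \<and> A0 \<subseteq> lattice h \<and> (\<forall>A. finite A \<and> A0 \<subseteq> A \<and> A \<subseteq> lattice h \<longrightarrow>
      tnorm2 h (\<lambda>\<xi>. G \<xi> - trig_poly h A (\<lambda>x. if x \<in> lattice h then fcoef h G x else 0) \<xi>) < \<epsilon>)"
    proof (intro exI[of _ A0] conjI allI impI A0)
      fix A assume A: "finite A \<and> A0 \<subseteq> A \<and> A \<subseteq> lattice h"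
      hence eq: "trig_poly h A (\<lambda>x. if x \<in> lattice h then fcoef h G x else 0) = trig_poly h A (fcoef h G)"
        by (auto simp: trig_poly_def fun_eq_iff subset_iff intro!: sum.cong arg_cong2[where f = "(*)"])
      have "(2 * pi * h)\<^sup>2 * (\<Sum>x\<in>A0. (cmod (fcoef h G x))\<^sup>2) \<le> (2 * pi * h)\<^sup>2 * (\<Sum>x\<in>A. (cmod (fcoef h G x))\<^sup>2)"
        using A by (intro mult_left_mono sum_mono2) auto
      moreover have "0 \<le> (2 * pi * h)\<^sup>2 * (\<Sum>x\<in>A0. (cmod (fcoef h G x - f x))\<^sup>2)"
        by (intro mult_nonneg_nonneg sum_nonneg) auto
      ultimately have "tnorm2 h (\<lambda>\<xi>. G \<xi> - trig_poly h A (fcoef h G) \<xi>) \<le> tnorm2 h (\<lambda>\<xi>. G \<xi> - trig_poly h A0 f \<xi>)"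
        using A A0 unfolding tnorm2_approx[OF h m fin A0(1,2)]
        by (subst tnorm2_approx[OF h m fin]) (auto intro!: ennreal_leI)
      thus "tnorm2 h (\<lambda>\<xi>. G \<xi> - trig_poly h A (\<lambda>x. if x \<in> lattice h then fcoef h G x else 0) \<xi>) < \<epsilon>"
        unfolding eq using A0(3) by (rule le_less_trans)
    qed
  qed
qed

lemma lattice_axis: "h *\<^sub>R axis i 1 \<in> lattice h" "- (h *\<^sub>R axis i 1) \<in> lattice h"
proof -
  have "h *\<^sub>R axis i 1 = h *\<^sub>R (\<chi> j. real_of_int ((axis i 1 :: int^2) $ j))"
    by (simp add: vec_eq_iff axis_def)
  thus "h *\<^sub>R axis i 1 \<in> lattice h" unfolding lattice_def by blast
  have "- (h *\<^sub>R axis i 1) = h *\<^sub>R (\<chi> j. real_of_int ((- axis i 1 :: int^2) $ j))"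
    by (simp add: vec_eq_iff axis_def)
  thus "- (h *\<^sub>R axis i 1) \<in> lattice h" unfolding lattice_def by blast
qed

text \<open>By Euler's formula the symbol is 4 minus the four characters of the nearest lattice
  neighbours of the origin.\<close>

lemma trig_closure_lap:
  assumes G: "G \<in> trig_closure h"
  shows "(\<lambda>\<xi>. of_real (lap_symbol (h * \<xi> $ 1) (h * \<xi> $ 2)) * G \<xi>) \<in> trig_closure h"
proof -
  let ?e = "\<lambda>i. h *\<^sub>R axis i 1 :: real^2"
  have "(\<lambda>\<xi>. 4 * G \<xi> + ((-1) * (cis (?e 1 \<bullet> \<xi>) * G \<xi>) + ((-1) * (cis (- ?e 1 \<bullet> \<xi>) * G \<xi>)
     + ((-1) * (cis (?e 2 \<bullet> \<xi>) * G \<xi>) + (-1) * (cis (- ?e 2 \<bullet> \<xi>) * G \<xi>))))) \<in> trig_closure h"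
    by (intro trig_closure_add trig_closure_scale trig_closure_modulate G lattice_axis)
  moreover have "4 * G \<xi> + ((-1) * (cis (?e 1 \<bullet> \<xi>) * G \<xi>) + ((-1) * (cis (- ?e 1 \<bullet> \<xi>) * G \<xi>)
     + ((-1) * (cis (?e 2 \<bullet> \<xi>) * G \<xi>) + (-1) * (cis (- ?e 2 \<bullet> \<xi>) * G \<xi>))))
     = of_real (lap_symbol (h * \<xi> $ 1) (h * \<xi> $ 2)) * G \<xi>" for \<xi>
  proof -
    have "cis (?e i \<bullet> \<xi>) + cis (- ?e i \<bullet> \<xi>) = of_real (2 * cos (h * \<xi> $ i))" for i
      by (simp add: inner_axis' complex_eq_iff)
    from this[of 1] this[of 2] have "of_real (lap_symbol (h * \<xi> $ 1) (h * \<xi> $ 2)) =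
      4 - (cis (?e 1 \<bullet> \<xi>) + cis (- ?e 1 \<bullet> \<xi>)) - (cis (?e 2 \<bullet> \<xi>) + cis (- ?e 2 \<bullet> \<xi>))"
      by (simp add: lap_symbol_def)
    moreover have "4 * g + ((-1) * (a * g) + ((-1) * (b * g) + ((-1) * (c * g) + (-1) * (d * g))))
       = (4 - (a + b) - (c + d)) * g" for a b c d g :: complex
      by (simp add: algebra_simps)
    ultimately show ?thesis by (simp only:)
  qed
  ultimately show ?thesis by simp
qed

lemma trig_closure_omega:
  assumes h: "h > 0" and G: "G \<in> trig_closure h"
  shows "(\<lambda>\<xi>. of_real (omega h \<xi> ^ 4) * G \<xi>) \<in> trig_closure h"
proof -
  have "(\<lambda>\<xi>. of_real (1 / h^4) * (of_real (lap_symbol (h * \<xi> $ 1) (h * \<xi> $ 2)) *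
     (of_real (lap_symbol (h * \<xi> $ 1) (h * \<xi> $ 2)) * G \<xi>))) \<in> trig_closure h"
    by (intro trig_closure_scale trig_closure_lap G)
  moreover have "of_real (1 / h^4) * (of_real (lap_symbol (h * \<xi> $ 1) (h * \<xi> $ 2)) *
     (of_real (lap_symbol (h * \<xi> $ 1) (h * \<xi> $ 2)) * G \<xi>)) = of_real (omega h \<xi> ^ 4) * G \<xi>" for \<xi>
    unfolding omega_pow4[OF h] by (simp add: power2_eq_square)
  ultimately show ?thesis by simp
qed

lemma omega_measurable [measurable]:
  assumes "h > 0"
  shows "(\<lambda>\<xi>. omega h \<xi> ^ 4) \<in> borel_measurable (lebesgue_on (torus h))"
  by (rule continuous_torus_measurable[OF continuous_omega_pow4[OF assms]])

lemma omega_bounded: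
  assumes h: "h > 0"
  shows "0 \<le> omega h \<xi> ^ 4" "omega h \<xi> ^ 4 \<le> 64 / h^4"
proof -
  show "0 \<le> omega h \<xi> ^ 4" unfolding omega_pow4[OF h] using h by simp
  have "\<bar>lap_symbol x y\<bar> \<le> 8" for x y
    using cos_ge_minus_one[of x] cos_ge_minus_one[of y] cos_le_one[of x] cos_le_one[of y]
    by (simp add: lap_symbol_def del: cos_le_one cos_ge_minus_one)
  hence "(lap_symbol x y)\<^sup>2 \<le> 8\<^sup>2" for x y by (metis abs_le_square_iff abs_numeral)
  thus "omega h \<xi> ^ 4 \<le> 64 / h^4" unfolding omega_pow4[OF h] using h by (intro divide_right_mono) auto
qed

text \<open>The multiplier is the uniform limit of the exponential series, whose terms are trigonometric polynomials;
  this avoids completeness of the trigonometric system.\<close>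

lemma trig_closure_propagator:
  assumes h: "h > 0" and G: "G \<in> trig_closure h"
  shows "(\<lambda>\<xi>. cis (t * omega h \<xi> ^ 4) * G \<xi>) \<in> trig_closure h"
proof -
  let ?M = "lebesgue_on (torus h)"
  note m [measurable] = trig_closure_measurable[OF G]
  note [measurable] = omega_measurable[OF h]
  define z where "z = (\<lambda>\<xi>. \<i> * of_real (t * omega h \<xi> ^ 4))"
  have zm [measurable]: "z \<in> borel_measurable ?M" unfolding z_def by measurable
  have ez: "cis (t * omega h \<xi> ^ 4) = exp (z \<xi>)" for \<xi> by (simp add: z_def cis_conv_exp)
  define S where "S = (\<lambda>n \<xi>. \<Sum>k<n. z \<xi> ^ k /\<^sub>R fact k)"
  have Sm [measurable]: "S n \<in> borel_measurable ?M" for n unfolding S_def by measurable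
  have powers: "(\<lambda>\<xi>. z \<xi> ^ k * G \<xi>) \<in> trig_closure h" for k
  proof (induction k)
    case (Suc k)
    have "(\<lambda>\<xi>. (\<i> * of_real t) * (of_real (omega h \<xi> ^ 4) * (z \<xi> ^ k * G \<xi>))) \<in> trig_closure h"
      by (intro trig_closure_scale trig_closure_omega h Suc)
    thus ?case by (simp add: z_def mult_ac)
  qed (use G in simp)
  have S: "(\<lambda>\<xi>. S n \<xi> * G \<xi>) \<in> trig_closure h" for n
  proof (induction n)
    case 0
    show ?case using trig_closure_scale[OF G, of 0] by (simp add: S_def)
  next
    case (Suc n)
    have "(\<lambda>\<xi>. S n \<xi> * G \<xi> + of_real (inverse (fact n)) * (z \<xi> ^ n * G \<xi>)) \<in> trig_closure h"
      by (intro trig_closure_add trig_closure_scale Suc powers)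
    moreover have "S n \<xi> * G \<xi> + of_real (inverse (fact n)) * (z \<xi> ^ n * G \<xi>) = S (Suc n) \<xi> * G \<xi>" for \<xi>
      by (simp add: S_def distrib_right scaleR_conv_of_real mult.assoc)
    ultimately show ?case by simp
  qed
  define Y where "Y = \<bar>t\<bar> * (64 / h^4)"
  have zY: "norm (z \<xi>) \<le> Y" for \<xi>
  proof -
    have "norm (z \<xi>) = \<bar>t\<bar> * omega h \<xi> ^ 4"
      unfolding z_def norm_mult norm_of_real using omega_bounded(1)[OF h, of \<xi>] by (simp add: abs_mult)
    also have "\<dots> \<le> Y" unfolding Y_def by (intro mult_left_mono omega_bounded(2) h) auto
    finally show ?thesis .
  qed
  have SY: "norm (S n \<xi>) \<le> exp Y" for n \<xi>
  proof -
    have "norm (S n \<xi>) \<le> (\<Sum>k<n. Y ^ k /\<^sub>R fact k)"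
      unfolding S_def by (intro sum_norm_le) (auto simp: norm_power intro!: mult_left_mono power_mono zY)
    also have "\<dots> \<le> (\<Sum>k. Y ^ k /\<^sub>R fact k)"
      using order_trans[OF norm_ge_zero zY] by (intro sum_le_suminf summable_exp_generic) auto
    finally show ?thesis by (simp add: exp_def)
  qed
  define B where "B = 1 + exp Y"
  have diff: "norm (exp (z \<xi>) - S n \<xi>) \<le> B" for n \<xi>
    unfolding B_def using order_trans[OF norm_triangle_ineq4 add_mono[OF _ SY]]
    by (metis ez norm_cis order_refl)
  have fin: "tnorm2 h G < \<infinity>" by (rule trig_closure_has_fourier(2)[OF h G])
  \<comment> \<open>Pointwise convergence of the exponential series suffices: \<open>B^2\<close>
    times the squared modulus of \<open>G\<close> is an integrable majorant, as \<open>G\<close> has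
    finite norm.\<close>
  have lim: "(\<lambda>n. tnorm2 h (\<lambda>\<xi>. exp (z \<xi>) * G \<xi> - S n \<xi> * G \<xi>)) \<longlonglongrightarrow> (\<integral>\<^sup>+\<xi>. 0 \<partial>?M)"
    unfolding tnorm2_def
  proof (rule nn_integral_dominated_convergence[where w = "\<lambda>\<xi>. ennreal (B\<^sup>2) * ennreal ((cmod (G \<xi>))\<^sup>2)"])
    show "AE \<xi> in ?M. ennreal ((cmod (exp (z \<xi>) * G \<xi> - S n \<xi> * G \<xi>))\<^sup>2) \<le> ennreal (B\<^sup>2) * ennreal ((cmod (G \<xi>))\<^sup>2)" for n
    proof (rule AE_I2)
      fix \<xi>
      have "(cmod (exp (z \<xi>) * G \<xi> - S n \<xi> * G \<xi>))\<^sup>2 = (cmod (exp (z \<xi>) - S n \<xi>))\<^sup>2 * (cmod (G \<xi>))\<^sup>2"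
        by (simp add: norm_mult power_mult_distrib flip: left_diff_distrib)
      also have "\<dots> \<le> B\<^sup>2 * (cmod (G \<xi>))\<^sup>2" by (intro mult_right_mono power_mono diff) auto
      finally show "ennreal ((cmod (exp (z \<xi>) * G \<xi> - S n \<xi> * G \<xi>))\<^sup>2) \<le> ennreal (B\<^sup>2) * ennreal ((cmod (G \<xi>))\<^sup>2)"
        by (simp add: ennreal_mult'[symmetric] ennreal_leI)
    qed
    have "(\<integral>\<^sup>+\<xi>. ennreal (B\<^sup>2) * ennreal ((cmod (G \<xi>))\<^sup>2) \<partial>?M) = ennreal (B\<^sup>2) * tnorm2 h G"
      unfolding tnorm2_def by (rule nn_integral_cmult) measurable
    also have "\<dots> < \<infinity>" using fin by (simp add: ennreal_mult_less_top)
    finally show "(\<integral>\<^sup>+\<xi>. ennreal (B\<^sup>2) * ennreal ((cmod (G \<xi>))\<^sup>2) \<partial>?M) < \<infinity>" .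
    show "AE \<xi> in ?M. (\<lambda>n. ennreal ((cmod (exp (z \<xi>) * G \<xi> - S n \<xi> * G \<xi>))\<^sup>2)) \<longlonglongrightarrow> 0"
    proof (rule AE_I2)
      fix \<xi>
      have "(\<lambda>n. S n \<xi>) \<longlonglongrightarrow> exp (z \<xi>)" unfolding S_def using exp_converges[of "z \<xi>"] by (simp add: sums_def)
      hence "(\<lambda>n. (cmod (exp (z \<xi>) * G \<xi> - S n \<xi> * G \<xi>))\<^sup>2) \<longlonglongrightarrow> (cmod (exp (z \<xi>) * G \<xi> - exp (z \<xi>) * G \<xi>))\<^sup>2"
        by (intro tendsto_intros)
      thus "(\<lambda>n. ennreal ((cmod (exp (z \<xi>) * G \<xi> - S n \<xi> * G \<xi>))\<^sup>2)) \<longlonglongrightarrow> 0"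
        using tendsto_ennrealI by fastforce
    qed
  qed measurable
  have "(\<lambda>\<xi>. exp (z \<xi>) * G \<xi>) \<in> trig_closure h"
  proof (rule trig_closure_limit)
    show "(\<lambda>\<xi>. exp (z \<xi>) * G \<xi>) \<in> borel_measurable ?M" unfolding ez[symmetric] by measurable
    fix \<epsilon> :: ennreal assume "0 < \<epsilon>"
    hence "eventually (\<lambda>n. tnorm2 h (\<lambda>\<xi>. exp (z \<xi>) * G \<xi> - S n \<xi> * G \<xi>) < \<epsilon>) sequentially"
      using lim by (intro order_tendstoD(2)) auto
    then obtain n where "tnorm2 h (\<lambda>\<xi>. exp (z \<xi>) * G \<xi> - S n \<xi> * G \<xi>) < \<epsilon>"
      by (auto simp: eventually_sequentially)
    thus "\<exists>H\<in>trig_closure h. tnorm2 h (\<lambda>\<xi>. exp (z \<xi>) * G \<xi> - H \<xi>) < \<epsilon>" by (rule bexI[OF _ S])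
  qed
  thus ?thesis unfolding ez .
qed

section \<open>Lattice norms and existence of the Fourier transform\<close>

lemma enn_powr_ennreal: "0 \<le> z \<Longrightarrow> enn_powr (ennreal z) a = ennreal (z powr a)"
  by (simp add: enn_powr_def)

lemma enn_powr_mono:
  assumes "x \<le> y" "0 < a"
  shows "enn_powr x a \<le> enn_powr y a"
proof (cases "y = \<infinity>")
  case False
  then obtain r where r: "y = ennreal r" "0 \<le> r" by (cases y) auto
  then obtain s where s: "x = ennreal s" "0 \<le> s" "s \<le> r" using assms(1) by (cases x) (auto simp: top_unique)
  thus ?thesis using r assms by (simp add: enn_powr_ennreal ennreal_leI powr_mono2)
qed (simp add: enn_powr_def)

text \<open>Finite sets suffice because the infinite sum of nonnegative terms is the supremum of its
  finite subsums.\<close>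

lemma lattice_norm_le:
  assumes "0 < r" "0 \<le> Z" and le: "\<And>A. finite A \<Longrightarrow> A \<subseteq> lattice h \<Longrightarrow> h\<^sup>2 * (\<Sum>x\<in>A. cmod (u x) powr r) \<le> Z"
  shows "lattice_norm h (ereal r) u \<le> ennreal (Z powr (1 / r))"
proof -
  have "ennreal (h\<^sup>2) * (\<Sum>\<^sub>\<infinity>x\<in>lattice h. ennreal (cmod (u x) powr r)) \<le> ennreal Z"
  proof (cases "h = 0")
    case False
    have "(\<Sum>\<^sub>\<infinity>x\<in>lattice h. ennreal (cmod (u x) powr r)) \<le> ennreal (Z / h\<^sup>2)"
      unfolding nonneg_infsum_complete[OF zero_le]
    proof (rule SUP_least)
      fix A assume A: "A \<in> {F. finite F \<and> F \<subseteq> lattice h}"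
      hence "(\<Sum>x\<in>A. cmod (u x) powr r) \<le> Z / h\<^sup>2" using le[of A] False by (simp add: field_simps)
      thus "(\<Sum>x\<in>A. ennreal (cmod (u x) powr r)) \<le> ennreal (Z / h\<^sup>2)"
        by (simp add: sum_ennreal ennreal_leI)
    qed
    hence "ennreal (h\<^sup>2) * (\<Sum>\<^sub>\<infinity>x\<in>lattice h. ennreal (cmod (u x) powr r)) \<le> ennreal (h\<^sup>2) * ennreal (Z / h\<^sup>2)"
      by (intro mult_left_mono) auto
    also have "\<dots> = ennreal Z" using False assms by (simp add: ennreal_mult[symmetric])
    finally show ?thesis .
  qed (use assms in auto)
  from enn_powr_mono[OF this, of "1 / r"] show ?thesis
    using assms by (simp add: lattice_norm_def enn_powr_ennreal)
qed

text \<open>Unpacks the squared norm as a supremum of finite masses. The last clause supplies the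
  finite sets that carry almost all of the mass in \<open>fourier_L2_exists\<close>.\<close>

lemma lattice_L2_norm:
  assumes h: "h > 0" and f: "f \<in> lattice_L2 h"
  obtains N where "0 \<le> N" "lattice_norm h 2 f = ennreal N"
    "\<And>A. finite A \<Longrightarrow> A \<subseteq> lattice h \<Longrightarrow> h\<^sup>2 * (\<Sum>x\<in>A. (cmod (f x))\<^sup>2) \<le> N\<^sup>2"
    "\<And>e. 0 < e \<Longrightarrow> \<exists>A. finite A \<and> A \<subseteq> lattice h \<and> N\<^sup>2 - e < h\<^sup>2 * (\<Sum>x\<in>A. (cmod (f x))\<^sup>2)"
proof -
  define S where "S = ennreal (h\<^sup>2) * (\<Sum>\<^sub>\<infinity>x\<in>lattice h. ennreal ((cmod (f x))\<^sup>2))"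
  have norm: "lattice_norm h 2 f = enn_powr S (1/2)"
  proof -
    have "real_of_ereal 2 = 2" by (metis numeral_eq_ereal real_of_ereal.simps(1))
    thus ?thesis by (simp add: lattice_norm_def S_def)
  qed
  have "S \<noteq> \<infinity>" using f unfolding lattice_L2_def mem_Collect_eq norm by (auto simp: enn_powr_def)
  then obtain s where s: "S = ennreal s" "0 \<le> s" by (cases S) auto
  have sup: "S = (SUP A\<in>{A. finite A \<and> A \<subseteq> lattice h}. ennreal (h\<^sup>2 * (\<Sum>x\<in>A. (cmod (f x))\<^sup>2)))"
    unfolding S_def nonneg_infsum_complete[OF zero_le]
    by (subst SUP_mult_left_ennreal) (auto intro!: SUP_cong simp: sum_ennreal ennreal_mult sum_nonneg)
  show ?thesis
  proof (rule that[of "sqrt s"])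
    show "lattice_norm h 2 f = ennreal (sqrt s)" unfolding norm s using s by (simp add: enn_powr_ennreal powr_half_sqrt)
    fix A assume "finite A" "A \<subseteq> lattice h"
    hence "ennreal (h\<^sup>2 * (\<Sum>x\<in>A. (cmod (f x))\<^sup>2)) \<le> ennreal s" unfolding s(1)[symmetric] sup by (intro SUP_upper) auto
    thus "h\<^sup>2 * (\<Sum>x\<in>A. (cmod (f x))\<^sup>2) \<le> (sqrt s)\<^sup>2" using s by (simp add: ennreal_le_iff)
  next
    fix e :: real assume e: "0 < e"
    show "\<exists>A. finite A \<and> A \<subseteq> lattice h \<and> (sqrt s)\<^sup>2 - e < h\<^sup>2 * (\<Sum>x\<in>A. (cmod (f x))\<^sup>2)"
    \<comment> \<open>For \<open>s = 0\<close> the strict inequality used in the other case would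
      read 0 < 0, since \<open>ennreal\<close> sends negative reals to 0.\<close>
    proof (cases "s = 0")
      case True thus ?thesis using e by (intro exI[of _ "{}"]) auto
    next
      case False
      hence "ennreal (s - e) < S" using s e by (simp add: ennreal_lessI)
      then obtain A where A: "finite A" "A \<subseteq> lattice h" "ennreal (s - e) < ennreal (h\<^sup>2 * (\<Sum>x\<in>A. (cmod (f x))\<^sup>2))"
        unfolding sup less_SUP_iff by auto
      have "s - e < h\<^sup>2 * (\<Sum>x\<in>A. (cmod (f x))\<^sup>2)"
        using A(3) by (metis ennreal_leI leD leI)
      thus ?thesis using A s by auto
    qed
  qed (use s in auto)
qed

text \<open>The Riesz-Fischer argument. Finite sets that miss less than 4^(-n) of the mass give
  partial sums that converge so fast that their increments are summable almost everywhere; Fatou's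
  lemma turns the pointwise limit into a limit in the L^2 norm. The factor \<open>(2 * pi)^2\<close>
  is the Plancherel constant.\<close>

lemma fourier_L2_exists:
  assumes h: "h > 0"
    and le: "\<And>A. finite A \<Longrightarrow> A \<subseteq> lattice h \<Longrightarrow> h\<^sup>2 * (\<Sum>x\<in>A. (cmod (f x))\<^sup>2) \<le> L"
    and approx: "\<And>e. 0 < e \<Longrightarrow> \<exists>A. finite A \<and> A \<subseteq> lattice h \<and> L - e < h\<^sup>2 * (\<Sum>x\<in>A. (cmod (f x))\<^sup>2)"
  obtains g where "has_fourier_L2 h f g" "tnorm2 h g \<le> ennreal ((2 * pi)\<^sup>2 * L)"
proof -
  let ?M = "lebesgue_on (torus h)"
  interpret finite_measure ?M by (rule finite_measure_torus)
  have L0: "0 \<le> L" using le[of "{}"] by simp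
  have "\<forall>n. \<exists>A. finite A \<and> A \<subseteq> lattice h \<and> L - (1/4)^n < h\<^sup>2 * (\<Sum>x\<in>A. (cmod (f x))\<^sup>2)"
    by (intro allI approx) auto
  then obtain A where A: "\<And>n. finite (A n)" "\<And>n. A n \<subseteq> lattice h"
    "\<And>n. L - (1/4)^n < h\<^sup>2 * (\<Sum>x\<in>A n. (cmod (f x))\<^sup>2)" by metis
  define B where "B = (\<lambda>n. \<Union>k\<le>n. A k)"
  have B: "finite (B n)" "B n \<subseteq> lattice h" "A n \<subseteq> B n" for n using A by (auto simp: B_def)
  have Bm: "B n \<subseteq> B m" if "n \<le> m" for n m unfolding B_def by (rule UN_mono) (use that in auto)
  define T where "T = (\<lambda>n. trig_poly h (B n) f)"
  have Tm [measurable]: "T n \<in> borel_measurable ?M" for n by (simp add: T_def)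
  define c where "c = (2 * pi)\<^sup>2"
  have c0: "0 \<le> c" by (simp add: c_def)
  have tail: "tnorm2 h (\<lambda>\<xi>. trig_poly h S f \<xi> - T n \<xi>) \<le> ennreal (c * (1/4)^n)"
    if S: "finite S" "S \<subseteq> lattice h" "B n \<subseteq> S" for S n
  proof -
    have "L - (1/4)^n \<le> h\<^sup>2 * (\<Sum>x\<in>A n. (cmod (f x))\<^sup>2)" using A(3)[of n] by simp
    also have "\<dots> \<le> h\<^sup>2 * (\<Sum>x\<in>B n. (cmod (f x))\<^sup>2)" using B by (intro mult_left_mono sum_mono2) auto
    finally have "h\<^sup>2 * (\<Sum>x\<in>S - B n. (cmod (f x))\<^sup>2) \<le> (1/4)^n"
      using le[OF S(1,2)] unfolding sum_diff[OF S(1,3)] right_diff_distrib by linarith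
    hence "c * (h\<^sup>2 * (\<Sum>x\<in>S - B n. (cmod (f x))\<^sup>2)) \<le> c * (1/4)^n" using c0 by (rule mult_left_mono)
    moreover have "tnorm2 h (\<lambda>\<xi>. trig_poly h S f \<xi> - T n \<xi>) = ennreal (c * (h\<^sup>2 * (\<Sum>x\<in>S - B n. (cmod (f x))\<^sup>2)))"
    proof -
      have "S - B n \<subseteq> lattice h" using S by auto
      thus ?thesis
        unfolding T_def trig_poly_diff_subset[OF S(1,3)]
        using tnorm2_trig_poly[OF h, of "S - B n" f] S by (simp add: c_def power_mult_distrib mult.assoc)
    qed
    ultimately show ?thesis by (simp add: ennreal_leI)
  qed
  define D where "D = (\<lambda>n \<xi>. cmod (T (Suc n) \<xi> - T n \<xi>))"
  have Dm [measurable]: "D n \<in> borel_measurable ?M" for n unfolding D_def by measurable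
  have D0: "0 \<le> D n \<xi>" for n \<xi> by (simp add: D_def)
  define \<mu> where "\<mu> = measure ?M (space ?M)"
  have "(\<integral>\<^sup>+\<xi>. ennreal (D n \<xi>) \<partial>?M) \<le> ennreal ((\<mu> + c) * (1/2)^n)" for n
  proof -
    \<comment> \<open>Converts the squared bound of order 4^(-n) into an L^1 bound of order 2^(-n):
      the first summand is paid for by the finite measure of the torus, and the factor 2^n in the
      second is outweighed by 4^(-n).\<close>
    have y: "d \<le> (1/2)^n + 2^n * d\<^sup>2" for d :: real
    proof -
      have "0 \<le> ((1/2)^n - d)\<^sup>2 * 2^n" by simp
      also have "\<dots> = (1/2)^n * ((1/2)^n * 2^n) + 2^n * d\<^sup>2 - 2 * d * ((1/2)^n * 2^n)"
        by (simp add: power2_eq_square algebra_simps)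
      also have "(1/2)^n * 2^n = (1::real)" by (simp flip: power_mult_distrib)
      finally have 1: "2 * d \<le> (1/2)^n + 2^n * d\<^sup>2" by simp
      have "0 \<le> (1/2)^n + 2^n * d\<^sup>2" by simp
      thus ?thesis using 1 by linarith
    qed
    have "(\<integral>\<^sup>+\<xi>. ennreal (D n \<xi>) \<partial>?M) \<le> (\<integral>\<^sup>+\<xi>. ennreal ((1/2)^n) + ennreal (2^n) * ennreal ((D n \<xi>)\<^sup>2) \<partial>?M)"
      using y by (intro nn_integral_mono) (simp add: ennreal_mult'[symmetric] ennreal_plus[symmetric] ennreal_leI del: ennreal_plus)
    also have "\<dots> = ennreal ((1/2)^n) * emeasure ?M (space ?M) + ennreal (2^n) * tnorm2 h (\<lambda>\<xi>. T (Suc n) \<xi> - T n \<xi>)"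
      by (simp add: nn_integral_add nn_integral_cmult tnorm2_def D_def)
    also have "\<dots> \<le> ennreal ((1/2)^n) * ennreal \<mu> + ennreal (2^n) * ennreal (c * (1/4)^n)"
      unfolding \<mu>_def emeasure_eq_measure
      using tail[OF B(1,2) Bm[of n "Suc n"]] by (intro add_mono mult_left_mono) (auto simp: T_def)
    also have "\<dots> = ennreal ((1/2)^n * \<mu> + 2^n * (c * (1/4)^n))"
      using c0 by (simp add: ennreal_mult'[symmetric] ennreal_plus[symmetric] \<mu>_def del: ennreal_plus)
    also have "(1/2)^n * \<mu> + 2^n * (c * (1/4)^n) = (\<mu> + c) * (1/2)^n"
    proof -
      have "2^n * (1/4)^n = (1/2 :: real)^n" by (simp flip: power_mult_distrib)
      thus ?thesis by (simp add: algebra_simps)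
    qed
    finally show ?thesis .
  qed
  hence "(\<Sum>n. \<integral>\<^sup>+\<xi>. ennreal (D n \<xi>) \<partial>?M) \<le> (\<Sum>n. ennreal ((\<mu> + c) * (1/2)^n))"
    by (intro suminf_le) auto
  also have "\<dots> = ennreal (\<Sum>n. (\<mu> + c) * (1/2)^n)"
    using c0 by (intro suminf_ennreal2 summable_mult summable_geometric) (auto simp: \<mu>_def)
  also have "\<dots> < \<infinity>" by simp
  finally have "(\<integral>\<^sup>+\<xi>. (\<Sum>n. ennreal (D n \<xi>)) \<partial>?M) < \<infinity>"
    by (subst nn_integral_suminf) auto
  hence "AE \<xi> in ?M. (\<Sum>n. ennreal (D n \<xi>)) \<noteq> \<infinity>"
    by (intro nn_integral_PInf_AE) auto
  hence conv: "AE \<xi> in ?M. convergent (\<lambda>n. T n \<xi>)"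
  proof eventually_elim
    fix \<xi> assume "(\<Sum>n. ennreal (D n \<xi>)) \<noteq> \<infinity>"
    hence "summable (\<lambda>n. D n \<xi>)"
      unfolding infinity_ennreal_def by (rule summable_suminf_not_top[OF D0])
    hence "summable (\<lambda>n. norm (T (Suc n) \<xi> - T n \<xi>))" unfolding D_def .
    hence "summable (\<lambda>n. T (Suc n) \<xi> - T n \<xi>)" by (rule summable_norm_cancel)
    hence "(\<lambda>m. T m \<xi> - T 0 \<xi>) \<longlonglongrightarrow> (\<Sum>n. T (Suc n) \<xi> - T n \<xi>)"
    proof -
      have "(\<Sum>n<m. T (Suc n) \<xi> - T n \<xi>) = T m \<xi> - T 0 \<xi>" for m
        by (rule sum_lessThan_telescope)
      thus ?thesis using summable_LIMSEQ[OF \<open>summable (\<lambda>n. T (Suc n) \<xi> - T n \<xi>)\<close>] by simp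
    qed
    from tendsto_add[OF this tendsto_const[of "T 0 \<xi>"]] show "convergent (\<lambda>n. T n \<xi>)"
      by (auto simp: convergent_def)
  qed
  define g where "g = (\<lambda>\<xi>. lim (\<lambda>n. T n \<xi>))"
  have gm [measurable]: "g \<in> borel_measurable ?M"
    unfolding g_def by (rule borel_measurable_lim_metric) measurable
  \<comment> \<open>Used twice: with \<open>F = T n\<close> for the rate of convergence, and with
    \<open>F = 0\<close> for the norm of the limit.\<close>
  have fatou: "tnorm2 h (\<lambda>\<xi>. g \<xi> - F \<xi>) \<le> ennreal K"
    if [measurable]: "F \<in> borel_measurable ?M" and le: "\<And>m. n \<le> m \<Longrightarrow> tnorm2 h (\<lambda>\<xi>. T m \<xi> - F \<xi>) \<le> ennreal K" for F K n
  proof -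
    have "tnorm2 h (\<lambda>\<xi>. g \<xi> - F \<xi>) = (\<integral>\<^sup>+\<xi>. liminf (\<lambda>m. ennreal ((cmod (T m \<xi> - F \<xi>))\<^sup>2)) \<partial>?M)"
      unfolding tnorm2_def
    proof (rule nn_integral_cong_AE)
      show "AE \<xi> in ?M. ennreal ((cmod (g \<xi> - F \<xi>))\<^sup>2) = liminf (\<lambda>m. ennreal ((cmod (T m \<xi> - F \<xi>))\<^sup>2))"
        using conv
      proof eventually_elim
        fix \<xi> assume "convergent (\<lambda>n. T n \<xi>)"
        hence "(\<lambda>n. T n \<xi>) \<longlonglongrightarrow> g \<xi>" unfolding g_def by (rule convergent_LIMSEQ_iff[THEN iffD1])
        hence "(\<lambda>m. ennreal ((cmod (T m \<xi> - F \<xi>))\<^sup>2)) \<longlonglongrightarrow> ennreal ((cmod (g \<xi> - F \<xi>))\<^sup>2)"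
          by (intro tendsto_intros tendsto_ennrealI)
        thus "ennreal ((cmod (g \<xi> - F \<xi>))\<^sup>2) = liminf (\<lambda>m. ennreal ((cmod (T m \<xi> - F \<xi>))\<^sup>2))"
          by (rule lim_imp_Liminf[OF sequentially_bot, symmetric])
      qed
    qed
    also have "\<dots> \<le> liminf (\<lambda>m. tnorm2 h (\<lambda>\<xi>. T m \<xi> - F \<xi>))"
      unfolding tnorm2_def by (rule nn_integral_liminf) measurable
    also have "\<dots> \<le> limsup (\<lambda>m. tnorm2 h (\<lambda>\<xi>. T m \<xi> - F \<xi>))" by (rule Liminf_le_Limsup) simp
    also have "\<dots> \<le> ennreal K"
      by (rule Limsup_bounded) (use le in \<open>auto simp: eventually_sequentially\<close>)
    finally show ?thesis .
  qed
  have gT: "tnorm2 h (\<lambda>\<xi>. g \<xi> - T n \<xi>) \<le> ennreal (c * (1/4)^n)" for n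
  proof (rule fatou)
    show "tnorm2 h (\<lambda>\<xi>. T m \<xi> - T n \<xi>) \<le> ennreal (c * (1/4)^n)" if "n \<le> m" for m
      using tail[OF B(1,2) Bm[OF that]] by (simp add: T_def)
  qed measurable
  have "tnorm2 h (\<lambda>\<xi>. g \<xi> - 0) \<le> ennreal (c * L)"
  proof (rule fatou)
    fix m
    have "c * (h\<^sup>2 * (\<Sum>x\<in>B m. (cmod (f x))\<^sup>2)) \<le> c * L" by (intro mult_left_mono le B c0)
    thus "tnorm2 h (\<lambda>\<xi>. T m \<xi> - 0) \<le> ennreal (c * L)"
      using tnorm2_trig_poly[OF h B(1,2), of m f]
      by (simp add: T_def c_def power_mult_distrib mult.assoc ennreal_leI)
  qed measurable
  moreover have "has_fourier_L2 h f g"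
    unfolding has_fourier_L2_iff
  proof (intro conjI gm allI impI)
    fix \<epsilon> :: ennreal assume "0 < \<epsilon>"
    then obtain \<delta> where \<delta>: "0 < \<delta>" "\<And>a b. a < \<delta> \<Longrightarrow> b < \<delta> \<Longrightarrow> 2 * (a + b) < \<epsilon>" using ennreal_quarter by blast
    have "(\<lambda>n. c * (1/4)^n) \<longlonglongrightarrow> c * 0"
      by (intro tendsto_mult_left LIMSEQ_power_zero) simp
    hence "(\<lambda>n. ennreal (c * (1/4)^n)) \<longlonglongrightarrow> 0" using tendsto_ennrealI by fastforce
    hence "eventually (\<lambda>n. ennreal (c * (1/4)^n) < \<delta>) sequentially" using \<delta>(1) by (rule order_tendstoD(2))
    then obtain n where n: "ennreal (c * (1/4)^n) < \<delta>" by (auto simp: eventually_sequentially)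
    show "\<exists>A0. finite A0 \<and> A0 \<subseteq> lattice h \<and> (\<forall>A. finite A \<and> A0 \<subseteq> A \<and> A \<subseteq> lattice h \<longrightarrow>
      tnorm2 h (\<lambda>\<xi>. g \<xi> - trig_poly h A f \<xi>) < \<epsilon>)"
    proof (intro exI[of _ "B n"] conjI allI impI B)
      fix S assume S: "finite S \<and> B n \<subseteq> S \<and> S \<subseteq> lattice h"
      have "tnorm2 h (\<lambda>\<xi>. g \<xi> - trig_poly h S f \<xi>) \<le> 2 * (tnorm2 h (\<lambda>\<xi>. g \<xi> - T n \<xi>) + tnorm2 h (\<lambda>\<xi>. T n \<xi> - trig_poly h S f \<xi>))"
        by (rule tnorm2_diff_le) measurable
      also have "\<dots> < \<epsilon>"
      proof (rule \<delta>(2))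
        show "tnorm2 h (\<lambda>\<xi>. g \<xi> - T n \<xi>) < \<delta>" using gT n by (rule le_less_trans)
        show "tnorm2 h (\<lambda>\<xi>. T n \<xi> - trig_poly h S f \<xi>) < \<delta>"
          unfolding tnorm2_minus_commute[of h "T n"] using tail[of S n] S n by (auto intro: le_less_trans)
      qed
      finally show "tnorm2 h (\<lambda>\<xi>. g \<xi> - trig_poly h S f \<xi>) < \<epsilon>" .
    qed
  qed
  ultimately show ?thesis by (intro that[of g]) (simp_all add: c_def)
qed

lemma has_fourier_L2_unique:
  assumes "has_fourier_L2 h f g" "has_fourier_L2 h f g'"
  shows "AE \<xi> in lebesgue_on (torus h). g \<xi> = g' \<xi>"
proof -
  note m [measurable] = has_fourier_L2_finite_norm(1)[OF assms(1)] has_fourier_L2_finite_norm(1)[OF assms(2)]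
  have "tnorm2 h (\<lambda>\<xi>. g \<xi> - g' \<xi>) \<le> \<epsilon>" if "0 < \<epsilon>" for \<epsilon>
  proof -
    obtain \<delta> where \<delta>: "0 < \<delta>" "\<And>a b. a < \<delta> \<Longrightarrow> b < \<delta> \<Longrightarrow> 2 * (a + b) < \<epsilon>"
      using ennreal_quarter[OF \<open>0 < \<epsilon>\<close>] by blast
    obtain A1 where A1: "finite A1" "A1 \<subseteq> lattice h"
      "\<And>A. finite A \<Longrightarrow> A1 \<subseteq> A \<Longrightarrow> A \<subseteq> lattice h \<Longrightarrow> tnorm2 h (\<lambda>\<xi>. g \<xi> - trig_poly h A f \<xi>) < \<delta>"
      using assms(1)[unfolded has_fourier_L2_iff, THEN conjunct2, rule_format, OF \<delta>(1)] by auto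
    obtain A2 where A2: "finite A2" "A2 \<subseteq> lattice h"
      "\<And>A. finite A \<Longrightarrow> A2 \<subseteq> A \<Longrightarrow> A \<subseteq> lattice h \<Longrightarrow> tnorm2 h (\<lambda>\<xi>. g' \<xi> - trig_poly h A f \<xi>) < \<delta>"
      using assms(2)[unfolded has_fourier_L2_iff, THEN conjunct2, rule_format, OF \<delta>(1)] by auto
    have "tnorm2 h (\<lambda>\<xi>. g \<xi> - g' \<xi>) \<le> 2 * (tnorm2 h (\<lambda>\<xi>. g \<xi> - trig_poly h (A1 \<union> A2) f \<xi>)
        + tnorm2 h (\<lambda>\<xi>. trig_poly h (A1 \<union> A2) f \<xi> - g' \<xi>))"
      by (rule tnorm2_diff_le) measurable
    also have "\<dots> < \<epsilon>"
      unfolding tnorm2_minus_commute[of h "trig_poly h (A1 \<union> A2) f"]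
      by (intro \<delta>(2) A1 A2) (use A1 A2 in auto)
    finally show ?thesis by simp
  qed
  hence "tnorm2 h (\<lambda>\<xi>. g \<xi> - g' \<xi>) = 0" by (meson dense leD not_gr_zero)
  hence "AE \<xi> in lebesgue_on (torus h). ennreal ((cmod (g \<xi> - g' \<xi>))\<^sup>2) = 0"
    unfolding tnorm2_def by (subst (asm) nn_integral_0_iff_AE) measurable
  thus ?thesis by eventually_elim simp
qed

section \<open>The propagator and the Strichartz estimate\<close>

lemma tnorm2_propagator: "tnorm2 h (\<lambda>\<xi>. cis (t * omega h \<xi> ^ 4) * g \<xi>) = tnorm2 h g"
  by (simp add: tnorm2_def norm_mult)

lemma fcoef_mass_bound:
  assumes h: "h > 0" and g: "g \<in> borel_measurable (lebesgue_on (torus h))" "tnorm2 h g \<le> ennreal ((2 * pi)\<^sup>2 * L)"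
    and L: "0 \<le> L" and A: "finite A" "A \<subseteq> lattice h"
  shows "h\<^sup>2 * (\<Sum>x\<in>A. (cmod (fcoef h g x))\<^sup>2) \<le> L"
proof -
  have "tnorm2 h g < \<infinity>" using g(2) by (rule le_less_trans) simp
  from order_trans[OF bessel[OF h g(1) this A] g(2)]
  have "(2 * pi)\<^sup>2 * (h\<^sup>2 * (\<Sum>x\<in>A. (cmod (fcoef h g x))\<^sup>2)) \<le> (2 * pi)\<^sup>2 * L"
    using L by (simp add: power_mult_distrib mult.assoc)
  thus ?thesis by (rule mult_left_le_imp_le) simp
qed

lemma lattice_norm_2_le:
  assumes "0 \<le> N" "\<And>A. finite A \<Longrightarrow> A \<subseteq> lattice h \<Longrightarrow> h\<^sup>2 * (\<Sum>x\<in>A. (cmod (u x))\<^sup>2) \<le> N\<^sup>2"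
  shows "lattice_norm h 2 u \<le> ennreal N"
proof -
  have "lattice_norm h (ereal 2) u \<le> ennreal (N\<^sup>2 powr (1/2))"
    using assms by (intro lattice_norm_le) auto
  thus ?thesis using assms(1) by (simp add: powr_half_sqrt numeral_eq_ereal)
qed

text \<open>Existence holds because the multiplied transform stays in \<open>trig_closure\<close>
  and so is the transform of its own coefficients; the mass bound \<open>N\<close> places these in
  \<open>lattice_L2\<close>. For uniqueness, two transforms of f agree almost everywhere, and a
  lattice function is recovered from its transform by \<open>fcoef\<close>.\<close>

lemma propagator_eq:
  assumes h: "h > 0" and f: "has_fourier_L2 h f g" and g: "tnorm2 h g \<le> ennreal ((2 * pi)\<^sup>2 * N\<^sup>2)" "0 \<le> N"
  shows "propagator h t f = (\<lambda>x. if x \<in> lattice h then fcoef h (\<lambda>\<xi>. cis (t * omega h \<xi> ^ 4) * g \<xi>) x else 0)"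
    (is "_ = ?u")
  unfolding propagator_def
proof (rule the_equality)
  let ?G = "\<lambda>\<xi>. cis (t * omega h \<xi> ^ 4) * g \<xi>"
  have G: "?G \<in> trig_closure h" by (rule trig_closure_propagator[OF h has_fourier_L2_trig_closure[OF f]])
  note Gm = trig_closure_measurable[OF G]
  have "lattice_norm h 2 ?u \<le> ennreal N"
  proof (rule lattice_norm_2_le[OF g(2)])
    fix A assume A: "finite A" "A \<subseteq> lattice h"
    have "(\<Sum>x\<in>A. (cmod (?u x))\<^sup>2) = (\<Sum>x\<in>A. (cmod (fcoef h ?G x))\<^sup>2)"
      using A by (intro sum.cong) auto
    thus "h\<^sup>2 * (\<Sum>x\<in>A. (cmod (?u x))\<^sup>2) \<le> N\<^sup>2"
      using fcoef_mass_bound[OF h Gm _ _ A] g by (simp add: tnorm2_propagator)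
  qed
  hence "lattice_norm h 2 ?u < \<infinity>" by (rule le_less_trans) simp
  hence "?u \<in> lattice_L2 h" by (simp add: lattice_L2_def)
  thus "?u \<in> lattice_L2 h \<and> (\<exists>g. has_fourier_L2 h f g \<and> has_fourier_L2 h ?u (\<lambda>\<xi>. cis (t * omega h \<xi> ^ 4) * g \<xi>))"
    using f trig_closure_has_fourier(1)[OF h G] by blast
  fix v assume v: "v \<in> lattice_L2 h \<and> (\<exists>g. has_fourier_L2 h f g \<and> has_fourier_L2 h v (\<lambda>\<xi>. cis (t * omega h \<xi> ^ 4) * g \<xi>))"
  then obtain g' where g': "has_fourier_L2 h f g'" "has_fourier_L2 h v (\<lambda>\<xi>. cis (t * omega h \<xi> ^ 4) * g' \<xi>)" by blast
  note m [measurable] = has_fourier_L2_finite_norm(1)[OF g'(2)] Gm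
  show "v = ?u"
  proof
    fix x
    show "v x = ?u x"
    proof (cases "x \<in> lattice h")
      case True
      have "v x = fcoef h (\<lambda>\<xi>. cis (t * omega h \<xi> ^ 4) * g' \<xi>) x"
        by (rule has_fourier_L2_fcoef[OF h g'(2) True])
      also have "\<dots> = fcoef h ?G x"
        unfolding fcoef_def
      proof (intro arg_cong2[where f = "(*)"] refl integral_cong_AE)
        show "AE \<xi> in lebesgue_on (torus h). cis (x \<bullet> \<xi>) * (cis (t * omega h \<xi> ^ 4) * g' \<xi>) = cis (x \<bullet> \<xi>) * (cis (t * omega h \<xi> ^ 4) * g \<xi>)"
          using has_fourier_L2_unique[OF f g'(1)] by eventually_elim simp
      qed measurable
      finally show ?thesis using True by simp
    qed (use v in \<open>simp add: lattice_L2_def\<close>)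
  qed
qed

section \<open>The endpoint pair\<close>

lemma measurable_argmax:
  fixes w :: "real \<Rightarrow> 'b::topological_space \<Rightarrow> real"
  assumes "finite A" "A \<noteq> {}" and [measurable]: "\<And>x. x \<in> A \<Longrightarrow> (\<lambda>t. w t x) \<in> borel_measurable borel"
  shows "\<exists>\<psi>\<in>borel_measurable borel. (\<lambda>t. w t (\<psi> t)) \<in> borel_measurable borel \<and> (\<forall>t. \<psi> t \<in> A \<and> (\<forall>x\<in>A. w t x \<le> w t (\<psi> t)))"
  using assms
proof (induction A rule: finite_ne_induct)
  case (singleton a)
  thus ?case by (intro bexI[of _ "\<lambda>_. a"]) auto
next
  case (insert a A)
  have [measurable]: "(\<lambda>t. w t a) \<in> borel_measurable borel" using insert by auto
  obtain \<psi> where [measurable]: "\<psi> \<in> borel_measurable borel" "(\<lambda>t. w t (\<psi> t)) \<in> borel_measurable borel"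
    and \<psi>: "\<And>t. \<psi> t \<in> A" "\<And>t x. x \<in> A \<Longrightarrow> w t x \<le> w t (\<psi> t)"
    using insert by auto
  define \<phi> where "\<phi> = (\<lambda>t. if w t (\<psi> t) < w t a then a else \<psi> t)"
  have "\<phi> \<in> borel_measurable borel" unfolding \<phi>_def by measurable
  moreover have "(\<lambda>t. w t (\<phi> t)) \<in> borel_measurable borel"
  proof -
    have "(\<lambda>t. if w t (\<psi> t) < w t a then w t a else w t (\<psi> t)) \<in> borel_measurable borel" by measurable
    moreover have "(\<lambda>t. w t (\<phi> t)) = (\<lambda>t. if w t (\<psi> t) < w t a then w t a else w t (\<psi> t))"
      by (auto simp: \<phi>_def)
    ultimately show ?thesis by simp
  qed
  moreover have "\<phi> t \<in> insert a A \<and> (\<forall>x\<in>insert a A. w t x \<le> w t (\<phi> t))" for t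
    using \<psi>(1)[of t] \<psi>(2)[of _ t] unfolding \<phi>_def by (auto intro: order_trans[OF _ less_imp_le])
  ultimately show ?case by blast
qed

text \<open>One measurable majorant \<open>H\<close> of all fourth powers
  \<open>cmod (u t x) ^ 4\<close> is produced instead of a bound on the norm, since the other finite
  exponents q are obtained from the same \<open>H\<close> at each time. The constant is 33600 = 14 *
  2400, from \<open>strichartz_linearized\<close> and \<open>dispersive\<close>; the leftover factor
  \<open>1 / c^2\<close> is at most 1.\<close>

lemma strichartz_endpoint:
  assumes h: "h > 0" and g [measurable]: "g \<in> borel_measurable (lebesgue_on (torus h))"
    and N: "0 < N" "tnorm2 h g \<le> ennreal ((2 * pi)\<^sup>2 * N\<^sup>2)"
  obtains H where "H \<in> borel_measurable borel" "(\<integral>\<^sup>+t. H t \<partial>lborel) \<le> ennreal (33600\<^sup>2 * N ^ 4)"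
    "\<And>t x. x \<in> lattice h \<Longrightarrow> ennreal (cmod (fcoef h (\<lambda>\<xi>. cis (t * omega h \<xi> ^ 4) * g \<xi>) x) ^ 4) \<le> H t"
proof -
  let ?M = "lebesgue_on (torus h)"
  interpret finite_measure ?M by (rule finite_measure_torus)
  note [measurable] = omega_measurable[OF h]
  have id [measurable]: "(\<lambda>\<xi>. \<xi>) \<in> borel_measurable ?M" by (intro continuous_torus_measurable continuous_intros)
  define c where "c = (2 * pi)\<^sup>2"
  have c: "1 \<le> c" unfolding c_def using pi_ge_two by (intro one_le_power) auto
  define w where "w = (\<lambda>t x. cmod (LINT \<xi>|?M. cis (x \<bullet> \<xi> + t * omega h \<xi> ^ 4) * g \<xi>))"
  have w0: "0 \<le> w t x" for t x by (simp add: w_def)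
  have wm [measurable]: "(\<lambda>t. w t x) \<in> borel_measurable borel" for x
  proof -
    have "(\<lambda>(t, \<xi>). cis (x \<bullet> \<xi> + t * omega h \<xi> ^ 4) * g \<xi>) \<in> borel_measurable (borel \<Otimes>\<^sub>M ?M)" by measurable
    hence "(\<lambda>t. LINT \<xi>|?M. cis (x \<bullet> \<xi> + t * omega h \<xi> ^ 4) * g \<xi>) \<in> borel_measurable borel"
      by (rule borel_measurable_lebesgue_integral)
    thus ?thesis unfolding w_def by measurable
  qed
  \<comment> \<open>Finite sets exhausting the lattice: on each the maximum is attained at a point
    that can be chosen measurably in time. The time windows in \<open>F\<close> grow with the same
    index, so one monotone limit removes both truncations.\<close>
  define A where "A = (\<lambda>n. from_nat_into (lattice h) ` {..n})"
  have ne: "lattice h \<noteq> {}" unfolding lattice_def by blast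
  have "\<forall>n. \<exists>\<psi>\<in>borel_measurable borel. (\<lambda>t. w t (\<psi> t)) \<in> borel_measurable borel \<and> (\<forall>t. \<psi> t \<in> A n \<and> (\<forall>x\<in>A n. w t x \<le> w t (\<psi> t)))"
    by (intro allI measurable_argmax wm) (auto simp: A_def)
  then obtain \<psi> where \<psi>: "\<And>n. \<psi> n \<in> borel_measurable borel" "\<And>n. (\<lambda>t. w t (\<psi> n t)) \<in> borel_measurable borel"
    "\<And>n t. \<psi> n t \<in> A n" "\<And>n t x. x \<in> A n \<Longrightarrow> w t x \<le> w t (\<psi> n t)" by metis
  note [measurable] = \<psi>(1,2)
  define F where "F = (\<lambda>n t. ennreal (indicator {-real n..real n} t * w t (\<psi> n t) ^ 4))"
  have Fm [measurable]: "F n \<in> borel_measurable borel" for n unfolding F_def by measurable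
  have Fint: "(\<integral>\<^sup>+t. F n t \<partial>lborel) \<le> ennreal ((14 * 2400 * (c * N\<^sup>2))\<^sup>2)" for n
    unfolding F_def w_def
    by (rule strichartz_linearized[OF finite_measure_torus id omega_measurable[OF h] \<psi>(1) dispersive[OF h] _ g])
      (use N c in \<open>auto simp: c_def tnorm2_def\<close>)
  have inc: "incseq F"
  proof (intro incseq_SucI le_funI)
    fix n t
    have "w t (\<psi> n t) \<le> w t (\<psi> (Suc n) t)" using \<psi>(3)[of n t] by (intro \<psi>(4)) (auto simp: A_def)
    hence "w t (\<psi> n t) ^ 4 \<le> w t (\<psi> (Suc n) t) ^ 4" using w0 by (intro power_mono) auto
    thus "F n t \<le> F (Suc n) t" unfolding F_def using w0[of t "\<psi> (Suc n) t"]
      by (intro ennreal_leI) (auto simp: indicator_def)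
  qed
  define H where "H = (\<lambda>t. ennreal (1 / c^4) * (SUP n. F n t))"
  show ?thesis
  proof (rule that[of H])
    show "H \<in> borel_measurable borel" unfolding H_def by measurable
    have "(\<integral>\<^sup>+t. H t \<partial>lborel) = ennreal (1 / c^4) * (\<integral>\<^sup>+t. (SUP n. F n t) \<partial>lborel)"
      unfolding H_def by (rule nn_integral_cmult) measurable
    also have "(\<integral>\<^sup>+t. (SUP n. F n t) \<partial>lborel) = (SUP n. \<integral>\<^sup>+t. F n t \<partial>lborel)"
      by (rule nn_integral_monotone_convergence_SUP[OF inc]) measurable
    also have "ennreal (1 / c^4) * \<dots> \<le> ennreal (1 / c^4) * ennreal ((14 * 2400 * (c * N\<^sup>2))\<^sup>2)"
      by (intro mult_left_mono SUP_least Fint) auto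
    also have "\<dots> = ennreal (33600\<^sup>2 * N ^ 4 / c\<^sup>2)"
    proof -
      have "1 / c^4 * (14 * 2400 * (c * N\<^sup>2))\<^sup>2 = 33600\<^sup>2 * N ^ 4 / c\<^sup>2"
        using c by (simp add: field_simps power2_eq_square power4_eq_xxxx)
      moreover have "0 \<le> 1 / c^4" by simp
      ultimately show ?thesis by (metis ennreal_mult')
    qed
    also have "\<dots> \<le> ennreal (33600\<^sup>2 * N ^ 4)"
    proof (rule ennreal_leI)
      have "1 \<le> c\<^sup>2" using c by (rule one_le_power)
      thus "33600\<^sup>2 * N ^ 4 / c\<^sup>2 \<le> 33600\<^sup>2 * N ^ 4" using N by (simp add: divide_le_eq mult_le_cancel_left1)
    qed
    finally show "(\<integral>\<^sup>+t. H t \<partial>lborel) \<le> ennreal (33600\<^sup>2 * N ^ 4)" .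
    fix t x assume x: "x \<in> lattice h"
    obtain k where k: "x = from_nat_into (lattice h) k" using from_nat_into_surj[OF countable_lattice x] by metis
    obtain n0 :: nat where n0: "\<bar>t\<bar> \<le> real n0" using real_arch_simple by blast
    define n where "n = max k n0"
    have "x \<in> A n" by (auto simp: A_def k n_def)
    hence "w t x ^ 4 \<le> w t (\<psi> n t) ^ 4" using w0 by (intro power_mono \<psi>(4)) auto
    moreover have "t \<in> {-real n..real n}" using n0 by (auto simp: n_def)
    ultimately have "ennreal (w t x ^ 4) \<le> F n t" by (simp add: F_def ennreal_leI)
    also have "\<dots> \<le> (SUP n. F n t)" by (rule SUP_upper) simp
    finally have le: "ennreal (w t x ^ 4) \<le> (SUP n. F n t)" .
    have eq: "cis (x \<bullet> \<xi>) * (cis (t * omega h \<xi> ^ 4) * g \<xi>) = cis (x \<bullet> \<xi> + t * omega h \<xi> ^ 4) * g \<xi>" for \<xi>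
      by (simp add: cis_mult mult.assoc[symmetric])
    have "cmod (fcoef h (\<lambda>\<xi>. cis (t * omega h \<xi> ^ 4) * g \<xi>) x) = 1 / c * w t x"
      unfolding fcoef_def eq w_def norm_mult c_def by (simp add: norm_divide norm_power)
    hence "ennreal (cmod (fcoef h (\<lambda>\<xi>. cis (t * omega h \<xi> ^ 4) * g \<xi>) x) ^ 4) = ennreal (1 / c^4) * ennreal (w t x ^ 4)"
      using c w0[of t x] by (simp add: ennreal_mult[symmetric] power_divide)
    also have "\<dots> \<le> H t" unfolding H_def by (intro mult_left_mono le) auto
    finally show "ennreal (cmod (fcoef h (\<lambda>\<xi>. cis (t * omega h \<xi> ^ 4) * g \<xi>) x) ^ 4) \<le> H t" .
  qed
qed

text \<open>Bounding \<open>\<rho> - 2\<close> of the \<open>\<rho>\<close> factors by the supremum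
  leaves the mass, at most \<open>N^2\<close>. The exponent
  \<open>q / \<rho> = 4 / (\<rho> - 2)\<close> is what turns the supremum into its fourth power, and
  the mass then enters as \<open>N\<close> to the power
  \<open>8 / (\<rho> - 2) = q - 4\<close>.\<close>

lemma lattice_norm_interpolation:
  assumes h: "h > 0" and N: "0 < N" and \<eta>: "0 \<le> \<eta>" and sup: "\<And>x. x \<in> lattice h \<Longrightarrow> cmod (u x) ^ 4 \<le> \<eta>"
    and mass: "\<And>A. finite A \<Longrightarrow> A \<subseteq> lattice h \<Longrightarrow> h\<^sup>2 * (\<Sum>x\<in>A. (cmod (u x))\<^sup>2) \<le> N\<^sup>2"
    and qr: "(r = \<infinity> \<and> q = 4) \<or> (\<exists>\<rho>>2. r = ereal \<rho> \<and> q = 4 * \<rho> / (\<rho> - 2))"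
  shows "enn_powr (lattice_norm h r u) q \<le> ennreal (N powr (q - 4) * \<eta>)"
proof -
  define \<sigma> where "\<sigma> = \<eta> powr (1/4)"
  have \<sigma>: "0 \<le> \<sigma>" "\<sigma> powr 4 = \<eta>" using \<eta> by (auto simp: \<sigma>_def powr_powr)
  have u\<sigma>: "cmod (u x) \<le> \<sigma>" if "x \<in> lattice h" for x
  proof -
    have "(cmod (u x) ^ 4) powr (1/4) \<le> \<sigma>" unfolding \<sigma>_def using sup[OF that] by (intro powr_mono2) auto
    moreover have "(cmod (u x) ^ 4) powr (1/4) = cmod (u x)"
      by (subst powr_numeral[symmetric]) (simp_all add: powr_powr del: powr_numeral)
    ultimately show ?thesis by simp
  qed
  from qr show ?thesis
  proof
    assume r: "r = \<infinity> \<and> q = 4"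
    have "lattice_norm h r u \<le> ennreal \<sigma>"
      using r u\<sigma> by (auto simp: lattice_norm_def intro!: SUP_least ennreal_leI)
    hence "enn_powr (lattice_norm h r u) q \<le> enn_powr (ennreal \<sigma>) q" using r by (intro enn_powr_mono) auto
    thus ?thesis using r \<sigma> N by (simp add: enn_powr_ennreal)
  next
    assume "\<exists>\<rho>>2. r = ereal \<rho> \<and> q = 4 * \<rho> / (\<rho> - 2)"
    then obtain \<rho> where \<rho>: "2 < \<rho>" "r = ereal \<rho>" "q = 4 * \<rho> / (\<rho> - 2)" by blast
    define Z where "Z = \<sigma> powr (\<rho> - 2) * N\<^sup>2"
    have Z: "0 \<le> Z" by (simp add: Z_def)
    have "lattice_norm h (ereal \<rho>) u \<le> ennreal (Z powr (1 / \<rho>))"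
    proof (rule lattice_norm_le)
      fix A assume A: "finite A" "A \<subseteq> lattice h"
      have "cmod (u x) powr \<rho> \<le> \<sigma> powr (\<rho> - 2) * (cmod (u x))\<^sup>2" if "x \<in> A" for x
      proof -
        have "cmod (u x) powr \<rho> = cmod (u x) powr (\<rho> - 2) * cmod (u x) powr 2"
          unfolding powr_add[symmetric] by simp
        also have "\<dots> = cmod (u x) powr (\<rho> - 2) * (cmod (u x))\<^sup>2" by simp
        also have "\<dots> \<le> \<sigma> powr (\<rho> - 2) * (cmod (u x))\<^sup>2"
          using \<rho> u\<sigma> that A by (intro mult_right_mono powr_mono2) auto
        finally show ?thesis .
      qed
      hence "(\<Sum>x\<in>A. cmod (u x) powr \<rho>) \<le> (\<Sum>x\<in>A. \<sigma> powr (\<rho> - 2) * (cmod (u x))\<^sup>2)" by (rule sum_mono)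
      hence "h\<^sup>2 * (\<Sum>x\<in>A. cmod (u x) powr \<rho>) \<le> h\<^sup>2 * (\<Sum>x\<in>A. \<sigma> powr (\<rho> - 2) * (cmod (u x))\<^sup>2)"
        by (rule mult_left_mono) simp
      also have "\<dots> = \<sigma> powr (\<rho> - 2) * (h\<^sup>2 * (\<Sum>x\<in>A. (cmod (u x))\<^sup>2))"
        unfolding sum_distrib_left[symmetric] by (rule mult.left_commute)
      also have "\<dots> \<le> Z" unfolding Z_def by (intro mult_left_mono mass A) auto
      finally show "h\<^sup>2 * (\<Sum>x\<in>A. cmod (u x) powr \<rho>) \<le> Z" .
    qed (use \<rho> Z in auto)
    hence "enn_powr (lattice_norm h r u) q \<le> enn_powr (ennreal (Z powr (1 / \<rho>))) q"
      unfolding \<rho>(2) using \<rho> by (intro enn_powr_mono) auto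
    also have "\<dots> = ennreal (Z powr (4 / (\<rho> - 2)))"
      using \<rho> by (simp add: enn_powr_ennreal powr_powr)
    also have "Z powr (4 / (\<rho> - 2)) = (\<sigma> powr (\<rho> - 2)) powr (4 / (\<rho> - 2)) * (N\<^sup>2) powr (4 / (\<rho> - 2))"
      unfolding Z_def by (rule powr_mult)
    also have "(\<sigma> powr (\<rho> - 2)) powr (4 / (\<rho> - 2)) = \<eta>"
    proof -
      have "(\<rho> - 2) * (4 / (\<rho> - 2)) = 4" using \<rho>(1) by (simp add: divide_simps)
      thus ?thesis unfolding powr_powr using \<sigma>(2) by simp
    qed
    also have "(N\<^sup>2) powr (4 / (\<rho> - 2)) = N powr (q - 4)"
    proof -
      have "(N\<^sup>2) powr (4 / (\<rho> - 2)) = (N powr 2) powr (4 / (\<rho> - 2))" using N by simp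
      also have "\<dots> = N powr (2 * (4 / (\<rho> - 2)))" by (rule powr_powr)
      also have "2 * (4 / (\<rho> - 2)) = q - 4" using \<rho> by (simp add: field_simps)
      finally show ?thesis .
    qed
    finally show ?thesis by (simp add: mult.commute)
  qed
qed

text \<open>Solved for q, the relation reads q = 4 r / (r - 2), which decreases from infinity at r =
  2 to 4 at r = infinity.\<close>

lemma admissible_cases:
  assumes "admissible q r"
  obtains "q = \<infinity>" "r = 2"
  | q' where "q = ereal q'" "4 \<le> q'"
      "(r = \<infinity> \<and> q' = 4) \<or> (\<exists>\<rho>>2. r = ereal \<rho> \<and> q' = 4 * \<rho> / (\<rho> - 2))"
proof -
  have q: "2 \<le> q" and r: "2 \<le> r" and eq: "1 / q = 1 / 2 * (1 / 2 - 1 / r)"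
    using assms by (auto simp: admissible_def)
  note e = one_ereal_def numeral_eq_ereal
  show ?thesis
  proof (cases q)
    case PInf
    show ?thesis
    proof (cases r)
      case (real \<rho>)
      have "2 \<le> \<rho>" using r real by (simp add: e)
      moreover have "0 = 1 / 2 * (1 / 2 - 1 / \<rho>)" using eq PInf real \<open>2 \<le> \<rho>\<close> by (simp add: e zero_ereal_def)
      ultimately have "\<rho> = 2" by (simp add: field_simps)
      thus ?thesis using that(1) PInf real by (simp add: e)
    qed (use eq PInf r in \<open>simp_all add: e zero_ereal_def\<close>)
  next
    case q': (real q')
    have q2: "2 \<le> q'" using q q' by (simp add: e)
    show ?thesis
    proof (cases r)
      case (real \<rho>)
      have \<rho>: "2 \<le> \<rho>" using r real by (simp add: e)
      have "1 / q' = 1 / 2 * (1 / 2 - 1 / \<rho>)" using eq q' real \<rho> q2 by (simp add: e)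
      hence *: "4 * \<rho> = q' * (\<rho> - 2)" using \<rho> q2 by (simp add: field_simps)
      have "\<rho> \<noteq> 2" using * by auto
      hence \<rho>2: "2 < \<rho>" using \<rho> by simp
      hence q'eq: "q' = 4 * \<rho> / (\<rho> - 2)" using * by (simp add: field_simps)
      moreover have "4 \<le> q'" unfolding q'eq using \<rho>2 by (simp add: le_divide_eq)
      ultimately show ?thesis using that(2)[OF q'] real \<rho>2 by blast
    next
      case PInf
      have "1 / q' = 1 / 4" using eq q' PInf q2 by (simp add: e zero_ereal_def)
      hence "q' = 4" using q2 by (simp add: field_simps)
      thus ?thesis using that(2)[OF q'] PInf by auto
    qed (use r in simp)
  qed (use q in simp)
qed

lemma enn_powr_measurable [measurable]: "(\<lambda>x. enn_powr x a) \<in> borel_measurable borel"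
  unfolding enn_powr_def by measurable

text \<open>A supremum over the countably many finite subsets of the lattice. Measurability matters
  for q = infinity because \<open>esssup\<close> is top on nonmeasurable functions.\<close>

lemma lattice_norm_2_measurable:
  assumes "\<And>x. x \<in> lattice h \<Longrightarrow> (\<lambda>t. u t x) \<in> borel_measurable borel"
  shows "(\<lambda>t. lattice_norm h 2 (u t)) \<in> borel_measurable (borel :: real measure)"
proof -
  have cnt: "countable {F. finite F \<and> F \<subseteq> lattice h}"
    using countable_Collect_finite_subset[OF countable_lattice] .
  have "(\<lambda>t. SUP F\<in>{F. finite F \<and> F \<subseteq> lattice h}. \<Sum>x\<in>F. ennreal (cmod (u t x) powr real_of_ereal 2)) \<in> borel_measurable borel"
  proof (intro borel_measurable_SUP cnt borel_measurable_sum)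
    fix F x assume "F \<in> {F. finite F \<and> F \<subseteq> lattice h}" "x \<in> F"
    hence [measurable]: "(\<lambda>t. u t x) \<in> borel_measurable borel" using assms by auto
    show "(\<lambda>t. ennreal (cmod (u t x) powr real_of_ereal 2)) \<in> borel_measurable borel" by measurable
  qed
  hence [measurable]: "(\<lambda>t. \<Sum>\<^sub>\<infinity>x\<in>lattice h. ennreal (cmod (u t x) powr real_of_ereal 2)) \<in> borel_measurable borel"
    unfolding nonneg_infsum_complete[OF zero_le] .
  have "(\<lambda>t. enn_powr (ennreal (h\<^sup>2) * (\<Sum>\<^sub>\<infinity>x\<in>lattice h. ennreal (cmod (u t x) powr real_of_ereal 2))) (1 / real_of_ereal 2)) \<in> borel_measurable borel"
    by measurable
  thus ?thesis by (simp add: lattice_norm_def)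
qed

theorem theorem1p3:
  fixes q r :: ereal
  assumes "admissible q r"
  shows "\<exists>C::real. C > 0 \<and>
    (\<forall>h::real. 0 < h \<and> h \<le> 1 \<longrightarrow>
      (\<forall>f\<in>lattice_L2 h.
        spacetime_norm h q r (\<lambda>t. propagator h t f) \<le> ennreal C * lattice_norm h 2 f))"
proof (intro exI[of _ "33600\<^sup>2"] conjI allI impI ballI)
  fix h :: real and f assume h01: "0 < h \<and> h \<le> 1" and f: "f \<in> lattice_L2 h"
  hence h: "h > 0" by simp
  obtain N where N: "0 \<le> N" "lattice_norm h 2 f = ennreal N"
    "\<And>A. finite A \<Longrightarrow> A \<subseteq> lattice h \<Longrightarrow> h\<^sup>2 * (\<Sum>x\<in>A. (cmod (f x))\<^sup>2) \<le> N\<^sup>2"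
    "\<And>e. 0 < e \<Longrightarrow> \<exists>A. finite A \<and> A \<subseteq> lattice h \<and> N\<^sup>2 - e < h\<^sup>2 * (\<Sum>x\<in>A. (cmod (f x))\<^sup>2)"
    using lattice_L2_norm[OF h f] by metis
  obtain g where g: "has_fourier_L2 h f g" "tnorm2 h g \<le> ennreal ((2 * pi)\<^sup>2 * N\<^sup>2)"
    using fourier_L2_exists[OF h N(3,4)] by metis
  have gm: "g \<in> borel_measurable (lebesgue_on (torus h))" by (rule has_fourier_L2_finite_norm(1)[OF g(1)])
  define u where "u = (\<lambda>t. propagator h t f)"
  have u: "u t x = fcoef h (\<lambda>\<xi>. cis (t * omega h \<xi> ^ 4) * g \<xi>) x" if "x \<in> lattice h" for t x
    using that by (simp add: u_def propagator_eq[OF h g N(1)])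
  have mass: "h\<^sup>2 * (\<Sum>x\<in>A. (cmod (u t x))\<^sup>2) \<le> N\<^sup>2" if A: "finite A" "A \<subseteq> lattice h" for A t
  proof -
    have "(\<Sum>x\<in>A. (cmod (u t x))\<^sup>2) = (\<Sum>x\<in>A. (cmod (fcoef h (\<lambda>\<xi>. cis (t * omega h \<xi> ^ 4) * g \<xi>) x))\<^sup>2)"
      using A u by (intro sum.cong) auto
    moreover have "(\<lambda>\<xi>. cis (t * omega h \<xi> ^ 4) * g \<xi>) \<in> borel_measurable (lebesgue_on (torus h))"
      using trig_closure_measurable[OF trig_closure_propagator[OF h has_fourier_L2_trig_closure[OF g(1)]]] .
    ultimately show ?thesis
      using fcoef_mass_bound[OF h _ _ _ A, of "\<lambda>\<xi>. cis (t * omega h \<xi> ^ 4) * g \<xi>" "N\<^sup>2"] g(2)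
      by (simp add: tnorm2_propagator)
  qed
  have goal: "spacetime_norm h q r u \<le> ennreal (33600\<^sup>2 * N)"
    using assms
  proof (cases rule: admissible_cases)
    case 1
    have um: "(\<lambda>t. u t x) \<in> borel_measurable borel" if x: "x \<in> lattice h" for x
    proof -
      interpret finite_measure "lebesgue_on (torus h)" by (rule finite_measure_torus)
      note [measurable] = omega_measurable[OF h] gm
      have "(\<lambda>(t, \<xi>). cis (x \<bullet> \<xi>) * (cis (t * omega h \<xi> ^ 4) * g \<xi>)) \<in> borel_measurable (borel \<Otimes>\<^sub>M lebesgue_on (torus h))"
        by measurable
      hence "(\<lambda>t. LINT \<xi>|lebesgue_on (torus h). cis (x \<bullet> \<xi>) * (cis (t * omega h \<xi> ^ 4) * g \<xi>)) \<in> borel_measurable borel"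
        by (rule borel_measurable_lebesgue_integral)
      thus ?thesis unfolding u[OF x] fcoef_def by measurable
    qed
    have "lattice_norm h 2 (u t) \<le> ennreal N" for t by (intro lattice_norm_2_le N(1) mass)
    hence "esssup lborel (\<lambda>t. lattice_norm h 2 (u t)) \<le> ennreal N"
      using lattice_norm_2_measurable[OF um] by (intro esssup_I) auto
    also have "\<dots> \<le> ennreal (33600\<^sup>2 * N)" using N(1) by (intro ennreal_leI) simp
    finally show ?thesis using 1 by (simp add: spacetime_norm_def)
  next
    case (2 q')
    show ?thesis
    \<comment> \<open>The absorption behind \<open>strichartz_endpoint\<close> divides by the norm,
      so data of norm zero are treated apart.\<close>
    proof (cases "N = 0")
      case True
      have u0: "u t x = 0" if "x \<in> lattice h" for t x
        using mass[of "{x}" t] that True h by (simp add: mult_le_0_iff)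
      have "lattice_norm h r (u t) = 0" for t
      proof (cases "r = \<infinity>")
        case True
        have "(SUP x\<in>lattice h. ennreal (cmod (u t x))) \<le> 0" by (intro SUP_least) (simp add: u0)
        thus ?thesis using True by (simp add: lattice_norm_def)
      next
        case False
        then obtain \<rho> where "2 < \<rho>" "r = ereal \<rho>" using 2(3) by blast
        thus ?thesis using lattice_norm_le[of \<rho> 0 h "u t"] u0 by (simp add: subset_iff)
      qed
      thus ?thesis using 2 by (simp add: spacetime_norm_def enn_powr_def)
    next
      case False
      hence Np: "0 < N" using N(1) by simp
      obtain H where H [measurable]: "H \<in> borel_measurable borel" and HI: "(\<integral>\<^sup>+t. H t \<partial>lborel) \<le> ennreal (33600\<^sup>2 * N ^ 4)"
        and Hu: "\<And>t x. x \<in> lattice h \<Longrightarrow> ennreal (cmod (u t x) ^ 4) \<le> H t"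
        by (rule strichartz_endpoint[OF h gm Np g(2)]) (rule that; simp add: u)
      have pw: "enn_powr (lattice_norm h r (u t)) q' \<le> ennreal (N powr (q' - 4)) * H t" for t
      proof (cases "H t = \<infinity>")
        case True
        thus ?thesis using Np by (simp add: ennreal_mult_top)
      next
        case fin: False
        then obtain \<eta> where \<eta>: "H t = ennreal \<eta>" "0 \<le> \<eta>" by (cases "H t") auto
        have "enn_powr (lattice_norm h r (u t)) q' \<le> ennreal (N powr (q' - 4) * \<eta>)"
          using Hu[of _ t] \<eta> by (intro lattice_norm_interpolation[OF h Np \<eta>(2) _ mass 2(3)]) auto
        thus ?thesis using \<eta> by (simp add: ennreal_mult)
      qed
      have "(\<integral>\<^sup>+t. enn_powr (lattice_norm h r (u t)) q' \<partial>lborel) \<le> (\<integral>\<^sup>+t. ennreal (N powr (q' - 4)) * H t \<partial>lborel)"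
        by (intro nn_integral_mono pw)
      also have "\<dots> = ennreal (N powr (q' - 4)) * (\<integral>\<^sup>+t. H t \<partial>lborel)" by (rule nn_integral_cmult) measurable
      also have "\<dots> \<le> ennreal (N powr (q' - 4)) * ennreal (33600\<^sup>2 * N ^ 4)" by (intro mult_left_mono HI) auto
      also have "\<dots> = ennreal (33600\<^sup>2 * N powr q')"
      proof -
        have "N powr (q' - 4) * N ^ 4 = N powr q'"
          using Np powr_add[of N "q' - 4" 4] by simp
        thus ?thesis using Np by (simp add: ennreal_mult[symmetric] mult.left_commute)
      qed
      finally have "enn_powr (\<integral>\<^sup>+t. enn_powr (lattice_norm h r (u t)) q' \<partial>lborel) (1 / q')
          \<le> enn_powr (ennreal (33600\<^sup>2 * N powr q')) (1 / q')"
        using 2(2) by (intro enn_powr_mono) auto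
      also have "\<dots> = ennreal ((33600\<^sup>2) powr (1 / q') * N)"
        using Np 2(2) by (simp add: enn_powr_ennreal powr_mult powr_powr)
      \<comment> \<open>The base is at least 1 and \<open>1 / q'\<close> at most 1, so dropping the
        root gives one constant for all pairs.\<close>
      also have "\<dots> \<le> ennreal (33600\<^sup>2 * N)"
      proof (intro ennreal_leI mult_right_mono)
        have "(33600\<^sup>2 :: real) powr (1 / q') \<le> (33600\<^sup>2) powr 1" using 2(2) by (intro powr_mono) auto
        thus "(33600\<^sup>2 :: real) powr (1 / q') \<le> 33600\<^sup>2" by simp
      qed (use Np in simp)
      finally show ?thesis using 2(1) by (simp add: spacetime_norm_def)
    qed
  qed
  thus "spacetime_norm h q r (\<lambda>t. propagator h t f) \<le> ennreal (33600\<^sup>2) * lattice_norm h 2 f"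
    using N(1,2) by (simp add: u_def ennreal_mult)
qed simp

end
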